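(* Consider the repeated team-decision problem described in the context, and assume that: (1) $x_t$ and $v_t$ have finite covariance matrices $\mathbb{E}[x_tx_t^\top]=V_{xx}$, $\mathbb{E}[v_tv_t^\top]=V_{vv}$ and bounded fourth-order moments $\mathbb{E}[(x_t^\top x_t)^2]\le\kappa_x$, $\mathbb{E}[(v_t^\top v_t)^2]\le\kappa_v$; (2) $\sigma_{\min}(D^\top D)\left(\sigma_{\min}(CV_{xx}C^\top)+\sigma_{\min}(V_{vv})\right)>0$; (3) a bound $b_K$ on $\|K\|_2$ is supplied. Let $\alpha=2\sigma_{\min}(D^\top D)\left(\sigma_{\min}(CV_{xx}C^\top)+\sigma_{\min}(V_{vv})\right)$, let $0<\lambda\le\alpha$, and let $\eta_t=\frac{1}{\lambda t}$. Let the agents use the following partial-gradient algorithm: start from $K_1\in\mathcal{K}$ with $\|K_1\|_2\le b_K$; at each time step $t=1,\ldots,T$ every agent $i$ plays $u_i^t=K_i^ty_i^t$, the team incurs the loss $l_t(K_t)=z_t^\top z_t$, and every agent $i$ observes the partial gradient $G_i^t=2[D^\top]_iz_t(y_i^t)^\top$ and updates $$K_i^{t+1}=\Pi_{\{M\in\mathbb{R}^{m_i\times p_i}:\ \|M\|_2\le b_K\}}\left(K_i^t-\eta_tG_i^t\right).$$ Let $K^\star=\operatorname{argmin}_{K\in\mathcal{K},\,\|K\|_2\le b_K}\sum_{t=1}^Tl_t(K)$. Then the expected regret satisfies $$\sum_{t=1}^T\mathbb{E}\left[l_t(K_t)-l_t(K^\star)\right]\le\frac{b_G^2}{2\lambda}\left(1+\log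 T\right),$$ where $$b_G^2=4\|D\|_2^2\left(\|H\|_2+b_K\|D\|_2(\|C\|_2+1)\right)^2(\|C\|_2+1)^2\left(\kappa_x+2\operatorname{Tr}V_{xx}\operatorname{Tr}V_{vv}+\kappa_v\right).$$
   Context: Setting. There are $N$ agents; agent $i$ has measurement dimension $p_i$ and decision dimension $m_i$; $m=\sum_im_i$, $p=\sum_ip_i$. Fixed real matrices $H\in\mathbb{R}^{q\times n}$, $D\in\mathbb{R}^{q\times m}$ with $D^\top D$ positive definite, and $C\in\mathbb{R}^{p\times n}$ with block rows $C_i\in\mathbb{R}^{p_i\times n}$. At each time $t$, independently over time, $x_t\sim\mathcal{N}(0,V_{xx})$ in $\mathbb{R}^n$ and $v_t\sim\mathcal{N}(0,V_{vv})$ in $\mathbb{R}^p$ are sampled, independent of each other; $v_t$ has blocks $v_i^t\in\mathbb{R}^{p_i}$. Agent $i$ observes $y_i^t=C_ix_t+v_i^t$, so $y_t=Cx_t+v_t$. Let $$\mathcal{K}=\{K:K=\operatorname{Diag}(K_1,\ldots,K_N),\ K_i\in\mathbb{R}^{m_i\times p_i}\}$$ be the set of block-diagonal matrices. When the policy $K\in\mathcal{K}$ is played at time $t$, the decisions are $u_i^t=K_iy_i^t$, i.e. $u_t=Ky_t$, with $z_t=Hx_t+Du_t$ and loss $l_t(K)=\|z_t\|_2^2=\|Hx_t+DKy_t\|_2^2$. The policy at time $t$ is $K_t=\operatorname{Diag}(K_1^t,\ldots,K_N^t)$. Notation. For matrices, $\|\cdot\|_2$ is the operator norm; for vectors it is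 the Euclidean norm. $\sigma_{\min}$ is the smallest singular value. $[D^\top]_i\in\mathbb{R}^{m_i\times q}$ is the $i$-th block row of $D^\top$. $\Pi_S$ is the Euclidean (Frobenius-norm) projection onto a closed convex set $S$. *)

theory Defs
  imports "HOL-Probability.Probability"
begin

section \<open>Matrices\<close>

text \<open>
  The norm that the library puts on \<^typ>\<open>real^'n^'m\<close> is the Frobenius norm, so
  \<^const>\<open>closest_point\<close> on matrices is the Frobenius projection; the operator norm is
  written separately.
\<close>

definition opnorm :: "real^'n^'m \<Rightarrow> real" where
  "opnorm A = onorm ((*v) A)"

definition positive_semidefinite :: "real^'n^'n \<Rightarrow> bool" where
  "positive_semidefinite A \<longleftrightarrow> transpose A = A \<and> (\<forall>x. 0 \<le> x \<bullet> (A *v x))"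

definition positive_definite :: "real^'n^'n \<Rightarrow> bool" where
  "positive_definite A \<longleftrightarrow> transpose A = A \<and> (\<forall>x. x \<noteq> 0 \<longrightarrow> 0 < x \<bullet> (A *v x))"

text \<open>
  Singular values are the nonnegative square roots of the eigenvalues of the Gram matrix.
  They are only needed for square matrices; for these, every eigenvalue of the Gram matrix counts.
  The set is finite and nonempty.
\<close>

definition singular_values :: "real^'n^'n \<Rightarrow> real set" where
  "singular_values A =
     {s. 0 \<le> s \<and> (\<exists>x. x \<noteq> 0 \<and> (transpose A ** A) *v x = s\<^sup>2 *\<^sub>R x)}"

definition sigma_min :: "real^'n^'n \<Rightarrow> real" where
  "sigma_min A = Min (singular_values A)"

definition outer :: "real^'m \<Rightarrow> real^'n \<Rightarrow> real^'n^'m" where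
  "outer a b = (\<chi> r c. a $ r * b $ c)"


section \<open>Blocks\<close>

text \<open>
  The agents are the elements of a finite type \<open>'a\<close>, so their number is \<open>CARD('a)\<close>.
  The splitting of the coordinates of a stacked vector in \<^typ>\<open>real^'k\<close> into agents' blocks is
  given by a map \<open>own :: 'k \<Rightarrow> 'a\<close>: agent \<open>i\<close> owns the coordinates in \<open>own -` {i}\<close>, and its block
  dimension is the number of these, which may differ from agent to agent.
  A block is represented by its zero padding in the full space. This changes neither Euclidean,
  Frobenius and operator norms nor matrix products of blocks with matching inner ownership, and it
  makes stacking of blocks the same as summing them.
\<close>

definition block_vec :: "('k \<Rightarrow> 'a) \<Rightarrow> 'a \<Rightarrow> real^'k \<Rightarrow> real^'k" where
  "block_vec own i y = (\<chi> k. if own k = i then y $ k else 0)"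

definition block_row :: "('k \<Rightarrow> 'a) \<Rightarrow> 'a \<Rightarrow> real^'n^'k \<Rightarrow> real^'n^'k" where
  "block_row own i A = (\<chi> k. if own k = i then A $ k else 0)"

text \<open>This is the space of \<open>m\<^sub>i \<times> p\<^sub>i\<close> matrices.\<close>

definition block_space :: "('m \<Rightarrow> 'a) \<Rightarrow> ('p \<Rightarrow> 'a) \<Rightarrow> 'a \<Rightarrow> (real^'p^'m) set" where
  "block_space own_u own_y i =
     {A. \<forall>r c. \<not> (own_u r = i \<and> own_y c = i) \<longrightarrow> A $ r $ c = 0}"

definition Diag :: "('a::finite \<Rightarrow> real^'p^'m) \<Rightarrow> real^'p^'m" where
  "Diag Ks = (\<Sum>i\<in>UNIV. Ks i)"

definition block_diagonal :: "('m \<Rightarrow> 'a::finite) \<Rightarrow> ('p \<Rightarrow> 'a) \<Rightarrow> (real^'p^'m) set" where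
  "block_diagonal own_u own_y =
     {Diag Ks | Ks. \<forall>i. Ks i \<in> block_space own_u own_y i}"


section \<open>Gaussian vectors\<close>

text \<open>
  A random vector has law \<open>N(0, V)\<close> iff each linear functional \<open>a\<close> of it has the one-dimensional law
  \<open>N(0, a\<^sup>T V a)\<close>, which is a point mass if the variance vanishes. Singular \<open>V\<close> are thus included.
\<close>

definition normal_law :: "real \<Rightarrow> real \<Rightarrow> real measure" where
  "normal_law \<mu> \<sigma> =
     (if \<sigma> = 0 then return borel \<mu> else density lborel (\<lambda>s. ennreal (normal_density \<mu> \<sigma> s)))"

definition centered_gaussian :: "'w measure \<Rightarrow> real^'n^'n \<Rightarrow> ('w \<Rightarrow> real^'n) \<Rightarrow> bool" where
  "centered_gaussian P V X \<longleftrightarrow>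
     X \<in> borel_measurable P \<and> positive_semidefinite V \<and>
     (\<forall>a. distr P borel (\<lambda>w. a \<bullet> X w) = normal_law 0 (sqrt (a \<bullet> (V *v a))))"


text \<open>The library's \<open>indep_var\<close> requires both variables to have values in the same type.\<close>

definition independent_rv ::
    "'w measure \<Rightarrow> ('w \<Rightarrow> 'b::topological_space) \<Rightarrow> ('w \<Rightarrow> 'c::topological_space) \<Rightarrow> bool" where
  "independent_rv P X Y \<longleftrightarrow>
     X \<in> borel_measurable P \<and> Y \<in> borel_measurable P \<and>
     prob_space.indep_set P
       {X -` A \<inter> space P | A. A \<in> sets borel} {Y -` B \<inter> space P | B. B \<in> sets borel}"


section \<open>The team decision problem\<close>

definition observation :: "real^'n^'p \<Rightarrow> real^'n \<Rightarrow> real^'p \<Rightarrow> real^'p" where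
  "observation C x v = C *v x + v"

definition agent_observation ::
    "('p \<Rightarrow> 'a) \<Rightarrow> real^'n^'p \<Rightarrow> 'a \<Rightarrow> real^'n \<Rightarrow> real^'p \<Rightarrow> real^'p" where
  "agent_observation own_y C i x v = block_row own_y i C *v x + block_vec own_y i v"

definition loss ::
    "real^'n^'q \<Rightarrow> real^'m^'q \<Rightarrow> real^'n^'p \<Rightarrow> real^'n \<Rightarrow> real^'p \<Rightarrow> real^'p^'m \<Rightarrow> real" where
  "loss H D C x v K = (norm (H *v x + D *v (K *v observation C x v)))\<^sup>2"

text \<open>The outcome \<open>z = H x + D u\<close> when \<open>u\<close> stacks the agents' own decisions \<open>u\<^sub>i = K\<^sub>i y\<^sub>i\<close>:\<close>

definition outcome ::
    "('p \<Rightarrow> 'a::finite) \<Rightarrow> real^'n^'q \<Rightarrow> real^'m^'q \<Rightarrow> real^'n^'p \<Rightarrow> real^'n \<Rightarrow> real^'p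
      \<Rightarrow> ('a \<Rightarrow> real^'p^'m) \<Rightarrow> real^'q" where
  "outcome own_y H D C x v Ks =
     H *v x + D *v (\<Sum>i\<in>UNIV. Ks i *v agent_observation own_y C i x v)"

definition partial_gradient ::
    "('m \<Rightarrow> 'a::finite) \<Rightarrow> ('p \<Rightarrow> 'a) \<Rightarrow> real^'n^'q \<Rightarrow> real^'m^'q \<Rightarrow> real^'n^'p
      \<Rightarrow> real^'n \<Rightarrow> real^'p \<Rightarrow> ('a \<Rightarrow> real^'p^'m) \<Rightarrow> 'a \<Rightarrow> real^'p^'m" where
  "partial_gradient own_u own_y H D C x v Ks i =
     2 *\<^sub>R outer (block_row own_u i (transpose D) *v outcome own_y H D C x v Ks)
               (agent_observation own_y C i x v)"

lemma block_times_observation: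
  assumes "A \<in> block_space own_u own_y i"
  shows "A *v agent_observation own_y C i x v = A *v observation C x v"
  using assms
  by (auto simp: vec_eq_iff matrix_vector_mult_def agent_observation_def observation_def
        block_space_def block_row_def block_vec_def intro!: sum.cong)

lemma loss_Diag_eq_outcome:
  assumes "\<And>i. Ks i \<in> block_space own_u own_y i"
  shows "loss H D C x v (Diag Ks)
    = outcome own_y H D C x v Ks \<bullet> outcome own_y H D C x v Ks"
proof -
  have "Diag Ks *v y = (\<Sum>i\<in>UNIV. Ks i *v y)" for y
    by (simp add: Diag_def vec_eq_iff matrix_vector_mult_def sum_distrib_right
        sum.swap[where A = "UNIV :: 'a set"])
  then show ?thesis
    by (simp add: loss_def outcome_def power2_norm_eq_inner block_times_observation[OF assms])
qed

text \<open>Rounds are numbered from 1; \<open>Ks t i\<close> is the gain that agent \<open>i\<close> plays in round \<open>t\<close>.\<close>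

definition partial_gradient_run ::
    "('m \<Rightarrow> 'a::finite) \<Rightarrow> ('p \<Rightarrow> 'a) \<Rightarrow> real^'n^'q \<Rightarrow> real^'m^'q \<Rightarrow> real^'n^'p
      \<Rightarrow> real \<Rightarrow> (nat \<Rightarrow> real) \<Rightarrow> nat \<Rightarrow> (nat \<Rightarrow> real^'n) \<Rightarrow> (nat \<Rightarrow> real^'p)
      \<Rightarrow> ('a \<Rightarrow> real^'p^'m) \<Rightarrow> (nat \<Rightarrow> 'a \<Rightarrow> real^'p^'m) \<Rightarrow> bool" where
  "partial_gradient_run own_u own_y H D C b \<eta> T x v K1 Ks \<longleftrightarrow>
     Ks 1 = K1 \<and>
     (\<forall>t\<in>{1..T}. \<forall>i.
        Ks (Suc t) i =
          closest_point {A \<in> block_space own_u own_y i. opnorm A \<le> b}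
            (Ks t i - \<eta> t *\<^sub>R partial_gradient own_u own_y H D C (x t) (v t) (Ks t) i))"

end

theory Submission
  imports Defs "HOL-Real_Asymp.Real_Asymp"
begin

text \<open>
  Projected online gradient descent with step \<open>1 / (lam t)\<close> has regret at most \<open>b\<^sub>G_sq / (2 lam) * (1 + ln T)\<close>
  against a fixed gain, because the expected loss is strongly convex with modulus \<open>\<alpha>\<close>: the gain played in a
  round depends on earlier rounds only, so the conditional expectation of the squared increment of
  the outcome is at least \<open>\<alpha> / 2\<close> times the squared distance of the gains. The comparator \<open>Kstar\<close>, however, is
  the minimizer in hindsight and depends on the whole sample path. The standard argument says nothing
  about it, and the advantage of \<open>Kstar\<close> over the best gain \<open>K0\<close> for the expected loss has to fit
  into the same bound.

  Write \<open>f\<^sup>2\<close> for the expected loss of \<open>K0\<close>, \<open>a\<^sup>2\<close> for the obvious bound on the expected loss of any admissible gain, and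
  \<open>\<kappa> a\<^sup>2 = b\<^sub>G_sq / (2 lam)\<close>. Room for the hindsight advantage is gained by bounding the first round, and the initial
  distance of the descent that starts at the second round, by \<open>a\<^sup>2 - f\<^sup>2\<close> each
  (\<open>regret_against_best_fixed_gain\<close>): the regret against \<open>K0\<close> is at most
  \<open>2 (a\<^sup>2 - f\<^sup>2) + \<kappa> a\<^sup>2 (1/2 + ... + 1/T)\<close>.

  The hindsight advantage is bounded, uniformly in \<open>T\<close>, by \<open>\<kappa> f a\<close> (\<open>hindsight_gap\<close>). The excess loss of any gain over
  \<open>K0\<close> is a linear term plus a quadratic one, and both split over the agents. For each agent the linear
  term is regressed on the agent's observation. The residual is white noise given the observations
  (\<open>residual_white_noise\<close>), so least squares gains from it at most the number of regressors times its variance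
  (\<open>ridge_gain_expectation\<close>). What the regression explains vanishes unless \<open>K0\<close> lies on the boundary of the
  operator-norm ball; it fluctuates by the square root of \<open>T\<close>, but the curvature of the ball makes the expected
  loss grow quadratically in exactly these directions (\<open>opball_normal_cone\<close>), which again leaves a
  bounded gain (\<open>hindsight_gain\<close>).

  The constants fit because the Gaussian fourth moment that enters \<open>b\<^sub>G_sq\<close> exceeds the squared second
  moment sufficiently (\<open>fourth_moment_surplus\<close>), so that \<open>\<kappa>\<close> dominates both coefficients of the hindsight
  bound and \<open>\<kappa> \<ge> 2\<close>. The rest is \<open>1/2 + ... + 1/T \<le> ln T - 1/4\<close> and a completed square
  (\<open>regret_budget\<close>), for \<open>T \<ge> 3\<close>; for one or two rounds the regret is at most
  \<open>2 a\<^sup>2 \<le> \<kappa> a\<^sup>2\<close> anyway.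
\<close>

section \<open>Matrices as operators\<close>

lemma norm_matrix_vector_le_opnorm: "norm (A *v x) \<le> opnorm A * norm x" for A :: "real^'n^'m"
  unfolding opnorm_def by (rule onorm) simp

lemma opnorm_nonneg: "0 \<le> opnorm A" for A :: "real^'n^'m"
  unfolding opnorm_def by (rule onorm_pos_le) simp

lemma opnorm_le_iff: "opnorm A \<le> b \<longleftrightarrow> 0 \<le> b \<and> (\<forall>x. norm (A *v x) \<le> b * norm x)"
  for A :: "real^'n^'m"
proof
  assume *: "opnorm A \<le> b"
  have "norm (A *v x) \<le> b * norm x" for x
    using norm_matrix_vector_le_opnorm[of A x] mult_right_mono[OF *, of "norm x"] by simp
  moreover have "0 \<le> b" using * opnorm_nonneg[of A] by linarith
  ultimately show "0 \<le> b \<and> (\<forall>x. norm (A *v x) \<le> b * norm x)" by blast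
next
  assume "0 \<le> b \<and> (\<forall>x. norm (A *v x) \<le> b * norm x)"
  then show "opnorm A \<le> b" unfolding opnorm_def by (intro onorm_le) auto
qed

lemma norm_vector_matrix_le_opnorm: "norm (x v* A) \<le> opnorm A * norm x" for A :: "real^'n^'m"
proof (cases "x v* A = 0")
  case False
  have "(norm (x v* A))\<^sup>2 = x \<bullet> (A *v (x v* A))"
    by (simp add: power2_norm_eq_inner flip: dot_lmul_matrix)
  also have "\<dots> \<le> norm x * (opnorm A * norm (x v* A))"
    by (intro order.trans[OF norm_cauchy_schwarz] mult_left_mono norm_matrix_vector_le_opnorm) simp
  finally show ?thesis using False by (simp add: power2_eq_square mult.assoc mult.left_commute)
qed (simp add: opnorm_nonneg)

lemma outer_mult_vector: "outer a b *v x = (b \<bullet> x) *\<^sub>R a"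
  by (simp add: outer_def matrix_vector_mult_def vec_eq_iff inner_vec_def sum_distrib_left ac_simps)

lemma inner_outer: "outer a b \<bullet> M = a \<bullet> (M *v b)" for M :: "real^'n^'m"
  by (simp add: outer_def matrix_vector_mult_def inner_vec_def sum_distrib_left ac_simps)

lemma norm_outer: "norm (outer a b) = norm a * norm b" for a :: "real^'m" and b :: "real^'n"
proof -
  have "(norm (outer a b))\<^sup>2 = (norm a * norm b)\<^sup>2"
    by (simp add: power2_norm_eq_inner inner_outer outer_mult_vector power_mult_distrib)
  then show ?thesis by (simp add: power2_eq_iff_nonneg)
qed

lemma sum_matrix_vector_mult: "(\<Sum>i\<in>I. M i) *v x = (\<Sum>i\<in>I. M i *v x)" for M :: "'i \<Rightarrow> real^'n^'m"
  by (induction I rule: infinite_finite_induct) (simp_all add: matrix_vector_mult_add_rdistrib)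

lemma vector_matrix_diff: "x v* (A - B) = x v* A - x v* B" for A :: "real^'n^'m"
  by (simp add: vector_matrix_mult_def vec_eq_iff right_diff_distrib sum_subtractf)

lemma inner_matrix_mult_left: "G \<bullet> (B ** K) = (G ** transpose K) \<bullet> B"
  for G :: "real^'n^'m" and B :: "real^'k^'m" and K :: "real^'n^'k"
  apply (simp add: inner_vec_def matrix_matrix_mult_def transpose_def sum_distrib_left sum_distrib_right)
  apply (rule sum.cong[OF refl])
  apply (subst sum.swap)
  apply (simp add: ac_simps)
  done

lemma abs_component_le_opnorm: "\<bar>K $ r $ c\<bar> \<le> opnorm K" for K :: "real^'n^'m"
proof -
  have "K $ r $ c = (K *v axis c 1) $ r"
    by (simp add: matrix_vector_mul_component inner_axis)
  then have "\<bar>K $ r $ c\<bar> \<le> norm (K *v axis c 1)" by (metis component_le_norm_cart)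
  also have "\<dots> \<le> opnorm K" using norm_matrix_vector_le_opnorm[of K "axis c 1"] by simp
  finally show ?thesis .
qed

section \<open>Positive semidefinite matrices\<close>

lemma quadratic_root_zero:
  fixes B :: "real^'n^'n"
  assumes sym: "transpose B = B" and nn: "\<And>x. 0 \<le> x \<bullet> (B *v x)" and z: "x \<bullet> (B *v x) = 0"
  shows "B *v x = 0"
proof (rule ccontr)
  define g where "g = B *v x"
  assume "B *v x \<noteq> 0"
  then have gpos: "0 < g \<bullet> g" by (simp add: g_def)
  have s: "x \<bullet> (B *v g) = g \<bullet> g"
    by (metis dot_lmul_matrix g_def sym transpose_matrix_vector)
  have main: "0 \<le> - 2 * s * (g \<bullet> g) + s\<^sup>2 * (g \<bullet> (B *v g))" for s
    using nn[of "x - s *\<^sub>R g"] z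
    by (simp add: matrix_vector_mult_diff_distrib inner_diff_left inner_diff_right s g_def[symmetric]
        inner_commute[of x g] power2_eq_square algebra_simps matrix_vector_mult_scaleR)
  define q where "q = g \<bullet> (B *v g)"
  have "q \<ge> 0" using nn q_def by simp
  define s where "s = (g \<bullet> g) / (q + 1)"
  have "s > 0" using gpos \<open>q \<ge> 0\<close> by (simp add: s_def)
  have "s * q \<le> g \<bullet> g" using \<open>q \<ge> 0\<close> gpos by (simp add: s_def field_simps)
  have "s * (s * q) \<le> s * (g \<bullet> g)" using \<open>s > 0\<close> \<open>s * q \<le> g \<bullet> g\<close> by simp
  with main[of s] have "s * (g \<bullet> g) \<le> 0" by (simp add: q_def[symmetric] power2_eq_square)
  moreover have "0 < s * (g \<bullet> g)" using \<open>s > 0\<close> gpos by (rule mult_pos_pos)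
  ultimately show False by linarith
qed

text \<open>
  A minimizer of the quadratic form on the sphere is an eigenvector: after subtracting the minimum the
  form is semidefinite and vanishes at the minimizer.
\<close>

lemma symmetric_min_eigenvector:
  fixes A :: "real^'n^'n"
  assumes sym: "transpose A = A"
  obtains x \<mu> where "norm x = 1" "A *v x = \<mu> *\<^sub>R x" "\<And>y. \<mu> * (norm y)\<^sup>2 \<le> y \<bullet> (A *v y)"
proof -
  have "compact (sphere (0::real^'n) 1)" by simp
  moreover have "sphere (0::real^'n) 1 \<noteq> {}" by simp
  moreover have "continuous_on (sphere (0::real^'n) 1) (\<lambda>x. x \<bullet> (A *v x))"
    by (intro continuous_intros)
  ultimately obtain x where x: "norm x = 1" and
    min: "\<And>y. norm y = 1 \<Longrightarrow> x \<bullet> (A *v x) \<le> y \<bullet> (A *v y)"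
    using continuous_attains_inf[of "sphere (0::real^'n) 1" "\<lambda>x. x \<bullet> (A *v x)"]
    by (force simp: dist_norm)
  define \<mu> where "\<mu> = x \<bullet> (A *v x)"
  have low: "\<mu> * (norm y)\<^sup>2 \<le> y \<bullet> (A *v y)" for y
  proof (cases "y = 0")
    case False
    have "\<mu> \<le> ((1 / norm y) *\<^sub>R y) \<bullet> (A *v ((1 / norm y) *\<^sub>R y))"
      unfolding \<mu>_def by (rule min) (use False in simp)
    then show ?thesis
      using False by (simp add: matrix_vector_mult_scaleR field_simps power2_eq_square)
  qed simp
  define B where "B = A - \<mu> *\<^sub>R mat 1"
  have Bv: "B *v y = A *v y - \<mu> *\<^sub>R y" for y
    by (simp add: B_def matrix_vector_mult_diff_rdistrib flip: scaleR_matrix_vector_assoc)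
  have "transpose B = B"
    using sym by (simp add: B_def transpose_def vec_eq_iff mat_def)
  moreover have "0 \<le> y \<bullet> (B *v y)" for y
    using low[of y] by (simp add: Bv inner_diff_right power2_norm_eq_inner)
  moreover have "x \<bullet> (B *v x) = 0"
    using x by (simp add: Bv inner_diff_right \<mu>_def dot_square_norm)
  ultimately have "B *v x = 0" by (rule quadratic_root_zero)
  then have "A *v x = \<mu> *\<^sub>R x" by (simp add: Bv)
  with x low that show ?thesis by blast
qed

text \<open>Eigenvectors of the Gram matrix for distinct eigenvalues are orthogonal, hence finitely many.\<close>

lemma finite_singular_values: "finite (singular_values A)" for A :: "real^'n^'n"
proof -
  define G where "G = transpose A ** A"
  have symG: "transpose G = G" by (simp add: G_def matrix_transpose_mul)
  define v where "v s = (SOME x. x \<noteq> 0 \<and> G *v x = s\<^sup>2 *\<^sub>R x)" for s :: real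
  have v: "v s \<noteq> 0" "G *v v s = s\<^sup>2 *\<^sub>R v s" if "s \<in> singular_values A" for s
    using that someI_ex[of "\<lambda>x. x \<noteq> 0 \<and> G *v x = s\<^sup>2 *\<^sub>R x"]
    unfolding v_def singular_values_def G_def by auto
  have orth: "v s \<bullet> v t = 0" if "s \<in> singular_values A" "t \<in> singular_values A" "s \<noteq> t" for s t
  proof -
    have "s\<^sup>2 * (v s \<bullet> v t) = (G *v v s) \<bullet> v t" using v that by simp
    also have "\<dots> = v s \<bullet> (G *v v t)"
      by (metis dot_lmul_matrix symG transpose_matrix_vector)
    also have "\<dots> = t\<^sup>2 * (v s \<bullet> v t)" using v that by simp
    finally have "(s\<^sup>2 - t\<^sup>2) * (v s \<bullet> v t) = 0" by (simp add: algebra_simps)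
    moreover have "s\<^sup>2 \<noteq> t\<^sup>2"
      using that by (auto simp: singular_values_def power2_eq_iff_nonneg)
    ultimately show ?thesis by simp
  qed
  have inj: "inj_on v (singular_values A)"
    using orth v by (force simp: inj_on_def)
  have "pairwise orthogonal (v ` singular_values A)"
    using orth by (auto simp: pairwise_def orthogonal_def)
  moreover have "0 \<notin> v ` singular_values A" using v by force
  ultimately have "finite (v ` singular_values A)"
    using independent_bound pairwise_orthogonal_independent by blast
  with inj show ?thesis using finite_imageD by blast
qed

text \<open>
  For a positive semidefinite matrix the least eigenvalue is itself a singular value, and it is the
  minimum of the quadratic form on the unit sphere.
\<close>

lemma sigma_min_quadratic_form:
  fixes A :: "real^'n^'n"
  assumes "positive_semidefinite A"
  shows "0 \<le> sigma_min A" "sigma_min A * (norm x)\<^sup>2 \<le> x \<bullet> (A *v x)"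
proof -
  have sym: "transpose A = A" and nn: "\<And>x. 0 \<le> x \<bullet> (A *v x)"
    using assms by (auto simp: positive_semidefinite_def)
  obtain x0 \<mu> where x0: "norm x0 = 1" "A *v x0 = \<mu> *\<^sub>R x0"
    and low: "\<And>y. \<mu> * (norm y)\<^sup>2 \<le> y \<bullet> (A *v y)"
    using symmetric_min_eigenvector[OF sym] by blast
  have "\<mu> = x0 \<bullet> (A *v x0)" using x0 by (simp add: dot_square_norm)
  then have "\<mu> \<ge> 0" using nn by simp
  have "(transpose A ** A) *v x0 = \<mu>\<^sup>2 *\<^sub>R x0"
    using x0 by (simp add: sym power2_eq_square matrix_vector_mult_scaleR flip: matrix_vector_mul_assoc)
  then have mem: "\<mu> \<in> singular_values A"
    using x0 \<open>\<mu> \<ge> 0\<close> by (auto simp: singular_values_def intro!: exI[of _ x0])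
  have fin: "finite (singular_values A)" by (rule finite_singular_values)
  have "sigma_min A \<in> singular_values A"
    unfolding sigma_min_def using mem fin by (intro Min_in) auto
  then show "0 \<le> sigma_min A" by (simp add: singular_values_def)
  have "sigma_min A \<le> \<mu>" unfolding sigma_min_def using mem fin by simp
  then have "sigma_min A * (norm x)\<^sup>2 \<le> \<mu> * (norm x)\<^sup>2" by (intro mult_right_mono) auto
  with low[of x] show "sigma_min A * (norm x)\<^sup>2 \<le> x \<bullet> (A *v x)" by linarith
qed

lemma psd_offdiag_zero:
  fixes A :: "real^'n^'n"
  assumes psd: "positive_semidefinite A" and z: "A $ i $ i = 0"
  shows "A $ j $ i = 0" and "A $ i $ j = 0"
proof -
  have "axis i 1 \<bullet> (A *v axis i 1) = 0"
    using z by (simp add: inner_axis' matrix_vector_mul_component inner_axis)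
  then have "A *v axis i 1 = 0"
    using psd by (intro quadratic_root_zero) (auto simp: positive_semidefinite_def)
  then show 1: "A $ j $ i = 0" for j
  proof -
    have "(A *v axis i 1) $ j = A $ j $ i" by (simp add: matrix_vector_mul_component inner_axis)
    then show ?thesis using \<open>A *v axis i 1 = 0\<close> by simp
  qed
  have "transpose A $ i $ j = A $ i $ j" using psd by (simp add: positive_semidefinite_def)
  then show "A $ i $ j = 0" using 1[of j] by (simp add: transpose_def)
qed

text \<open>Elimination of one row and column at a time, as in the Cholesky factorization.\<close>

lemma psd_sum_of_outer:
  fixes A :: "real^'n^'n"
  assumes "positive_semidefinite A"
  shows "\<exists>(a::nat \<Rightarrow> real^'n) n. A = (\<Sum>k<n. outer (a k) (a k))"
  using assms
proof (induction A rule: measure_induct_rule[where f = "\<lambda>A. card {i. A $ i $ i \<noteq> 0}"])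
  case (less A)
  note psd = less.prems
  show ?case
  proof (cases "\<exists>i. A $ i $ i \<noteq> 0")
    case False
    have "A $ j $ i = 0" for i j
      using psd_offdiag_zero(1)[OF psd, of i j] False by simp
    then show ?thesis
      by (intro exI[of _ "\<lambda>_. 0"] exI[of _ "0::nat"]) (simp add: vec_eq_iff)
  next
    case True
    then obtain i where i: "A $ i $ i \<noteq> 0" by blast
    have "transpose A $ c $ r = A $ c $ r" for r c
      using psd by (simp add: positive_semidefinite_def)
    then have sym: "A $ r $ c = A $ c $ r" for r c by (simp add: transpose_def)
    have nn: "0 \<le> x \<bullet> (A *v x)" for x using psd by (simp add: positive_semidefinite_def)
    have "axis i 1 \<bullet> (A *v axis i 1) = A $ i $ i"
      by (simp add: inner_axis' matrix_vector_mul_component inner_axis)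
    with nn[of "axis i 1"] i have pos: "A $ i $ i > 0" by simp
    define g where "g = A $ i"
    define a0 where "a0 = (1 / sqrt (A $ i $ i)) *\<^sub>R g"
    have gA: "g = A *v axis i 1"
      using sym[of i] by (simp add: g_def vec_eq_iff matrix_vector_mul_component inner_axis)
    define A' where "A' = A - outer a0 a0"
    have A'rc: "A' $ r $ c = A $ r $ c - A $ i $ r * A $ i $ c / A $ i $ i" for r c
      using pos by (simp add: A'_def outer_def a0_def g_def)
    have quad: "x \<bullet> (A' *v x) = x \<bullet> (A *v x) - (g \<bullet> x)\<^sup>2 / A $ i $ i" for x
      using pos by (simp add: A'_def matrix_vector_mult_diff_rdistrib inner_diff_right
          outer_mult_vector a0_def power2_eq_square inner_commute[of x])
    have "positive_semidefinite A'"
      unfolding positive_semidefinite_def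
    proof safe
      show "transpose A' = A'"
        using sym by (simp add: transpose_def vec_eq_iff A'rc mult.commute)
    next
      fix x
      define s where "s = (g \<bullet> x) / A $ i $ i"
      have gx: "axis i 1 \<bullet> (A *v x) = g \<bullet> x"
        by (simp add: inner_axis' matrix_vector_mul_component g_def)
      have xg: "x \<bullet> (A *v axis i 1) = g \<bullet> x" by (simp add: gA[symmetric] inner_commute)
      have "0 \<le> (x - s *\<^sub>R axis i 1) \<bullet> (A *v (x - s *\<^sub>R axis i 1))" by (rule nn)
      also have "\<dots> = x \<bullet> (A *v x) - 2 * s * (g \<bullet> x) + s\<^sup>2 * A $ i $ i"
        using \<open>axis i 1 \<bullet> (A *v axis i 1) = A $ i $ i\<close>
        by (simp add: matrix_vector_mult_diff_distrib matrix_vector_mult_scaleR inner_diff_left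
            inner_diff_right gx xg power2_eq_square algebra_simps)
      also have "\<dots> = x \<bullet> (A' *v x)"
        using pos by (simp add: quad s_def power2_eq_square field_simps)
      finally show "0 \<le> x \<bullet> (A' *v x)" .
    qed
    moreover have "{j. A' $ j $ j \<noteq> 0} \<subset> {j. A $ j $ j \<noteq> 0}"
    proof -
      have "A' $ i $ i = 0" using pos by (simp add: A'rc)
      moreover have "A' $ j $ j = 0" if "A $ j $ j = 0" for j
        using that psd_offdiag_zero(2)[OF psd that, of i] psd_offdiag_zero(1)[OF psd that, of i]
        by (simp only: A'rc)
      ultimately show ?thesis using i by blast
    qed
    then have "card {j. A' $ j $ j \<noteq> 0} < card {j. A $ j $ j \<noteq> 0}"
      by (intro psubset_card_mono) auto
    ultimately obtain a :: "nat \<Rightarrow> real^'n" and n where a: "A' = (\<Sum>k<n. outer (a k) (a k))"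
      using less.IH[of A'] by force
    show ?thesis
      by (intro exI[of _ "a(n := a0)"] exI[of _ "Suc n"]) (simp add: A'_def algebra_simps flip: a)
  qed
qed

section \<open>Normal cone of the operator-norm ball\<close>

text \<open>
  A direction \<open>M\<close> along which the squared operator norm grows only to second order is feasible to
  first order: shrinking \<open>K0 + s M\<close> back into the ball costs \<open>O(s\<^sup>2)\<close>.
\<close>

lemma opball_tangent_direction:
  fixes K0 \<Gamma> M :: "real^'n^'m"
  assumes b: "b > 0"
    and opt: "\<And>K. opnorm K \<le> b \<Longrightarrow> 0 \<le> \<Gamma> \<bullet> (K - K0)"
    and growth: "\<And>s x. s > 0 \<Longrightarrow> (norm ((K0 + s *\<^sub>R M) *v x))\<^sup>2 \<le> b\<^sup>2 * (1 + c * s\<^sup>2) * (norm x)\<^sup>2"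
    and c: "c \<ge> 0"
  shows "0 \<le> \<Gamma> \<bullet> M"
proof -
  have ineq: "c * (\<Gamma> \<bullet> K0) * s \<le> \<Gamma> \<bullet> M" if s: "s > 0" for s
  proof -
    define d where "d = 1 + c * s\<^sup>2"
    have d: "d \<ge> 1" using c by (simp add: d_def)
    have "norm (((1 / d) *\<^sub>R (K0 + s *\<^sub>R M)) *v x) \<le> b * norm x" for x
    proof -
      have "(norm ((K0 + s *\<^sub>R M) *v x))\<^sup>2 \<le> b\<^sup>2 * d * (norm x)\<^sup>2"
        using growth[OF s] by (simp add: d_def)
      also have "\<dots> \<le> b\<^sup>2 * (d * d) * (norm x)\<^sup>2"
        using d by (intro mult_right_mono mult_left_mono) auto
      also have "\<dots> = (d * (b * norm x))\<^sup>2" by (simp add: power2_eq_square)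
      finally have "norm ((K0 + s *\<^sub>R M) *v x) \<le> d * (b * norm x)"
        by (rule power2_le_imp_le) (use b d in auto)
      then show ?thesis using d by (simp add: divide_simps mult.commute flip: scaleR_matrix_vector_assoc)
    qed
    then have "0 \<le> \<Gamma> \<bullet> ((1 / d) *\<^sub>R (K0 + s *\<^sub>R M) - K0)"
      using b by (intro opt) (simp add: opnorm_le_iff)
    then have "0 \<le> d * (\<Gamma> \<bullet> ((1 / d) *\<^sub>R (K0 + s *\<^sub>R M) - K0))"
      using d by (intro mult_nonneg_nonneg) auto
    also have "\<dots> = \<Gamma> \<bullet> K0 + s * (\<Gamma> \<bullet> M) - d * (\<Gamma> \<bullet> K0)"
      using d by (simp add: inner_diff_right inner_add_right field_simps)
    also have "\<dots> = s * (\<Gamma> \<bullet> M - c * (\<Gamma> \<bullet> K0) * s)"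
      by (simp add: d_def power2_eq_square algebra_simps)
    finally show ?thesis using s by (simp add: zero_le_mult_iff)
  qed
  have "((\<lambda>s. c * (\<Gamma> \<bullet> K0) * s) \<longlongrightarrow> c * (\<Gamma> \<bullet> K0) * 0) (at_right 0)"
    by (intro tendsto_intros)
  then show ?thesis
    using ineq by (intro tendsto_upperbound[of "\<lambda>s. c * (\<Gamma> \<bullet> K0) * s"])
      (auto simp: eventually_at_right_less intro: eventually_mono[OF eventually_at_right_less])
qed

text \<open>
  A normal direction of the ball at \<open>K0\<close> sees only the right singular vectors of \<open>K0\<close> with singular value \<open>b\<close>. The
  factor \<open>R = b\<^sup>2 - K0\<^sup>T K0\<close> damps a perturbation near these vectors, so each \<open>B R\<close> and its negative are feasible to
  first order, and \<open>\<Gamma> R = 0\<close>.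
\<close>

lemma opball_normal_annihilates:
  fixes K0 \<Gamma> :: "real^'n^'m"
  assumes b: "b > 0" and K0: "opnorm K0 \<le> b"
    and opt: "\<And>K. opnorm K \<le> b \<Longrightarrow> 0 \<le> \<Gamma> \<bullet> (K - K0)"
  shows "\<Gamma> ** (transpose K0 ** K0) = b\<^sup>2 *\<^sub>R \<Gamma>"
proof -
  define R where "R = b\<^sup>2 *\<^sub>R mat 1 - transpose K0 ** K0"
  have symR: "transpose R = R"
    by (simp add: R_def transpose_def vec_eq_iff mat_def matrix_matrix_mult_def mult.commute)
  have Rx: "R *v x = b\<^sup>2 *\<^sub>R x - (K0 *v x) v* K0" for x
    by (simp add: R_def matrix_vector_mult_diff_rdistrib flip: scaleR_matrix_vector_assoc matrix_vector_mul_assoc)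
  have K0x: "norm (K0 *v x) \<le> b * norm x" for x using K0 by (simp add: opnorm_le_iff)
  have Rquad: "(norm (R *v x))\<^sup>2 \<le> b\<^sup>2 * (b\<^sup>2 * (norm x)\<^sup>2 - (norm (K0 *v x))\<^sup>2)" for x
  proof -
    have "norm ((K0 *v x) v* K0) \<le> b * norm (K0 *v x)"
      using norm_vector_matrix_le_opnorm[of "K0 *v x" K0] mult_right_mono[OF K0, of "norm (K0 *v x)"] by simp
    then have "(norm ((K0 *v x) v* K0))\<^sup>2 \<le> b\<^sup>2 * (norm (K0 *v x))\<^sup>2"
      using power_mono[of _ _ 2] by (fastforce simp: power_mult_distrib)
    moreover have "x \<bullet> ((K0 *v x) v* K0) = (norm (K0 *v x))\<^sup>2"
      by (simp add: dot_lmul_matrix inner_commute[of x] power2_norm_eq_inner)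
    ultimately show ?thesis
      by (simp add: Rx power2_norm_eq_inner inner_diff_left inner_diff_right algebra_simps
          inner_commute[of "(K0 *v x) v* K0" x] power2_eq_square[of b])
  qed
  have main: "0 \<le> \<Gamma> \<bullet> (B ** R)" for B
  proof -
    show ?thesis
    proof (rule opball_tangent_direction[OF b opt])
      show "0 \<le> 2 * b\<^sup>2 * (opnorm B)\<^sup>2" by simp
      fix s :: real and x :: "real^'n"
      assume s: "s > 0"
      define k r where "k = norm (K0 *v x)" and "r = norm (R *v x)"
      have r2: "r\<^sup>2 \<le> b\<^sup>2 * (b\<^sup>2 * (norm x)\<^sup>2 - k\<^sup>2)" using Rquad by (simp add: k_def r_def)
      have Bx: "norm (B *v (R *v x)) \<le> opnorm B * r" by (simp add: r_def norm_matrix_vector_le_opnorm)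
      have kx: "k \<le> b * norm x" using K0x by (simp add: k_def)
      have "r\<^sup>2 \<le> (b * b * norm x)\<^sup>2"
      proof -
        have "b\<^sup>2 * (b\<^sup>2 * (norm x)\<^sup>2 - k\<^sup>2) \<le> b\<^sup>2 * (b\<^sup>2 * (norm x)\<^sup>2)"
          by (intro mult_left_mono) auto
        with r2 show ?thesis by (simp add: power_mult_distrib power2_eq_square[of b] mult.assoc)
      qed
      have "norm ((K0 + s *\<^sub>R (B ** R)) *v x) \<le> k + s * (opnorm B * r)"
        using Bx s unfolding matrix_vector_mult_add_rdistrib k_def
        by (intro order.trans[OF norm_triangle_ineq])
          (simp flip: scaleR_matrix_vector_assoc matrix_vector_mul_assoc)
      then have "(norm ((K0 + s *\<^sub>R (B ** R)) *v x))\<^sup>2 \<le> (k + s * (opnorm B * r))\<^sup>2"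
        by (intro power_mono) auto
      also have "\<dots> = k\<^sup>2 + 2 * (s * opnorm B * k) * r + s\<^sup>2 * (opnorm B)\<^sup>2 * r\<^sup>2"
        by (simp add: power2_eq_square algebra_simps)
      also have "2 * (s * opnorm B * k) * r \<le> (b * (s * opnorm B * k))\<^sup>2 + (r / b)\<^sup>2"
        using b sum_squares_bound[of "b * (s * opnorm B * k)" "r / b"] by simp
      also have "(r / b)\<^sup>2 \<le> b\<^sup>2 * (norm x)\<^sup>2 - k\<^sup>2"
        using r2 b by (simp add: power_divide field_simps)
      also have "(b * (s * opnorm B * k))\<^sup>2 \<le> (b * (s * opnorm B * (b * norm x)))\<^sup>2"
        using kx b s by (intro power_mono mult_left_mono) (auto simp: k_def opnorm_nonneg)
      also have "s\<^sup>2 * (opnorm B)\<^sup>2 * r\<^sup>2 \<le> s\<^sup>2 * (opnorm B)\<^sup>2 * (b * b * norm x)\<^sup>2"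
        by (intro mult_left_mono) (use \<open>r\<^sup>2 \<le> (b * b * norm x)\<^sup>2\<close> in auto)
      finally have "(norm ((K0 + s *\<^sub>R (B ** R)) *v x))\<^sup>2
          \<le> b\<^sup>2 * (norm x)\<^sup>2 + 2 * (s\<^sup>2 * (opnorm B)\<^sup>2 * (b * b * norm x)\<^sup>2)"
        by (simp add: power2_eq_square algebra_simps)
      also have "\<dots> = b\<^sup>2 * (1 + 2 * b\<^sup>2 * (opnorm B)\<^sup>2 * s\<^sup>2) * (norm x)\<^sup>2"
        by (simp add: power2_eq_square algebra_simps)
      finally show "(norm ((K0 + s *\<^sub>R (B ** R)) *v x))\<^sup>2
          \<le> b\<^sup>2 * (1 + (2 * b\<^sup>2 * (opnorm B)\<^sup>2) * s\<^sup>2) * (norm x)\<^sup>2" .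
    qed
  qed
  have "\<Gamma> \<bullet> (B ** R) = (\<Gamma> ** R) \<bullet> B" for B
    using inner_matrix_mult_left[of \<Gamma> B R] symR by simp
  with main[of "- (\<Gamma> ** R)"] have "(\<Gamma> ** R) \<bullet> (\<Gamma> ** R) \<le> 0" by simp
  then have "\<Gamma> ** R = 0" by (metis inner_eq_zero_iff inner_ge_zero order_antisym)
  then have "(\<Gamma> ** R) *v x = 0" for x by simp
  then have "\<Gamma> *v (R *v x) = 0" for x by (simp add: matrix_vector_mul_assoc)
  then show ?thesis
    by (simp add: matrix_eq R_def matrix_vector_mult_diff_rdistrib matrix_vector_mult_diff_distrib
        matrix_vector_mult_scaleR flip: scaleR_matrix_vector_assoc matrix_vector_mul_assoc)
qed

text \<open>
  First-order optimality over the operator-norm ball, with the curvature of the ball made explicit.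
  The multiplier is \<open>\<Lambda> = - \<Gamma> K0\<^sup>T / (2 b\<^sup>2)\<close>; it is positive semidefinite, \<open>\<Gamma> = - 2 \<Lambda> K0\<close>, and
  writing \<open>\<Lambda>\<close> as a sum of dyads \<open>a a\<^sup>T\<close> turns \<open>\<Gamma> \<bullet> (K - K0)\<close> into a sum of squares plus a nonnegative
  slack. That quadratic growth is what absorbs the random fluctuation of the gradient in the
  directions in which \<open>K0\<close> is pressed against the ball.
\<close>

lemma opball_normal_cone:
  fixes K0 \<Gamma> :: "real^'n^'m"
  assumes b: "b > 0" and K0: "opnorm K0 \<le> b"
    and opt: "\<And>K. opnorm K \<le> b \<Longrightarrow> 0 \<le> \<Gamma> \<bullet> (K - K0)"
  obtains a :: "nat \<Rightarrow> real^'m" and n where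
    "\<Gamma> = - 2 *\<^sub>R (\<Sum>k<n. outer (a k) (a k v* K0))"
    "(\<Sum>k<n. (norm (a k v* K0))\<^sup>2) = - (\<Gamma> \<bullet> K0) / 2"
    "\<And>K. opnorm K \<le> b \<Longrightarrow> (\<Sum>k<n. (norm (a k v* (K - K0)))\<^sup>2) \<le> \<Gamma> \<bullet> (K - K0)"
proof -
  have K0x: "norm (K0 *v x) \<le> b * norm x" for x using K0 by (simp add: opnorm_le_iff)
  have b2: "b\<^sup>2 > 0" using b by simp
  define G where "G = \<Gamma> ** transpose K0"
  define \<beta> where "\<beta> = - (1 / (2 * b\<^sup>2))"
  define \<Lambda> where "\<Lambda> = \<beta> *\<^sub>R G"
  have \<beta>: "\<beta> \<le> 0" "\<beta> * b\<^sup>2 = - (1 / 2)" using b by (auto simp: \<beta>_def)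
  \<comment> \<open>a skew \<open>B\<close> rotates: \<open>K0 + s B K0\<close> grows only to second order in \<open>s\<close>\<close>
  have skew: "0 \<le> G \<bullet> B" if B: "\<And>y. y \<bullet> (B *v y) = 0" for B
  proof -
    have "0 \<le> \<Gamma> \<bullet> (B ** K0)"
    proof (rule opball_tangent_direction[OF b opt])
      show "0 \<le> (opnorm B)\<^sup>2" by simp
      fix s :: real and x :: "real^'n"
      assume s: "s > 0"
      define k where "k = K0 *v x"
      have k: "norm k \<le> b * norm x" using K0x by (simp add: k_def)
      have "norm (B *v k) \<le> opnorm B * (b * norm x)"
        using norm_matrix_vector_le_opnorm[of B k] mult_left_mono[OF k opnorm_nonneg[of B]] by linarith
      then have Bk: "(norm (B *v k))\<^sup>2 \<le> (opnorm B)\<^sup>2 * (b\<^sup>2 * (norm x)\<^sup>2)"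
        using power_mono[of _ _ 2] by (fastforce simp: power_mult_distrib)
      have k2: "(norm k)\<^sup>2 \<le> b\<^sup>2 * (norm x)\<^sup>2"
        using power_mono[OF k, of 2] by (simp add: power_mult_distrib)
      have "(norm ((K0 + s *\<^sub>R (B ** K0)) *v x))\<^sup>2 = (norm k)\<^sup>2 + s\<^sup>2 * (norm (B *v k))\<^sup>2"
        using B[of k]
        by (simp add: matrix_vector_mult_add_rdistrib k_def[symmetric] power2_norm_eq_inner inner_add_left
            inner_add_right inner_commute[of "B *v k" k] power2_eq_square[of s]
            flip: scaleR_matrix_vector_assoc matrix_vector_mul_assoc)
      also have "\<dots> \<le> b\<^sup>2 * (norm x)\<^sup>2 + s\<^sup>2 * ((opnorm B)\<^sup>2 * (b\<^sup>2 * (norm x)\<^sup>2))"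
        using k2 Bk by (intro add_mono mult_left_mono) auto
      finally show "(norm ((K0 + s *\<^sub>R (B ** K0)) *v x))\<^sup>2 \<le> b\<^sup>2 * (1 + (opnorm B)\<^sup>2 * s\<^sup>2) * (norm x)\<^sup>2"
        by (simp add: algebra_simps)
    qed
    then show ?thesis by (simp add: inner_matrix_mult_left G_def)
  qed
  have symG: "transpose G = G"
  proof -
    define B where "B = transpose G - G"
    have "y \<bullet> (B *v y) = 0" for y
      by (simp add: B_def matrix_vector_mult_diff_rdistrib inner_diff_right dot_lmul_matrix inner_commute[of y])
    then have "0 \<le> G \<bullet> B" by (rule skew)
    moreover have "G \<bullet> transpose G = transpose G \<bullet> G" by (simp add: inner_commute)
    moreover have "transpose G \<bullet> transpose G = G \<bullet> G"
      by (simp add: inner_vec_def transpose_def) (rule sum.swap)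
    ultimately have "B \<bullet> B \<le> 0" by (simp add: B_def inner_diff_left inner_diff_right)
    then have "B = 0" by (metis inner_eq_zero_iff inner_ge_zero order_antisym)
    then show ?thesis by (simp add: B_def)
  qed
  have neg: "u \<bullet> (G *v u) \<le> 0" for u
  proof -
    have "0 \<le> \<Gamma> \<bullet> (- outer u u ** K0)"
    proof (rule opball_tangent_direction[OF b opt])
      show "0 \<le> (norm u) ^ 4" by simp
      fix s :: real and x :: "real^'n"
      assume s: "s > 0"
      define k where "k = K0 *v x"
      have k: "norm k \<le> b * norm x" using K0x by (simp add: k_def)
      have k2: "(norm k)\<^sup>2 \<le> b\<^sup>2 * (norm x)\<^sup>2"
        using power_mono[OF k, of 2] by (simp add: power_mult_distrib)
      have uk: "(u \<bullet> k)\<^sup>2 \<le> (norm u)\<^sup>2 * (norm k)\<^sup>2"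
        using Cauchy_Schwarz_ineq[of u k] by (simp add: power2_norm_eq_inner)
      have uminus: "(- outer u u) *v y = - (outer u u *v y)" for y
        by (simp add: matrix_vector_mult_def vec_eq_iff sum_negf)
      have eq: "(K0 + s *\<^sub>R (- outer u u ** K0)) *v x = k - (s * (u \<bullet> k)) *\<^sub>R u"
        by (simp add: matrix_vector_mult_add_rdistrib k_def[symmetric] outer_mult_vector uminus
            flip: scaleR_matrix_vector_assoc matrix_vector_mul_assoc)
      have "(norm ((K0 + s *\<^sub>R (- outer u u ** K0)) *v x))\<^sup>2
          = (norm k)\<^sup>2 - 2 * s * (u \<bullet> k)\<^sup>2 + s\<^sup>2 * (norm u)\<^sup>2 * (u \<bullet> k)\<^sup>2"
        unfolding eq
        by (simp add: power2_norm_eq_inner inner_diff_left inner_diff_right inner_commute[of k u]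
            power2_eq_square[of s] power2_eq_square[of "u \<bullet> k"] algebra_simps)
      also have "\<dots> \<le> (norm k)\<^sup>2 + s\<^sup>2 * (norm u)\<^sup>2 * ((norm u)\<^sup>2 * (norm k)\<^sup>2)"
      proof -
        have "0 \<le> 2 * s * (u \<bullet> k)\<^sup>2" using s by simp
        moreover have "s\<^sup>2 * (norm u)\<^sup>2 * (u \<bullet> k)\<^sup>2 \<le> s\<^sup>2 * (norm u)\<^sup>2 * ((norm u)\<^sup>2 * (norm k)\<^sup>2)"
          by (rule mult_left_mono[OF uk]) simp
        ultimately show ?thesis by linarith
      qed
      also have "\<dots> = (1 + (norm u)^4 * s\<^sup>2) * (norm k)\<^sup>2"
        by (simp add: algebra_simps power2_eq_square power4_eq_xxxx)
      also have "\<dots> \<le> (1 + (norm u)^4 * s\<^sup>2) * (b\<^sup>2 * (norm x)\<^sup>2)"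
        using k2 by (intro mult_left_mono) auto
      finally show "(norm ((K0 + s *\<^sub>R (- outer u u ** K0)) *v x))\<^sup>2
          \<le> b\<^sup>2 * (1 + (norm u)^4 * s\<^sup>2) * (norm x)\<^sup>2" by (simp add: algebra_simps)
    qed
    also have "\<Gamma> \<bullet> (- outer u u ** K0) = - (G \<bullet> outer u u)"
      by (simp only: inner_matrix_mult_left G_def inner_minus_right)
    finally show ?thesis by (simp add: inner_commute[of G] inner_outer)
  qed
  have "positive_semidefinite \<Lambda>"
    unfolding positive_semidefinite_def
  proof safe
    have "transpose \<Lambda> = \<beta> *\<^sub>R transpose G" by (simp add: \<Lambda>_def transpose_def vec_eq_iff)
    then show "transpose \<Lambda> = \<Lambda>" by (simp add: symG \<Lambda>_def)
  next
    fix x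
    show "0 \<le> x \<bullet> (\<Lambda> *v x)"
      using neg[of x] \<beta> by (simp add: \<Lambda>_def mult_nonpos_nonpos flip: scaleR_matrix_vector_assoc)
  qed
  then obtain a :: "nat \<Rightarrow> real^'m" and n where a: "\<Lambda> = (\<Sum>k<n. outer (a k) (a k))"
    using psd_sum_of_outer by blast
  have "\<Lambda> ** K0 = \<beta> *\<^sub>R (\<Gamma> ** (transpose K0 ** K0))"
    by (simp add: matrix_eq \<Lambda>_def G_def flip: scaleR_matrix_vector_assoc matrix_vector_mul_assoc)
  also have "\<dots> = - (1 / 2) *\<^sub>R \<Gamma>"
    by (simp only: opball_normal_annihilates[OF b K0 opt] scaleR_scaleR \<beta>)
  finally have \<Gamma>1: "\<Gamma> = - 2 *\<^sub>R (\<Lambda> ** K0)" by simp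
  have dyad: "outer c c ** K0 = outer c (c v* K0)" for c
    by (simp add: outer_def matrix_matrix_mult_def vector_matrix_mult_def vec_eq_iff sum_distrib_left ac_simps)
  have "\<Lambda> ** K0 = (\<Sum>k<n. outer (a k) (a k v* K0))"
    unfolding a by (simp flip: dyad add: matrix_matrix_mult_def vec_eq_iff sum_distrib_right)
      (subst sum.swap, simp)
  with \<Gamma>1 have \<Gamma>: "\<Gamma> = - 2 *\<^sub>R (\<Sum>k<n. outer (a k) (a k v* K0))" by simp
  have \<Gamma>inner: "\<Gamma> \<bullet> M = - 2 * (\<Sum>k<n. (a k v* M) \<bullet> (a k v* K0))" for M
    by (simp add: \<Gamma> inner_sum_left inner_outer dot_lmul_matrix)
  have E: "(\<Sum>k<n. (norm (a k v* K0))\<^sup>2) = - (\<Gamma> \<bullet> K0) / 2"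
    by (simp add: \<Gamma>inner power2_norm_eq_inner)
  have slack: "b\<^sup>2 * (\<Sum>k<n. (norm (a k))\<^sup>2) = (\<Sum>k<n. (norm (a k v* K0))\<^sup>2)"
  proof -
    have "(\<Sum>k<n. (norm (a k))\<^sup>2) = \<Lambda> \<bullet> mat 1"
      by (simp add: a inner_sum_left inner_outer power2_norm_eq_inner)
    also have "\<dots> = \<beta> * (G \<bullet> mat 1)" by (simp add: \<Lambda>_def)
    also have "G \<bullet> mat 1 = \<Gamma> \<bullet> K0"
      unfolding G_def by (simp flip: inner_matrix_mult_left)
    finally have "b\<^sup>2 * (\<Sum>k<n. (norm (a k))\<^sup>2) = (\<beta> * b\<^sup>2) * (\<Gamma> \<bullet> K0)" by simp
    then show ?thesis unfolding \<beta> E by simp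
  qed
  have "(\<Sum>k<n. (norm (a k v* (K - K0)))\<^sup>2) \<le> \<Gamma> \<bullet> (K - K0)" if K: "opnorm K \<le> b" for K
  proof -
    have "norm (a k v* K) \<le> b * norm (a k)" for k
      using norm_vector_matrix_le_opnorm[of "a k" K] mult_right_mono[OF K, of "norm (a k)"] by simp
    then have "(norm (a k v* K))\<^sup>2 \<le> b\<^sup>2 * (norm (a k))\<^sup>2" for k
      using power_mono[of _ _ 2] by (fastforce simp: power_mult_distrib)
    then have "(\<Sum>k<n. (norm (a k v* K))\<^sup>2) \<le> (\<Sum>k<n. (norm (a k v* K0))\<^sup>2)"
      by (simp flip: slack add: sum_distrib_left) (rule sum_mono)
    moreover have "(norm (a k v* (K - K0)))\<^sup>2
        = (norm (a k v* K))\<^sup>2 + (norm (a k v* K0))\<^sup>2 - 2 * ((a k v* K) \<bullet> (a k v* K0))" for k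
      by (simp add: vector_matrix_diff power2_norm_eq_inner inner_diff_left inner_diff_right inner_commute)
    ultimately show ?thesis
      by (simp add: inner_diff_right \<Gamma>inner sum.distrib sum_subtractf power2_norm_eq_inner flip: sum_distrib_left)
  qed
  with \<Gamma> E that show ?thesis by blast
qed

section \<open>Ridge regression\<close>

definition ridge_matrix :: "real \<Rightarrow> nat set \<Rightarrow> (nat \<Rightarrow> real^'p) \<Rightarrow> real^'p^'p" where
  "ridge_matrix \<rho> I \<eta> = \<rho> *\<^sub>R mat 1 + (\<Sum>t\<in>I. outer (\<eta> t) (\<eta> t))"

text \<open>The inverse of the ridge matrix by Cramer's rule, which shows that it depends measurably on the data.\<close>

definition ridge_solve :: "real \<Rightarrow> nat set \<Rightarrow> (nat \<Rightarrow> real^'p) \<Rightarrow> real^'p \<Rightarrow> real^'p" where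
  "ridge_solve \<rho> I \<eta> y =
     (\<chi> k. det (\<chi> i j. if j = k then y $ i else ridge_matrix \<rho> I \<eta> $ i $ j) / det (ridge_matrix \<rho> I \<eta>))"

lemma ridge_matrix_mult: "ridge_matrix \<rho> I \<eta> *v x = \<rho> *\<^sub>R x + (\<Sum>t\<in>I. (\<eta> t \<bullet> x) *\<^sub>R \<eta> t)"
  by (simp add: ridge_matrix_def matrix_vector_mult_add_rdistrib sum_matrix_vector_mult outer_mult_vector
      flip: scaleR_matrix_vector_assoc)

lemma ridge_matrix_quadratic: "x \<bullet> (ridge_matrix \<rho> I \<eta> *v x) = \<rho> * (norm x)\<^sup>2 + (\<Sum>t\<in>I. (\<eta> t \<bullet> x)\<^sup>2)"
  by (simp add: ridge_matrix_mult inner_add_right inner_sum_right power2_norm_eq_inner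
      power2_eq_square[of "_ \<bullet> _"] inner_commute)

lemma ridge_matrix_sym: "x \<bullet> (ridge_matrix \<rho> I \<eta> *v y) = (ridge_matrix \<rho> I \<eta> *v x) \<bullet> y"
  by (simp add: ridge_matrix_mult inner_add_right inner_add_left inner_sum_right inner_sum_left
      inner_commute[of x] ac_simps)

lemma ridge_matrix_inj:
  assumes "\<rho> > 0" "ridge_matrix \<rho> I \<eta> *v x = 0"
  shows "x = 0"
proof -
  have "\<rho> * (norm x)\<^sup>2 + (\<Sum>t\<in>I. (\<eta> t \<bullet> x)\<^sup>2) = 0"
    using ridge_matrix_quadratic[of x \<rho> I \<eta>] assms by simp
  moreover have "(\<Sum>t\<in>I. (\<eta> t \<bullet> x)\<^sup>2) \<ge> 0" by (intro sum_nonneg) simp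
  moreover have "\<rho> * (norm x)\<^sup>2 \<ge> 0" using assms by simp
  ultimately have "\<rho> * (norm x)\<^sup>2 = 0" by linarith
  then show ?thesis using assms by simp
qed

lemma ridge_solve:
  assumes "\<rho> > 0"
  shows "ridge_matrix \<rho> I \<eta> *v ridge_solve \<rho> I \<eta> y = y"
proof -
  have "invertible (ridge_matrix \<rho> I \<eta>)"
    unfolding invertible_left_inverse matrix_left_invertible_ker
    using ridge_matrix_inj[OF assms] by blast
  then have "det (ridge_matrix \<rho> I \<eta>) \<noteq> 0" by (simp add: invertible_det_nz)
  then show ?thesis unfolding ridge_solve_def by (simp add: cramer)
qed

lemma ridge_solve_unique:
  assumes "\<rho> > 0" "ridge_matrix \<rho> I \<eta> *v x = y"
  shows "ridge_solve \<rho> I \<eta> y = x"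
proof -
  have "ridge_matrix \<rho> I \<eta> *v (ridge_solve \<rho> I \<eta> y - x) = 0"
    by (simp only: matrix_vector_mult_diff_distrib ridge_solve[OF assms(1)] assms(2) diff_self)
  from ridge_matrix_inj[OF assms(1) this] show ?thesis by simp
qed

lemma ridge_solve_sum:
  assumes "\<rho> > 0"
  shows "ridge_solve \<rho> I \<eta> (\<Sum>t\<in>J. e t *\<^sub>R y t) = (\<Sum>t\<in>J. e t *\<^sub>R ridge_solve \<rho> I \<eta> (y t))"
proof (rule ridge_solve_unique[OF assms])
  have "ridge_matrix \<rho> I \<eta> *v (\<Sum>t\<in>J. e t *\<^sub>R ridge_solve \<rho> I \<eta> (y t))
      = (\<Sum>t\<in>J. ridge_matrix \<rho> I \<eta> *v (e t *\<^sub>R ridge_solve \<rho> I \<eta> (y t)))"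
    by (rule linear_sum[OF matrix_vector_mul_linear])
  also have "\<dots> = (\<Sum>t\<in>J. e t *\<^sub>R y t)"
    by (simp only: matrix_vector_mult_scaleR ridge_solve[OF assms])
  finally show "ridge_matrix \<rho> I \<eta> *v (\<Sum>t\<in>J. e t *\<^sub>R ridge_solve \<rho> I \<eta> (y t))
      = (\<Sum>t\<in>J. e t *\<^sub>R y t)" .
qed

text \<open>
  The entries of the hat matrix \<open>\<eta>\<^sub>s\<^sup>T N\<^sup>-\<^sup>1 \<eta>\<^sub>t\<close>. A diagonal entry is at least the sum of the squares of its
  row, hence at most one; so are then the others.
\<close>

lemma ridge_hat_bound:
  assumes "\<rho> > 0" "finite I" "s \<in> I" "t \<in> I"
  shows "\<bar>\<eta> s \<bullet> ridge_solve \<rho> I \<eta> (\<eta> t)\<bar> \<le> 1"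
proof -
  define n where "n = ridge_solve \<rho> I \<eta> (\<eta> t)"
  have q: "n \<bullet> \<eta> t = \<rho> * (norm n)\<^sup>2 + (\<Sum>t\<in>I. (\<eta> t \<bullet> n)\<^sup>2)"
    unfolding ridge_matrix_quadratic[symmetric] by (simp add: n_def ridge_solve[OF assms(1)])
  have le: "(\<eta> r \<bullet> n)\<^sup>2 \<le> n \<bullet> \<eta> t" if "r \<in> I" for r
  proof -
    have "(\<eta> r \<bullet> n)\<^sup>2 \<le> (\<Sum>t\<in>I. (\<eta> t \<bullet> n)\<^sup>2)"
      by (rule member_le_sum[OF that]) (use assms in auto)
    moreover have "\<rho> * (norm n)\<^sup>2 \<ge> 0" using assms by simp
    ultimately show ?thesis using q by linarith
  qed
  define h where "h = n \<bullet> \<eta> t"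
  have "h\<^sup>2 \<le> h" using le[OF assms(4)] by (simp add: h_def inner_commute)
  have "h \<le> 1"
  proof (rule ccontr)
    assume "\<not> h \<le> 1"
    then have "h * 1 < h * h" by (intro mult_strict_left_mono) auto
    with \<open>h\<^sup>2 \<le> h\<close> show False by (simp add: power2_eq_square)
  qed
  with le[OF assms(3)] have "(\<eta> s \<bullet> n)\<^sup>2 \<le> 1" by (simp add: h_def)
  then show ?thesis by (simp add: n_def abs_square_le_1)
qed

text \<open>The effective number of degrees of freedom of a ridge regression is at most the dimension.\<close>

lemma ridge_hat_trace:
  fixes \<eta> :: "nat \<Rightarrow> real^'p"
  assumes "\<rho> > 0"
  shows "(\<Sum>t\<in>I. \<eta> t \<bullet> ridge_solve \<rho> I \<eta> (\<eta> t)) \<le> real CARD('p)"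
proof -
  define S where "S = ridge_solve \<rho> I \<eta>"
  have S_add: "S (x + y) = S x + S y" and S_scale: "S (c *\<^sub>R x) = c *\<^sub>R S x" for x y c
    unfolding S_def
    by (rule ridge_solve_unique[OF assms],
        simp add: ridge_solve[OF assms] matrix_vector_right_distrib matrix_vector_mult_scaleR)+
  have col: "\<rho> * S (axis c 1) $ c + (\<Sum>t\<in>I. \<eta> t $ c * S (\<eta> t) $ c) = 1" for c
  proof -
    have "axis c 1 = S (ridge_matrix \<rho> I \<eta> *v axis c 1)"
      unfolding S_def by (rule ridge_solve_unique[OF assms refl, symmetric])
    also have "\<dots> = \<rho> *\<^sub>R S (axis c 1) + S (\<Sum>t\<in>I. (\<eta> t $ c) *\<^sub>R \<eta> t)"
      by (simp add: ridge_matrix_mult S_add S_scale inner_axis)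
    also have "S (\<Sum>t\<in>I. (\<eta> t $ c) *\<^sub>R \<eta> t) = (\<Sum>t\<in>I. (\<eta> t $ c) *\<^sub>R S (\<eta> t))"
      unfolding S_def by (rule ridge_solve_sum[OF assms])
    finally have "axis c (1::real) $ c = (\<rho> *\<^sub>R S (axis c 1) + (\<Sum>t\<in>I. (\<eta> t $ c) *\<^sub>R S (\<eta> t))) $ c"
      by simp
    then show ?thesis by simp
  qed
  have nn: "S (axis c 1) $ c \<ge> 0" for c
  proof -
    have "S (axis c 1) $ c = S (axis c 1) \<bullet> (ridge_matrix \<rho> I \<eta> *v S (axis c 1))"
      by (simp add: S_def ridge_solve[OF assms] inner_axis)
    also have "\<dots> \<ge> 0" unfolding ridge_matrix_quadratic
      using assms by (intro add_nonneg_nonneg sum_nonneg) auto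
    finally show ?thesis .
  qed
  have "(\<Sum>t\<in>I. \<eta> t \<bullet> S (\<eta> t)) = (\<Sum>c\<in>UNIV. \<Sum>t\<in>I. \<eta> t $ c * S (\<eta> t) $ c)"
    unfolding inner_vec_def by (subst sum.swap) simp
  also have "\<dots> = (\<Sum>c\<in>(UNIV::'p set). 1 - \<rho> * S (axis c 1) $ c)"
    by (intro sum.cong refl) (metis add_diff_cancel_left' col)
  also have "\<dots> \<le> (\<Sum>c\<in>(UNIV::'p set). 1)"
    using nn assms by (intro sum_mono) simp
  finally show ?thesis by (simp add: S_def)
qed

text \<open>Completing the square in a ridge regression with target \<open>-e\<close>.\<close>

lemma ridge_lower_bound:
  fixes \<eta> :: "nat \<Rightarrow> real^'p"
  assumes "\<rho> > 0" "c > 0"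
  shows "- (\<Sum>s\<in>I. \<Sum>t\<in>I. e s * e t * (\<eta> s \<bullet> ridge_solve \<rho> I \<eta> (\<eta> t))) / c - c * \<rho> * (norm d)\<^sup>2
    \<le> (\<Sum>t\<in>I. 2 * e t * (d \<bullet> \<eta> t) + c * (d \<bullet> \<eta> t)\<^sup>2)"
proof -
  let ?N = "ridge_matrix \<rho> I \<eta>"
  define w where "w = (\<Sum>t\<in>I. e t *\<^sub>R \<eta> t)"
  define n where "n = ridge_solve \<rho> I \<eta> w"
  have Nn: "?N *v n = w" by (simp add: n_def ridge_solve[OF assms(1)])
  have wn: "w \<bullet> n = (\<Sum>s\<in>I. \<Sum>t\<in>I. e s * e t * (\<eta> s \<bullet> ridge_solve \<rho> I \<eta> (\<eta> t)))"
    unfolding n_def w_def ridge_solve_sum[OF assms(1)]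
    by (simp add: inner_sum_left inner_sum_right sum_distrib_left mult.assoc)
      (subst sum.swap, simp add: mult.left_commute)
  have "0 \<le> (c *\<^sub>R d + n) \<bullet> (?N *v (c *\<^sub>R d + n))"
    unfolding ridge_matrix_quadratic using assms by (intro add_nonneg_nonneg sum_nonneg) auto
  also have "\<dots> = c\<^sup>2 * (d \<bullet> (?N *v d)) + 2 * c * (d \<bullet> w) + w \<bullet> n"
    using ridge_matrix_sym[of n \<rho> I \<eta> d]
    by (simp add: matrix_vector_right_distrib matrix_vector_mult_scaleR Nn inner_add_left inner_add_right
        power2_eq_square inner_commute algebra_simps)
  also have "d \<bullet> (?N *v d) = \<rho> * (norm d)\<^sup>2 + (\<Sum>t\<in>I. (d \<bullet> \<eta> t)\<^sup>2)"
    by (simp add: ridge_matrix_quadratic inner_commute)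
  also have "d \<bullet> w = (\<Sum>t\<in>I. e t * (d \<bullet> \<eta> t))" by (simp add: w_def inner_sum_right)
  finally have "0 \<le> c * (c * \<rho> * (norm d)\<^sup>2 + (c * (\<Sum>t\<in>I. (d \<bullet> \<eta> t)\<^sup>2)
      + 2 * (\<Sum>t\<in>I. e t * (d \<bullet> \<eta> t))) + (w \<bullet> n) / c)"
    using assms by (simp add: power2_eq_square algebra_simps)
  then have "0 \<le> c * \<rho> * (norm d)\<^sup>2 + (c * (\<Sum>t\<in>I. (d \<bullet> \<eta> t)\<^sup>2)
      + 2 * (\<Sum>t\<in>I. e t * (d \<bullet> \<eta> t))) + (w \<bullet> n) / c"
    using assms by (simp add: zero_le_mult_iff)
  then show ?thesis
    by (simp add: wn sum.distrib sum_distrib_left mult.assoc)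
qed

lemma borel_measurable_vec_nth:
  "(\<lambda>w. f w $ i) \<in> borel_measurable M" if "f \<in> borel_measurable M" for f :: "'w \<Rightarrow> real^'n"
  by (rule measurable_compose[OF that borel_measurable_continuous_onI]) (intro continuous_intros)

lemma borel_measurable_det:
  fixes A :: "'w \<Rightarrow> real^'n^'n"
  assumes "\<And>i j. (\<lambda>w. A w $ i $ j) \<in> borel_measurable M"
  shows "(\<lambda>w. det (A w)) \<in> borel_measurable M"
  unfolding det_def
  by (intro borel_measurable_sum borel_measurable_times borel_measurable_const borel_measurable_prod assms)

lemma measurable_ridge_hat:
  fixes \<eta> :: "nat \<Rightarrow> 'w \<Rightarrow> real^'p"
  assumes "\<And>t. t \<in> I \<Longrightarrow> \<eta> t \<in> borel_measurable M" "s \<in> I" "t \<in> I"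
  shows "(\<lambda>w. \<eta> s w \<bullet> ridge_solve \<rho> I (\<lambda>t. \<eta> t w) (\<eta> t w)) \<in> borel_measurable M"
proof -
  have \<eta>: "(\<lambda>w. \<eta> t w $ i) \<in> borel_measurable M" if "t \<in> I" for t i
    using assms(1)[OF that] by (rule borel_measurable_vec_nth)
  have R: "(\<lambda>w. ridge_matrix \<rho> I (\<lambda>t. \<eta> t w) $ i $ j) \<in> borel_measurable M" for i j
    unfolding ridge_matrix_def outer_def using \<eta>
    by (auto intro!: borel_measurable_add borel_measurable_sum borel_measurable_times)
  have "(\<lambda>w. ridge_solve \<rho> I (\<lambda>t. \<eta> t w) (\<eta> t w) $ k) \<in> borel_measurable M" for k
    unfolding ridge_solve_def vec_lambda_beta
  proof (intro borel_measurable_divide borel_measurable_det R)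
    fix i j
    show "(\<lambda>w. (\<chi> i j. if j = k then \<eta> t w $ i else ridge_matrix \<rho> I (\<lambda>t. \<eta> t w) $ i $ j) $ i $ j)
        \<in> borel_measurable M"
      by (cases "j = k") (simp_all add: R \<eta>[OF assms(3)])
  qed
  then show ?thesis
    unfolding inner_vec_def inner_real_def
    by (intro borel_measurable_sum borel_measurable_times \<eta>[OF assms(2)])
qed

section \<open>Restricting a covariance to a block\<close>

text \<open>
  The covariance of one agent's observation, padded by zeros, is invertible only on the agent's coordinates; the
  padding is completed to an identity block.
\<close>

lemma solve_on_block:
  fixes S :: "real^'p^'p" and J :: "'p set"
  assumes zero: "\<And>i j. i \<notin> J \<or> j \<notin> J \<Longrightarrow> S $ i $ j = 0"
    and pd: "\<And>u. (\<And>j. j \<notin> J \<Longrightarrow> u $ j = 0) \<Longrightarrow> \<sigma> * (norm u)\<^sup>2 \<le> u \<bullet> (S *v u)" and \<sigma>: "\<sigma> > 0"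
    and g: "\<And>j. j \<notin> J \<Longrightarrow> g $ j = 0"
  obtains u where "S *v u = g" "\<sigma> * (u \<bullet> g) \<le> (norm g)\<^sup>2"
proof -
  define M where "M = S + (\<chi> i j. if i = j \<and> i \<notin> J then 1 else 0)"
  have Mu: "(M *v u) $ i = (S *v u) $ i + (if i \<in> J then 0 else u $ i)" for u i
  proof -
    have "(\<Sum>j\<in>UNIV. (if i = j \<and> i \<notin> J then 1 else 0) * u $ j) = (\<Sum>j\<in>UNIV. if j = i then (if i \<in> J then 0 else u $ i) else 0)"
      by (intro sum.cong) auto
    then show ?thesis
      by (simp only: M_def matrix_vector_mult_add_rdistrib) (simp add: matrix_vector_mult_def)
  qed
  have S0: "(S *v u) $ i = 0" if "i \<notin> J" for u i
    using zero that by (simp add: matrix_vector_mult_def)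
  have "u = 0" if "M *v u = 0" for u
  proof -
    have u0: "u $ i = 0" if "i \<notin> J" for i
      using Mu[of u i] S0[OF that, of u] \<open>M *v u = 0\<close> that by simp
    have "S *v u = 0" using Mu[of u] u0 \<open>M *v u = 0\<close> by (simp add: vec_eq_iff) (metis add.right_neutral)
    with pd[OF u0] \<sigma> show ?thesis by (simp add: mult_le_0_iff)
  qed
  then have "\<exists>B. B ** M = mat 1" unfolding matrix_left_invertible_ker by blast
  then have "surj ((*v) M)" by (metis matrix_left_right_inverse matrix_right_invertible_surjective)
  then obtain u where u: "M *v u = g" by (metis surjD)
  have u0: "u $ i = 0" if "i \<notin> J" for i
    using Mu[of u i] S0[OF that, of u] u that g by simp
  have Su: "S *v u = g" using Mu[of u] u0 u by (simp add: vec_eq_iff)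
  have "\<sigma> * (norm u)\<^sup>2 \<le> u \<bullet> g" using pd[OF u0] Su by simp
  also have ug: "\<dots> \<le> norm u * norm g" by (rule norm_cauchy_schwarz)
  finally have "\<sigma> * norm u \<le> norm g"
    by (cases "u = 0") (simp_all add: power2_eq_square mult.commute mult.left_commute)
  have "\<sigma> * (u \<bullet> g) \<le> \<sigma> * (norm u * norm g)" using ug \<sigma> by simp
  also have "\<dots> \<le> norm g * norm g"
    using mult_right_mono[OF \<open>\<sigma> * norm u \<le> norm g\<close>, of "norm g"] by (simp add: mult.assoc)
  finally have "\<sigma> * (u \<bullet> g) \<le> (norm g)\<^sup>2" by (simp add: power2_eq_square)
  with Su that show ?thesis by blast
qed

section \<open>Fourier uniqueness and Gaussian conditioning\<close>

context prob_space
begin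

lemma weighted_law:
  fixes g :: "'b \<Rightarrow> 'c::{banach, second_countable_topology}" and f :: "'a \<Rightarrow> real"
  assumes f: "f \<in> borel_measurable M" "\<And>w. 0 \<le> f w" and Y: "Y \<in> measurable M N"
    and g: "g \<in> borel_measurable N"
  shows "(\<integral>y. g y \<partial>distr (density M (\<lambda>w. ennreal (f w))) N Y) = (\<integral>w. f w *\<^sub>R g (Y w) \<partial>M)"
proof -
  have [measurable]: "f \<in> borel_measurable M" "Y \<in> measurable M N" "g \<in> borel_measurable N"
    using f Y g by auto
  show ?thesis
    by (subst integral_distr, simp, simp, subst integral_density) (use f in auto)
qed

text \<open>
  Weighting the probability by the positive and by the negative part of \<open>Z\<close> gives two laws of \<open>Y\<close> of equal mass and
  equal characteristic function; Levy's uniqueness theorem identifies them.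
\<close>

lemma fourier_zero_indicator_real:
  fixes Z Y :: "'a \<Rightarrow> real"
  assumes Z: "integrable M Z" and Y[measurable]: "Y \<in> borel_measurable M"
    and fourier: "\<And>a. (\<integral>w. Z w *\<^sub>R iexp (a * Y w) \<partial>M) = 0"
    and A[measurable]: "A \<in> sets borel"
  shows "(\<integral>w. Z w * indicator A (Y w) \<partial>M) = 0"
proof -
  have [measurable]: "Z \<in> borel_measurable M" using Z by auto
  define Zp Zn where "Zp = (\<lambda>w. max 0 (Z w))" and "Zn = (\<lambda>w. max 0 (- Z w))"
  have Zpn: "Z w = Zp w - Zn w" for w by (auto simp: Zp_def Zn_def)
  have int: "integrable M Zp" "integrable M Zn"
    using Z by (auto simp: Zp_def Zn_def intro!: integrable_max)
  then have [measurable]: "Zp \<in> borel_measurable M" "Zn \<in> borel_measurable M" by auto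
  have nn: "0 \<le> Zp w" "0 \<le> Zn w" for w by (auto simp: Zp_def Zn_def)
  have intc: "integrable M (\<lambda>w. f w *\<^sub>R g w)"
    if "integrable M f" "g \<in> borel_measurable M" "\<And>w. norm (g w) \<le> 1"
    for f :: "'a \<Rightarrow> real" and g :: "'a \<Rightarrow> 'c::{banach, second_countable_topology}"
  proof (rule Bochner_Integration.integrable_bound[OF that(1)])
    show "(\<lambda>w. f w *\<^sub>R g w) \<in> borel_measurable M" using that by (intro borel_measurable_scaleR) auto
    show "AE w in M. norm (f w *\<^sub>R g w) \<le> norm (f w)"
      using that(3) by (simp add: mult_left_le)
  qed
  have Z_iexp: "(\<integral>w. Zp w *\<^sub>R iexp (a * Y w) \<partial>M) = (\<integral>w. Zn w *\<^sub>R iexp (a * Y w) \<partial>M)" for a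
    using fourier[of a] int
    by (simp add: Zpn scaleR_diff_left intc Bochner_Integration.integral_diff)
  define m where "m = (\<integral>w. Zp w \<partial>M)"
  have "complex_of_real (\<integral>w. Zp w \<partial>M) = complex_of_real (\<integral>w. Zn w \<partial>M)"
    using Z_iexp[of 0] by (simp add: scaleR_conv_of_real)
  then have m: "(\<integral>w. Zn w \<partial>M) = m" by (simp add: m_def)
  have "m \<ge> 0" unfolding m_def by (rule Bochner_Integration.integral_nonneg) (rule nn)
  have eq: "(\<integral>w. Zp w * indicator A (Y w) \<partial>M) = (\<integral>w. Zn w * indicator A (Y w) \<partial>M)"
  proof (cases "m = 0")
    case True
    then have "AE w in M. Zp w = 0" "AE w in M. Zn w = 0"
      using integral_nonneg_eq_0_iff_AE[OF int(1)] integral_nonneg_eq_0_iff_AE[OF int(2)] nn m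
      by (auto simp: m_def)
    then show ?thesis by (intro integral_cong_AE) auto
  next
    case False
    with \<open>m \<ge> 0\<close> have mpos: "m > 0" by simp
    define D where "D f = distr (density M (\<lambda>w. ennreal (f w / m))) borel Y" for f
    have D_int: "(\<integral>y. g y \<partial>D f) = (\<integral>w. (f w / m) *\<^sub>R g (Y w) \<partial>M)"
      if "f \<in> borel_measurable M" "\<And>w. 0 \<le> f w" "g \<in> borel_measurable borel"
      for f and g :: "real \<Rightarrow> 'c::{banach, second_countable_topology}"
      unfolding D_def using that mpos by (intro weighted_law) auto
    have D_real: "real_distribution (D f)"
      if [measurable]: "f \<in> borel_measurable M" and "\<And>w. 0 \<le> f w" "integrable M f" "(\<integral>w. f w \<partial>M) = m" for f
    proof -
      have "emeasure (density M (\<lambda>w. ennreal (f w / m))) (space M) = (\<integral>\<^sup>+w. ennreal (f w / m) \<partial>M)"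
        by (subst emeasure_density) (auto intro!: nn_integral_cong)
      also have "\<dots> = ennreal (\<integral>w. f w / m \<partial>M)"
        using that mpos by (intro nn_integral_eq_integral) auto
      also have "\<dots> = 1" using that mpos by simp
      finally have "prob_space (density M (\<lambda>w. ennreal (f w / m)))"
        by (intro prob_spaceI) simp
      then interpret d: prob_space "density M (\<lambda>w. ennreal (f w / m))" .
      show ?thesis unfolding D_def by (intro d.real_distribution_distr) simp
    qed
    have "D Zp = D Zn"
    proof (rule Levy_uniqueness)
      show "real_distribution (D Zp)" "real_distribution (D Zn)"
        using int nn m by (auto intro!: D_real simp: m_def)
      show "char (D Zp) = char (D Zn)"
      proof
        fix a
        have "char (D f) a = (1 / m) *\<^sub>R (\<integral>w. f w *\<^sub>R iexp (a * Y w) \<partial>M)"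
          if "f \<in> borel_measurable M" "\<And>w. 0 \<le> f w" for f
          unfolding char_def using that
          by (subst D_int) (auto simp flip: integral_scaleR_right)
        then show "char (D Zp) a = char (D Zn) a" using nn Z_iexp by simp
      qed
    qed
    moreover have "(\<integral>y. indicator A y \<partial>D f) = (1 / m) * (\<integral>w. f w * indicator A (Y w) \<partial>M)"
      if "f \<in> borel_measurable M" "\<And>w. 0 \<le> f w" for f
      using D_int[OF that, of "indicator A :: real \<Rightarrow> real"] by simp
    ultimately show ?thesis using nn mpos by (metis (no_types, lifting) \<open>Zp \<in> borel_measurable M\<close>
          \<open>Zn \<in> borel_measurable M\<close> divide_eq_0_iff less_irrefl mult_cancel_left zero_neq_one)
  qed
  have "(\<integral>w. Z w * indicator A (Y w) \<partial>M)
      = (\<integral>w. Zp w * indicator A (Y w) \<partial>M) - (\<integral>w. Zn w * indicator A (Y w) \<partial>M)"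
    using intc[OF int(1), of "\<lambda>w. indicator A (Y w) :: real"] intc[OF int(2), of "\<lambda>w. indicator A (Y w) :: real"]
    by (simp add: Zpn left_diff_distrib indicator_def)
  then show ?thesis using eq by simp
qed

text \<open>
  One coordinate at a time: absorbing the indicator of one coordinate and the cosine or sine of the
  phase of the others into the weight keeps the hypothesis of the one-dimensional statement.
\<close>

lemma fourier_zero_indicator:
  fixes Z :: "'a \<Rightarrow> real" and Y :: "'k \<Rightarrow> 'a \<Rightarrow> real"
  assumes "finite K" "integrable M Z" "\<And>k. k \<in> K \<Longrightarrow> Y k \<in> borel_measurable M"
    and "\<And>a. (\<integral>w. Z w *\<^sub>R iexp (\<Sum>k\<in>K. a k * Y k w) \<partial>M) = 0"
    and "\<And>k. k \<in> K \<Longrightarrow> A k \<in> sets borel"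
  shows "(\<integral>w. Z w * (\<Prod>k\<in>K. indicator (A k) (Y k w)) \<partial>M) = 0"
  using assms
proof (induction K arbitrary: Z rule: finite_induct)
  case empty
  from empty(3)[of "\<lambda>_. 0"] have "complex_of_real (\<integral>w. Z w \<partial>M) = 0"
    by (simp add: scaleR_conv_of_real)
  then show ?case by simp
next
  case (insert k K)
  have [measurable]: "Z \<in> borel_measurable M" "Y k \<in> borel_measurable M" "A k \<in> sets borel"
    and Ym[measurable]: "\<And>j. j \<in> K \<Longrightarrow> Y j \<in> borel_measurable M" using insert.prems by auto
  define Z' where "Z' = (\<lambda>w. Z w * indicator (A k) (Y k w))"
  have int_bdd: "integrable M (\<lambda>w. Z w *\<^sub>R g w)"
    if "g \<in> borel_measurable M" "\<And>w. norm (g w) \<le> 1" for g :: "'a \<Rightarrow> 'c::{banach, second_countable_topology}"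
  proof (rule Bochner_Integration.integrable_bound[OF insert.prems(1)])
    show "(\<lambda>w. Z w *\<^sub>R g w) \<in> borel_measurable M" using that by (intro borel_measurable_scaleR) auto
    show "AE w in M. norm (Z w *\<^sub>R g w) \<le> norm (Z w)"
      using that(2) by (simp add: mult_left_le)
  qed
  have "(\<integral>w. Z' w * (\<Prod>k\<in>K. indicator (A k) (Y k w)) \<partial>M) = 0"
  proof (rule insert.IH)
    show "integrable M Z'"
      unfolding Z'_def using int_bdd[of "\<lambda>w. indicator (A k) (Y k w) :: real"] by (simp add: indicator_def)
    fix a :: "'k \<Rightarrow> real"
    define S where "S w = (\<Sum>k\<in>K. a k * Y k w)" for w
    have [measurable]: "S \<in> borel_measurable M" unfolding S_def by measurable
    have F: "(\<integral>w. Z w *\<^sub>R iexp (c * S w + a0 * Y k w) \<partial>M) = 0" for c a0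
    proof -
      have "(\<Sum>j\<in>insert k K. (if j = k then a0 else c * a j) * Y j w) = c * S w + a0 * Y k w" for w
      proof -
        have "(\<Sum>j\<in>K. (if j = k then a0 else c * a j) * Y j w) = (\<Sum>j\<in>K. c * (a j * Y j w))"
          using insert.hyps by (intro sum.cong) auto
        then show ?thesis using insert.hyps by (simp add: S_def sum_distrib_left)
      qed
      then show ?thesis using insert.prems(3)[of "\<lambda>j. if j = k then a0 else c * a j"] by simp
    qed
    have cosS: "(\<integral>w. (Z w * cos (S w)) * indicator (A k) (Y k w) \<partial>M) = 0"
    proof (rule fourier_zero_indicator_real)
      show "integrable M (\<lambda>w. Z w * cos (S w))"
        using int_bdd[of "\<lambda>w. cos (S w)"] by simp
      fix a0
      have "(Z w * cos (S w)) *\<^sub>R iexp (a0 * Y k w)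
          = (1 / 2) *\<^sub>R (Z w *\<^sub>R iexp (1 * S w + a0 * Y k w) + Z w *\<^sub>R iexp ((- 1) * S w + a0 * Y k w))" for w
        by (simp add: complex_eq_iff Re_exp Im_exp cos_add sin_add cos_diff sin_diff algebra_simps
            add_divide_distrib diff_divide_distrib)
      then have "(\<integral>w. (Z w * cos (S w)) *\<^sub>R iexp (a0 * Y k w) \<partial>M)
          = (1 / 2) *\<^sub>R ((\<integral>w. Z w *\<^sub>R iexp (1 * S w + a0 * Y k w) \<partial>M)
              + (\<integral>w. Z w *\<^sub>R iexp ((- 1) * S w + a0 * Y k w) \<partial>M))"
        by (simp only: integral_scaleR_right)
          (subst Bochner_Integration.integral_add, auto intro!: int_bdd)
      then show "(\<integral>w. (Z w * cos (S w)) *\<^sub>R iexp (a0 * Y k w) \<partial>M) = 0" by (simp only: F) simp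
    qed measurable
    have sinS: "(\<integral>w. (Z w * sin (S w)) * indicator (A k) (Y k w) \<partial>M) = 0"
    proof (rule fourier_zero_indicator_real)
      show "integrable M (\<lambda>w. Z w * sin (S w))"
        using int_bdd[of "\<lambda>w. sin (S w)"] by simp
      fix a0
      have "(Z w * sin (S w)) *\<^sub>R iexp (a0 * Y k w)
          = (- \<i> / 2) * (Z w *\<^sub>R iexp (1 * S w + a0 * Y k w) - Z w *\<^sub>R iexp ((- 1) * S w + a0 * Y k w))" for w
        by (simp add: complex_eq_iff Re_exp Im_exp cos_add sin_add cos_diff sin_diff algebra_simps
            add_divide_distrib diff_divide_distrib)
      then have "(\<integral>w. (Z w * sin (S w)) *\<^sub>R iexp (a0 * Y k w) \<partial>M)
          = (- \<i> / 2) * ((\<integral>w. Z w *\<^sub>R iexp (1 * S w + a0 * Y k w) \<partial>M)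
              - (\<integral>w. Z w *\<^sub>R iexp ((- 1) * S w + a0 * Y k w) \<partial>M))"
        by (simp only: integral_mult_right_zero)
          (subst Bochner_Integration.integral_diff, auto intro!: int_bdd)
      then show "(\<integral>w. (Z w * sin (S w)) *\<^sub>R iexp (a0 * Y k w) \<partial>M) = 0" by (simp only: F) simp
    qed measurable
    have int': "integrable M (\<lambda>w. Z w * cos (S w) * indicator (A k) (Y k w))"
      "integrable M (\<lambda>w. Z w * sin (S w) * indicator (A k) (Y k w))"
      using int_bdd[of "\<lambda>w. cos (S w) * indicator (A k) (Y k w)"]
        int_bdd[of "\<lambda>w. sin (S w) * indicator (A k) (Y k w)"]
      by (auto simp: indicator_def mult.assoc)
    have "Z' w *\<^sub>R iexp (S w) = of_real (Z w * cos (S w) * indicator (A k) (Y k w))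
        + \<i> * of_real (Z w * sin (S w) * indicator (A k) (Y k w))" for w
      by (simp add: Z'_def complex_eq_iff Re_exp Im_exp)
    then have "(\<integral>w. Z' w *\<^sub>R iexp (S w) \<partial>M)
        = of_real (\<integral>w. Z w * cos (S w) * indicator (A k) (Y k w) \<partial>M)
          + \<i> * of_real (\<integral>w. Z w * sin (S w) * indicator (A k) (Y k w) \<partial>M)"
      using int' by (simp del: of_real_mult add: Bochner_Integration.integral_add)
    then show "(\<integral>w. Z' w *\<^sub>R iexp (\<Sum>k\<in>K. a k * Y k w) \<partial>M) = 0"
      using cosS sinS by (simp add: S_def)
  qed (use insert.prems in auto)
  then show ?case using insert.hyps by (simp add: Z'_def mult.assoc)
qed

text \<open>Rectangles generate the product, so the two weighted laws of the vector coincide.\<close>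

lemma fourier_zero_bounded:
  fixes Z :: "'a \<Rightarrow> real" and Y :: "'k \<Rightarrow> 'a \<Rightarrow> real"
  assumes K: "finite K" and Z: "integrable M Z" and Y: "\<And>k. k \<in> K \<Longrightarrow> Y k \<in> borel_measurable M"
    and fourier: "\<And>a. (\<integral>w. Z w *\<^sub>R iexp (\<Sum>k\<in>K. a k * Y k w) \<partial>M) = 0"
    and f: "f \<in> borel_measurable (PiM K (\<lambda>_. borel))" "\<And>y. \<bar>f y\<bar> \<le> B"
  shows "(\<integral>w. Z w * f (\<lambda>k\<in>K. Y k w) \<partial>M) = 0"
proof -
  have [measurable]: "Z \<in> borel_measurable M" using Z by auto
  define Zp Zn where "Zp = (\<lambda>w. max 0 (Z w))" and "Zn = (\<lambda>w. max 0 (- Z w))"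
  have Zpn: "Z w = Zp w - Zn w" for w by (auto simp: Zp_def Zn_def)
  have int: "integrable M Zp" "integrable M Zn"
    using Z by (auto simp: Zp_def Zn_def intro!: integrable_max)
  then have [measurable]: "Zp \<in> borel_measurable M" "Zn \<in> borel_measurable M" by auto
  have nn: "0 \<le> Zp w" "0 \<le> Zn w" for w by (auto simp: Zp_def Zn_def)
  define N :: "('k \<Rightarrow> real) measure" where "N = PiM K (\<lambda>_. borel)"
  define V where "V w = (\<lambda>k\<in>K. Y k w)" for w
  have V[measurable]: "V \<in> measurable M N"
    unfolding V_def N_def using Y by (intro measurable_restrict) auto
  have f[measurable]: "f \<in> borel_measurable N" using f by (simp add: N_def)
  have intf: "integrable M (\<lambda>w. h w * g w)"
    if "integrable M h" "g \<in> borel_measurable M" "\<And>w. \<bar>g w\<bar> \<le> c" for h g :: "'a \<Rightarrow> real" and c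
  proof (rule Bochner_Integration.integrable_bound[of M "\<lambda>w. c * h w"])
    show "integrable M (\<lambda>w. c * h w)" using that by simp
    show "(\<lambda>w. h w * g w) \<in> borel_measurable M" using that by (intro borel_measurable_times) auto
    have "0 \<le> c" using that(3) abs_ge_zero order_trans by blast
    then show "AE w in M. norm (h w * g w) \<le> norm (c * h w)"
      using that(3) by (auto simp: abs_mult mult.commute intro!: mult_right_mono always_eventually)
  qed
  have "distr (density M (\<lambda>w. ennreal (Zp w))) N V = distr (density M (\<lambda>w. ennreal (Zn w))) N V" (is "?P = ?Q")
  proof (rule measure_eqI_PiM_finite[OF K])
    show "sets ?P = PiM K (\<lambda>_. borel)" "sets ?Q = PiM K (\<lambda>_. borel)" by (auto simp: N_def)
    have emeas: "emeasure (distr (density M (\<lambda>w. ennreal (h w))) N V) (Pi\<^sub>E K A)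
        = ennreal (\<integral>w. h w * (\<Prod>k\<in>K. indicator (A k) (Y k w)) \<partial>M)"
      if h: "integrable M h" "\<And>w. 0 \<le> h w" and A: "\<And>k. k \<in> K \<Longrightarrow> A k \<in> sets borel" for A h
    proof -
      have [measurable]: "h \<in> borel_measurable M" using h by auto
      have PiE: "Pi\<^sub>E K A \<in> sets N" unfolding N_def using A K by (intro sets_PiM_I_finite) auto
      then have pre: "V -` Pi\<^sub>E K A \<inter> space M \<in> sets M" using V by (rule measurable_sets[rotated])
      have ind: "indicator (V -` Pi\<^sub>E K A \<inter> space M) w = (\<Prod>k\<in>K. indicator (A k) (Y k w) :: real)"
        if "w \<in> space M" for w
        using K that by (auto simp: indicator_def V_def PiE_iff prod_zero_iff intro: ccontr)
      have "emeasure (distr (density M (\<lambda>w. ennreal (h w))) N V) (Pi\<^sub>E K A)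
          = emeasure (density M (\<lambda>w. ennreal (h w))) (V -` Pi\<^sub>E K A \<inter> space M)"
        by (subst emeasure_distr) (use PiE in auto)
      also have "\<dots> = (\<integral>\<^sup>+w. ennreal (h w) * indicator (V -` Pi\<^sub>E K A \<inter> space M) w \<partial>M)"
        by (rule emeasure_density) (use pre in auto)
      also have "\<dots> = (\<integral>\<^sup>+w. ennreal (h w * indicator (V -` Pi\<^sub>E K A \<inter> space M) w) \<partial>M)"
        by (intro nn_integral_cong) (auto simp: indicator_def)
      also have "\<dots> = ennreal (\<integral>w. h w * indicator (V -` Pi\<^sub>E K A \<inter> space M) w \<partial>M)"
        using h pre by (intro nn_integral_eq_integral intf[of _ _ 1] borel_measurable_indicator)
          (auto simp: indicator_def)
      also have "(\<integral>w. h w * indicator (V -` Pi\<^sub>E K A \<inter> space M) w \<partial>M)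
          = (\<integral>w. h w * (\<Prod>k\<in>K. indicator (A k) (Y k w)) \<partial>M)"
        by (intro Bochner_Integration.integral_cong refl) (simp add: ind)
      finally show ?thesis .
    qed
    show "emeasure ?P (Pi\<^sub>E K A) = emeasure ?Q (Pi\<^sub>E K A)" if A: "\<And>k. k \<in> K \<Longrightarrow> A k \<in> sets borel" for A
    proof -
      have "\<bar>\<Prod>k\<in>K. indicator (A k) (Y k w) :: real\<bar> \<le> 1" for w
        unfolding abs_prod by (intro prod_le_1) (auto simp: indicator_def)
      moreover have "(\<lambda>w. \<Prod>k\<in>K. indicator (A k) (Y k w) :: real) \<in> borel_measurable M"
        using Y A by (intro borel_measurable_prod borel_measurable_indicator' ) auto
      ultimately have *: "integrable M (\<lambda>w. h w * (\<Prod>k\<in>K. indicator (A k) (Y k w)))"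
        if "integrable M h" for h :: "'a \<Rightarrow> real" using that by (intro intf[of _ _ 1]) auto
      have "0 = (\<integral>w. Z w * (\<Prod>k\<in>K. indicator (A k) (Y k w)) \<partial>M)"
        using fourier_zero_indicator[OF K Z Y fourier A] by simp
      also have "\<dots> = (\<integral>w. Zp w * (\<Prod>k\<in>K. indicator (A k) (Y k w)) \<partial>M)
          - (\<integral>w. Zn w * (\<Prod>k\<in>K. indicator (A k) (Y k w)) \<partial>M)"
        using *[OF int(1)] *[OF int(2)] by (simp add: Zpn left_diff_distrib)
      finally show ?thesis using int nn A by (simp add: emeas)
    qed
    show "range (\<lambda>_::nat. Pi\<^sub>E K (\<lambda>_. UNIV)) \<subseteq> prod_algebra K (\<lambda>_. borel :: real measure)"
      using K by (auto simp: prod_algebra_eq_finite)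
    show "(\<Union>i::nat. Pi\<^sub>E K (\<lambda>_. UNIV)) = space (PiM K (\<lambda>_. borel :: real measure))" by (simp add: space_PiM)
    show "emeasure ?P (Pi\<^sub>E K (\<lambda>_. UNIV)) \<noteq> \<infinity>"
      using int nn by (simp add: emeas)
  qed
  then have "(\<integral>y. f y \<partial>?P) = (\<integral>y. f y \<partial>?Q)" by simp
  then have "(\<integral>w. Zp w * f (V w) \<partial>M) = (\<integral>w. Zn w * f (V w) \<partial>M)"
    using nn by (simp add: weighted_law)
  moreover have "integrable M (\<lambda>w. Zp w * f (V w))" "integrable M (\<lambda>w. Zn w * f (V w))"
    using int assms(6) by (auto intro!: intf[of _ _ B])
  ultimately have "(\<integral>w. Z w * f (V w) \<partial>M) = 0" by (simp add: Zpn left_diff_distrib)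
  then show ?thesis by (simp add: V_def)
qed

text \<open>
  If \<open>Z\<close> and the vector \<open>Y\<close> have a joint characteristic function that factors with a Gaussian factor
  for \<open>Z\<close>, then \<open>Z\<close> has constant conditional variance given \<open>Y\<close>. Two derivatives of the factorization
  at zero give the Fourier transform of the weight \<open>Z\<^sup>2 - v\<close> against the law of \<open>Y\<close>.
\<close>

lemma gaussian_conditional_variance:
  fixes Z :: "'a \<Rightarrow> real" and Y :: "'k \<Rightarrow> 'a \<Rightarrow> real"
  assumes K: "finite K" and Z: "Z \<in> borel_measurable M" "integrable M (\<lambda>w. (Z w)\<^sup>2)"
    and Y: "\<And>k. k \<in> K \<Longrightarrow> Y k \<in> borel_measurable M"
    and char: "\<And>u a. (\<integral>w. iexp (u * Z w + (\<Sum>k\<in>K. a k * Y k w)) \<partial>M) = of_real (exp (- u\<^sup>2 * v / 2)) * \<phi> a"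
    and f: "f \<in> borel_measurable (PiM K (\<lambda>_. borel))" "\<And>y. \<bar>f y\<bar> \<le> B"
  shows "(\<integral>w. ((Z w)\<^sup>2 - v) * f (\<lambda>k\<in>K. Y k w) \<partial>M) = 0"
proof (rule fourier_zero_bounded[OF K _ Y _ f])
  note [measurable] = Z(1)
  show "integrable M (\<lambda>w. (Z w)\<^sup>2 - v)" using Z by simp
  fix a :: "'k \<Rightarrow> real"
  define S where "S w = (\<Sum>k\<in>K. a k * Y k w)" for w
  have [measurable]: "S \<in> borel_measurable M" unfolding S_def using Y by measurable
  define g where "g n w = (2 * real (Suc n) * sin (Z w / (2 * real (Suc n))))\<^sup>2" for n w
  have int_iexp: "integrable M (\<lambda>w. iexp (h w))" if [measurable]: "h \<in> borel_measurable M" for h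
    by (rule integrable_const_bound[where B = 1]) auto
  have S0: "(\<integral>w. iexp (S w) \<partial>M) = \<phi> a" using char[of 0 a] by (simp add: S_def)
  have gn: "(\<integral>w. g n w *\<^sub>R iexp (S w) \<partial>M)
      = of_real ((real (Suc n))\<^sup>2 * 2 * (1 - exp (- v / (2 * (real (Suc n))\<^sup>2)))) * \<phi> a" for n
  proof -
    define N where "N = real (Suc n)"
    have N: "N > 0" by (simp add: N_def)
    define u where "u = 1 / N"
    have g_eq: "g n w *\<^sub>R iexp (S w)
        = (N\<^sup>2) *\<^sub>R (2 *\<^sub>R iexp (S w) - (iexp (u * Z w + S w) + iexp ((- u) * Z w + S w)))" for w
    proof -
      have "g n w = N\<^sup>2 * (2 - 2 * cos (u * Z w))"
        using cos_double_sin[of "Z w / (2 * N)"] N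
        unfolding g_def N_def[symmetric] by (simp add: power_mult_distrib u_def mult.commute)
      moreover have "(2 - 2 * cos (u * Z w)) *\<^sub>R iexp (S w)
          = 2 *\<^sub>R iexp (S w) - (iexp (u * Z w + S w) + iexp ((- u) * Z w + S w))"
        by (simp add: complex_eq_iff Re_exp Im_exp cos_add sin_add cos_diff sin_diff algebra_simps
            add_divide_distrib diff_divide_distrib)
      ultimately show ?thesis by (metis scaleR_scaleR)
    qed
    have "(\<integral>w. g n w *\<^sub>R iexp (S w) \<partial>M) = (N\<^sup>2) *\<^sub>R (2 *\<^sub>R (\<integral>w. iexp (S w) \<partial>M)
        - ((\<integral>w. iexp (u * Z w + S w) \<partial>M) + (\<integral>w. iexp ((- u) * Z w + S w) \<partial>M)))"
    proof -
      have I: "integrable M (\<lambda>w. iexp (S w))" "integrable M (\<lambda>w. iexp (u * Z w + S w))"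
        "integrable M (\<lambda>w. iexp ((- u) * Z w + S w))" by (intro int_iexp, measurable)+
      show ?thesis
        unfolding g_eq
        by (simp only: I integral_scaleR_right Bochner_Integration.integral_diff
            Bochner_Integration.integral_add Bochner_Integration.integrable_add integrable_scaleR_right)
    qed
    also have "(\<integral>w. iexp (u * Z w + S w) \<partial>M) = of_real (exp (- v / (2 * N\<^sup>2))) * \<phi> a"
      using char[of u a] by (simp add: S_def u_def power_divide)
    also have "(\<integral>w. iexp ((- u) * Z w + S w) \<partial>M) = of_real (exp (- v / (2 * N\<^sup>2))) * \<phi> a"
      using char[of "- u" a] by (simp add: S_def u_def power_divide)
    finally show ?thesis
      unfolding S0 N_def[symmetric] by (simp add: scaleR_conv_of_real algebra_simps)
  qed
  have "(\<lambda>n. \<integral>w. g n w *\<^sub>R iexp (S w) \<partial>M) \<longlonglongrightarrow> (\<integral>w. (Z w)\<^sup>2 *\<^sub>R iexp (S w) \<partial>M)"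
  proof (rule integral_dominated_convergence[where w = "\<lambda>w. (Z w)\<^sup>2"])
    show "AE w in M. (\<lambda>n. g n w *\<^sub>R iexp (S w)) \<longlonglongrightarrow> (Z w)\<^sup>2 *\<^sub>R iexp (S w)"
    proof (intro always_eventually allI tendsto_scaleR tendsto_const)
      fix w
      have "(\<lambda>n. 2 * real (Suc n) * sin (Z w / (2 * real (Suc n)))) \<longlonglongrightarrow> Z w"
        by real_asymp
      then show "(\<lambda>n. g n w) \<longlonglongrightarrow> (Z w)\<^sup>2" unfolding g_def by (intro tendsto_power)
    qed
    show "AE w in M. norm (g n w *\<^sub>R iexp (S w)) \<le> (Z w)\<^sup>2" for n
    proof (intro always_eventually allI)
      fix w
      have "\<bar>2 * real (Suc n) * sin (Z w / (2 * real (Suc n)))\<bar> \<le> 2 * real (Suc n) * \<bar>Z w / (2 * real (Suc n))\<bar>"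
        using mult_left_mono[OF abs_sin_x_le_abs_x, of "2 * real (Suc n)" "Z w / (2 * real (Suc n))"]
        by (simp add: abs_mult del: of_nat_Suc)
      also have "\<dots> = \<bar>Z w\<bar>" by simp
      finally have "g n w \<le> (Z w)\<^sup>2" unfolding g_def by (simp add: abs_le_square_iff)
      then show "norm (g n w *\<^sub>R iexp (S w)) \<le> (Z w)\<^sup>2" by (simp add: g_def)
    qed
  qed (use Z in \<open>auto simp: g_def\<close>)
  moreover have "(\<lambda>n. of_real ((real (Suc n))\<^sup>2 * 2 * (1 - exp (- v / (2 * (real (Suc n))\<^sup>2)))) * \<phi> a)
      \<longlonglongrightarrow> of_real v * \<phi> a"
  proof (intro tendsto_mult tendsto_const tendsto_of_real)
    show "(\<lambda>n. (real (Suc n))\<^sup>2 * 2 * (1 - exp (- v / (2 * (real (Suc n))\<^sup>2)))) \<longlonglongrightarrow> v" by real_asymp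
  qed
  ultimately have "(\<integral>w. (Z w)\<^sup>2 *\<^sub>R iexp (S w) \<partial>M) = of_real v * \<phi> a"
    unfolding gn by (rule LIMSEQ_unique)
  moreover have "integrable M (\<lambda>w. (Z w)\<^sup>2 *\<^sub>R iexp (S w))"
    by (rule Bochner_Integration.integrable_bound[OF Z(2)]) auto
  ultimately have "(\<integral>w. ((Z w)\<^sup>2 - v) *\<^sub>R iexp (S w) \<partial>M) = 0"
    by (simp add: scaleR_diff_left int_iexp S0 scaleR_conv_of_real[of v])
  then show "(\<integral>w. ((Z w)\<^sup>2 - v) *\<^sub>R iexp (\<Sum>k\<in>K. a k * Y k w) \<partial>M) = 0" by (simp add: S_def)
qed

end

section \<open>Independent Gaussian vectors\<close>

lemma normal_law_moments:
  assumes s: "0 \<le> s"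
  shows "has_bochner_integral (normal_law 0 s) (\<lambda>x. x\<^sup>2) (s\<^sup>2)"
    "has_bochner_integral (normal_law 0 s) (\<lambda>x. x ^ 4) (3 * s ^ 4)"
    "(\<integral>x. iexp (u * x) \<partial>normal_law 0 s) = of_real (exp (- (u\<^sup>2 * s\<^sup>2) / 2))"
proof -
  have "has_bochner_integral (normal_law 0 s) (\<lambda>x. x\<^sup>2) (s\<^sup>2) \<and>
    has_bochner_integral (normal_law 0 s) (\<lambda>x. x ^ 4) (3 * s ^ 4) \<and>
    (\<integral>x. iexp (u * x) \<partial>normal_law 0 s) = of_real (exp (- (u\<^sup>2 * s\<^sup>2) / 2))"
  proof (cases "s = 0")
    case True
    have "has_bochner_integral (return borel 0) f (f 0)"
      if [measurable]: "f \<in> borel_measurable borel" for f :: "real \<Rightarrow> real"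
    proof -
      have "AE x in return borel 0. f x = f 0" by (subst AE_return) auto
      moreover interpret r: prob_space "return borel (0::real)" by (rule prob_space_return) simp
      have "has_bochner_integral (return borel (0::real)) (\<lambda>_. f 0) (f 0)"
        using r.prob_space by (simp add: has_bochner_integral_iff)
      ultimately show ?thesis
        by (subst has_bochner_integral_cong_AE[where g = "\<lambda>_. f 0"]) auto
    qed
    note delta = this
    have "(\<lambda>x::real. x\<^sup>2) \<in> borel_measurable borel"
      "(\<lambda>x::real. x ^ 4) \<in> borel_measurable borel" by measurable
    note this[THEN delta]
    moreover have "(\<integral>x. iexp (u * x) \<partial>return borel 0) = iexp (u * 0)"
      by (rule integral_return) auto
    ultimately show ?thesis by (simp add: normal_law_def True)
  next
    case False
    with s have s: "s > 0" by simp
    let ?D = "density lborel (\<lambda>x. ennreal (normal_density 0 s x))"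
    have bochner: "has_bochner_integral ?D g v"
      if "has_bochner_integral lborel (\<lambda>x. normal_density 0 s x * g x) v" "g \<in> borel_measurable borel"
      for g and v :: real
      using that s by (simp add: has_bochner_integral_iff integrable_density integral_density)
    have m2: "has_bochner_integral ?D (\<lambda>x. x\<^sup>2) (s\<^sup>2)"
      using normal_moment_even[OF s, of 0 1] s by (intro bochner) (auto simp: field_simps power2_eq_square)
    have m4: "has_bochner_integral ?D (\<lambda>x. x ^ 4) (3 * s ^ 4)"
    proof (rule bochner)
      have "fact 4 / ((2 / s\<^sup>2)\<^sup>2 * 2) = (3::real) * s ^ 4"
        using s by (simp add: fact_numeral field_simps power2_eq_square power4_eq_xxxx)
      then show "has_bochner_integral lborel (\<lambda>x. normal_density 0 s x * x ^ 4) (3 * s ^ 4)"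
        using normal_moment_even[OF s, of 0 2] by simp
    qed simp
    have "(\<integral>x. iexp (u * x) \<partial>?D) = (\<integral>x. normal_density 0 s x *\<^sub>R iexp (u * x) \<partial>lborel)"
      using s by (subst integral_density) auto
    also have "\<dots> = s *\<^sub>R (\<integral>x. normal_density 0 s (s * x) *\<^sub>R iexp (u * (s * x)) \<partial>lborel)"
      using lborel_integral_real_affine[of s "\<lambda>x. normal_density 0 s x *\<^sub>R iexp (u * x)" 0] s by simp
    also have "\<dots> = (\<integral>x. std_normal_density x *\<^sub>R iexp ((u * s) * x) \<partial>lborel)"
    proof -
      have "s * normal_density 0 s (s * x) = std_normal_density x" for x
        using s by (simp add: normal_density_def real_sqrt_mult power_mult_distrib)
      then show ?thesis
        by (simp only: integral_scaleR_right[symmetric] scaleR_scaleR mult.assoc)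
    qed
    also have "\<dots> = char std_normal_distribution (u * s)"
      unfolding char_def by (subst integral_density) auto
    also have "\<dots> = of_real (exp (- (u\<^sup>2 * s\<^sup>2) / 2))"
      by (simp add: char_std_normal_distribution power_mult_distrib)
    finally show ?thesis using m2 m4 False by (simp add: normal_law_def)
  qed
  then show "has_bochner_integral (normal_law 0 s) (\<lambda>x. x\<^sup>2) (s\<^sup>2)"
    "has_bochner_integral (normal_law 0 s) (\<lambda>x. x ^ 4) (3 * s ^ 4)"
    "(\<integral>x. iexp (u * x) \<partial>normal_law 0 s) = of_real (exp (- (u\<^sup>2 * s\<^sup>2) / 2))" by blast+
qed

text \<open>
  The vectors are described by their scalar projections: \<open>c \<bullet> X t\<close> is centred normal with variance
  \<open>Q c c\<close>. Linear images of \<open>X t\<close> are given by covectors, one for each coordinate of the image.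
\<close>

locale gaussian_sequence = prob_space M for M :: "'w measure" +
  fixes X :: "nat \<Rightarrow> 'w \<Rightarrow> 'e::euclidean_space" and Q :: "'e \<Rightarrow> 'e \<Rightarrow> real"
  assumes bilinear: "bilinear Q" and Q_sym: "Q c d = Q d c" and Q_nonneg: "0 \<le> Q c c"
    and law: "t \<ge> 1 \<Longrightarrow> distr M borel (\<lambda>w. c \<bullet> X t w) = normal_law 0 (sqrt (Q c c))"
    and indep: "indep_vars (\<lambda>_. borel) X {1..}"
begin

lemmas Q_simps = bilinear_ladd[OF bilinear] bilinear_radd[OF bilinear] bilinear_lmul[OF bilinear]
  bilinear_rmul[OF bilinear] bilinear_lzero[OF bilinear] bilinear_rzero[OF bilinear]
  bilinear_lneg[OF bilinear] bilinear_rneg[OF bilinear] bilinear_lsub[OF bilinear] bilinear_rsub[OF bilinear]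

lemma Q_sum_left: "Q (\<Sum>i\<in>I. f i) d = (\<Sum>i\<in>I. Q (f i) d)"
  using bilinear by (simp add: bilinear_def linear_sum[of "\<lambda>x. Q x d"])

lemma Q_sum_right: "Q d (\<Sum>i\<in>I. f i) = (\<Sum>i\<in>I. Q d (f i))"
  using bilinear by (simp add: bilinear_def linear_sum[of "Q d"])

lemma measurable_X: "t \<ge> 1 \<Longrightarrow> X t \<in> borel_measurable M"
  using indep by (auto simp: indep_vars_def)

lemma measurable_coord: "t \<ge> 1 \<Longrightarrow> (\<lambda>w. c \<bullet> X t w) \<in> borel_measurable M"
  using measurable_X by simp

lemma
  assumes t: "t \<ge> 1"
  shows second_moment_diag: "has_bochner_integral M (\<lambda>w. (c \<bullet> X t w)\<^sup>2) (Q c c)"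
    and fourth_moment_diag: "has_bochner_integral M (\<lambda>w. (c \<bullet> X t w) ^ 4) (3 * (Q c c)\<^sup>2)"
    and char_coord: "(\<integral>w. iexp (c \<bullet> X t w) \<partial>M) = of_real (exp (- Q c c / 2))"
proof -
  have s: "0 \<le> sqrt (Q c c)" using Q_nonneg by simp
  have m: "(\<lambda>w. c \<bullet> X t w) \<in> borel_measurable M" by (rule measurable_coord[OF t])
  have push: "has_bochner_integral M (\<lambda>w. f (c \<bullet> X t w)) v"
    if "has_bochner_integral (normal_law 0 (sqrt (Q c c))) f v" "f \<in> borel_measurable borel"
    for f :: "real \<Rightarrow> real" and v
    using that(1) unfolding law[OF t, symmetric] has_bochner_integral_iff
    using that(2) m by (simp add: integrable_distr_eq integral_distr)
  show "has_bochner_integral M (\<lambda>w. (c \<bullet> X t w)\<^sup>2) (Q c c)"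
    using push[OF normal_law_moments(1)[OF s]] Q_nonneg by simp
  have "sqrt (Q c c) ^ 4 = (Q c c)\<^sup>2"
    using Q_nonneg[of c] by (metis power4_eq_xxxx power2_eq_square real_sqrt_pow2 mult.assoc)
  then show "has_bochner_integral M (\<lambda>w. (c \<bullet> X t w) ^ 4) (3 * (Q c c)\<^sup>2)"
    using push[OF normal_law_moments(2)[OF s]] by simp
  show "(\<integral>w. iexp (c \<bullet> X t w) \<partial>M) = of_real (exp (- Q c c / 2))"
    using normal_law_moments(3)[OF s, of 1] Q_nonneg[of c] m
    unfolding law[OF t, symmetric] by (subst (asm) integral_distr) auto
qed

lemma second_moment:
  assumes t: "t \<ge> 1"
  shows "has_bochner_integral M (\<lambda>w. (c \<bullet> X t w) * (d \<bullet> X t w)) (Q c d)"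
proof -
  have "has_bochner_integral M (\<lambda>w. (1 / 2) * ((((c + d) \<bullet> X t w)\<^sup>2 - (c \<bullet> X t w)\<^sup>2) - (d \<bullet> X t w)\<^sup>2))
      ((1 / 2) * ((Q (c + d) (c + d) - Q c c) - Q d d))"
    by (intro has_bochner_integral_mult_right has_bochner_integral_diff second_moment_diag t)
  moreover have "(1 / 2) * ((((c + d) \<bullet> X t w)\<^sup>2 - (c \<bullet> X t w)\<^sup>2) - (d \<bullet> X t w)\<^sup>2)
      = (c \<bullet> X t w) * (d \<bullet> X t w)" for w
    by (simp add: inner_add_left power2_eq_square algebra_simps)
  moreover have "(1 / 2) * ((Q (c + d) (c + d) - Q c c) - Q d d) = Q c d"
    by (simp add: Q_simps Q_sym[of d c])
  ultimately show ?thesis by simp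
qed

text \<open>Isserlis' formula for two projections.\<close>

lemma fourth_moment:
  assumes t: "t \<ge> 1"
  shows "has_bochner_integral M (\<lambda>w. (c \<bullet> X t w)\<^sup>2 * (d \<bullet> X t w)\<^sup>2) (Q c c * Q d d + 2 * (Q c d)\<^sup>2)"
proof -
  have "has_bochner_integral M
      (\<lambda>w. (1 / 12) * ((((c + d) \<bullet> X t w) ^ 4 + ((c - d) \<bullet> X t w) ^ 4)
          - (2 * (c \<bullet> X t w) ^ 4 + 2 * (d \<bullet> X t w) ^ 4)))
      ((1 / 12) * ((3 * (Q (c + d) (c + d))\<^sup>2 + 3 * (Q (c - d) (c - d))\<^sup>2)
          - (2 * (3 * (Q c c)\<^sup>2) + 2 * (3 * (Q d d)\<^sup>2))))"
    by (intro has_bochner_integral_mult_right has_bochner_integral_diff has_bochner_integral_add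
        fourth_moment_diag t)
  moreover have "(1 / 12) * ((((c + d) \<bullet> X t w) ^ 4 + ((c - d) \<bullet> X t w) ^ 4)
          - (2 * (c \<bullet> X t w) ^ 4 + 2 * (d \<bullet> X t w) ^ 4)) = (c \<bullet> X t w)\<^sup>2 * (d \<bullet> X t w)\<^sup>2" for w
    by (simp add: inner_add_left inner_diff_left power4_eq_xxxx power2_eq_square algebra_simps)
  moreover have "(1 / 12) * ((3 * (Q (c + d) (c + d))\<^sup>2 + 3 * (Q (c - d) (c - d))\<^sup>2)
          - (2 * (3 * (Q c c)\<^sup>2) + 2 * (3 * (Q d d)\<^sup>2))) = Q c c * Q d d + 2 * (Q c d)\<^sup>2"
    by (simp add: Q_simps Q_sym[of d c] power2_eq_square algebra_simps)
  ultimately show ?thesis by (simp only:)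
qed

lemma indep_pair:
  assumes "1 \<le> s" "1 \<le> t" "s \<noteq> t"
  shows "indep_var borel (X s) borel (X t)"
proof -
  have "indep_var borel ((\<lambda>f. f s) \<circ> (\<lambda>w. restrict (\<lambda>i. X i w) {s}))
      borel ((\<lambda>f. f t) \<circ> (\<lambda>w. restrict (\<lambda>i. X i w) {t}))"
    by (rule indep_var_compose[OF indep_var_restrict[OF indep, of "{s}" "{t}"]]) (use assms in auto)
  then show ?thesis by (simp add: comp_def)
qed

text \<open>Bienayme's identity for a centred function of the terms.\<close>

lemma second_moment_of_sum:
  fixes f :: "'e \<Rightarrow> real"
  assumes f: "f \<in> borel_measurable borel"
    and int: "\<And>t. t \<in> {1..T} \<Longrightarrow> integrable M (\<lambda>w. (f (X t w))\<^sup>2)"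
    and mean: "\<And>t. t \<in> {1..T} \<Longrightarrow> (\<integral>w. f (X t w) \<partial>M) = 0"
    and var: "\<And>t. t \<in> {1..T} \<Longrightarrow> (\<integral>w. (f (X t w))\<^sup>2 \<partial>M) = v"
  shows "has_bochner_integral M (\<lambda>w. (\<Sum>t\<in>{1..T}. f (X t w))\<^sup>2) (real T * v)"
proof -
  have m: "(\<lambda>w. f (X t w)) \<in> borel_measurable M" if "t \<in> {1..T}" for t
    using that by (intro measurable_compose[OF measurable_X f]) auto
  have int1: "integrable M (\<lambda>w. f (X t w))" if "t \<in> {1..T}" for t
    by (rule square_integrable_imp_integrable[OF m int]) (use that in auto)
  have cross: "has_bochner_integral M (\<lambda>w. f (X s w) * f (X t w)) (if s = t then v else 0)"
    if st: "s \<in> {1..T}" "t \<in> {1..T}" for s t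
  proof (cases "s = t")
    case True
    then show ?thesis using int[OF st(1)] var[OF st(1)]
      by (simp add: has_bochner_integral_iff power2_eq_square)
  next
    case False
    have "indep_var borel (f \<circ> X s) borel (f \<circ> X t)"
      by (rule indep_var_compose[OF indep_pair f f]) (use st False in auto)
    then have "indep_var borel (\<lambda>w. f (X s w)) borel (\<lambda>w. f (X t w))" by (simp add: comp_def)
    from indep_var_lebesgue_integral[OF this int1[OF st(1)] int1[OF st(2)]]
      indep_var_integrable[OF this int1[OF st(1)] int1[OF st(2)]]
    show ?thesis using False mean[OF st(1)] by (simp add: has_bochner_integral_iff)
  qed
  have "has_bochner_integral M (\<lambda>w. \<Sum>s\<in>{1..T}. \<Sum>t\<in>{1..T}. f (X s w) * f (X t w))
      (\<Sum>s\<in>{1..T}. \<Sum>t\<in>{1..T}. if s = t then v else 0)"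
    by (intro has_bochner_integral_sum cross)
  moreover have "(\<Sum>s\<in>{1..T}. \<Sum>t\<in>{1..T}. if s = t then v else 0) = real T * v" by simp
  ultimately show ?thesis by (simp only: power2_eq_square sum_product)
qed

lemma char_joint:
  "(\<integral>w. iexp (\<Sum>t\<in>{1..T}. d t \<bullet> X t w) \<partial>M) = of_real (exp (- (\<Sum>t\<in>{1..T}. Q (d t) (d t)) / 2))"
proof -
  have "indep_vars (\<lambda>_. borel) (\<lambda>t w. iexp (d t \<bullet> X t w)) {1..T}"
    by (rule indep_vars_compose2[OF indep_vars_subset[OF indep]]) auto
  moreover have "integrable M (\<lambda>w. iexp (d t \<bullet> X t w))" if "t \<in> {1..T}" for t
    using measurable_coord[of t "d t"] that by (intro integrable_const_bound[where B = 1]) auto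
  ultimately have "(\<integral>w. (\<Prod>t\<in>{1..T}. iexp (d t \<bullet> X t w)) \<partial>M) = (\<Prod>t\<in>{1..T}. \<integral>w. iexp (d t \<bullet> X t w) \<partial>M)"
    by (intro indep_vars_lebesgue_integral) auto
  also have "\<dots> = (\<Prod>t\<in>{1..T}. of_real (exp (- Q (d t) (d t) / 2)))"
    by (intro prod.cong refl char_coord) simp
  also have "\<dots> = of_real (exp (\<Sum>t\<in>{1..T}. - Q (d t) (d t) / 2))"
    by (simp add: exp_sum)
  also have "(\<Sum>t\<in>{1..T}. - Q (d t) (d t) / 2) = - (\<Sum>t\<in>{1..T}. Q (d t) (d t)) / 2"
    by (simp add: sum_negf sum_divide_distrib)
  finally show ?thesis by (simp add: exp_sum sum_distrib_left)
qed

text \<open>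
  A projection that is uncorrelated with the coordinates \<open>yc\<close> behaves, conditionally on all these
  coordinates over time, like white noise. The joint characteristic function factors, which fixes the
  conditional variance of every linear combination over time; polarization gives the covariances.
\<close>

lemma residual_white_noise:
  fixes yc :: "'p::finite \<Rightarrow> 'e"
  assumes orth: "\<And>c. Q e (yc c) = 0"
    and f: "f \<in> borel_measurable (PiM ({1..T} \<times> UNIV) (\<lambda>_. borel))" "\<And>y. \<bar>f y\<bar> \<le> 1"
    and st: "s \<in> {1..T}" "t \<in> {1..T}"
  defines "F \<equiv> \<lambda>w. f (\<lambda>(t, c)\<in>{1..T} \<times> UNIV. yc c \<bullet> X t w)"
  shows "has_bochner_integral M (\<lambda>w. (e \<bullet> X s w) * (e \<bullet> X t w) * F w)
    (if s = t then Q e e * (\<integral>w. F w \<partial>M) else 0)"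
proof -
  define K where "K = {1..T} \<times> (UNIV :: 'p set)"
  define Y where "Y k w = yc (snd k) \<bullet> X (fst k) w" for k :: "nat \<times> 'p" and w
  have Y: "Y k \<in> borel_measurable M" if "k \<in> K" for k
    using that unfolding Y_def K_def by (intro measurable_coord) auto
  have F_eq: "F = (\<lambda>w. f (\<lambda>k\<in>K. Y k w))"
    unfolding F_def K_def Y_def by (auto simp: fun_eq_iff restrict_def case_prod_beta intro!: arg_cong[where f = f])
  have f': "f \<in> borel_measurable (PiM K (\<lambda>_. borel))" using f by (simp add: K_def)
  have mF: "F \<in> borel_measurable M" unfolding F_eq
    by (rule measurable_compose[OF measurable_restrict f']) (rule Y)
  have bF: "\<bar>F w\<bar> \<le> 1" for w using f by (simp add: F_def)
  have mult_F: "integrable M (\<lambda>w. g w * F w)" if "integrable M g" for g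
    by (rule Bochner_Integration.integrable_bound[OF that])
      (use that mF bF in \<open>auto simp: abs_mult mult_left_le\<close>)
  have intF: "integrable M F" using mF bF by (intro integrable_const_bound[where B = 1]) auto
  have main: "has_bochner_integral M (\<lambda>w. (\<Sum>t\<in>{1..T}. \<kappa> t * (e \<bullet> X t w))\<^sup>2 * F w)
      ((\<Sum>t\<in>{1..T}. (\<kappa> t)\<^sup>2) * Q e e * (\<integral>w. F w \<partial>M))" for \<kappa> :: "nat \<Rightarrow> real"
  proof -
    define Z where "Z w = (\<Sum>t\<in>{1..T}. \<kappa> t * (e \<bullet> X t w))" for w
    define v where "v = (\<Sum>t\<in>{1..T}. (\<kappa> t)\<^sup>2) * Q e e"
    have mZ: "Z \<in> borel_measurable M" unfolding Z_def
      by (intro borel_measurable_sum borel_measurable_times measurable_coord) auto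
    have ZZ: "integrable M (\<lambda>w. (Z w)\<^sup>2)"
    proof (rule Bochner_Integration.integrable_bound)
      show "integrable M (\<lambda>w. (\<Sum>t\<in>{1..T}. (\<kappa> t)\<^sup>2) * (\<Sum>t\<in>{1..T}. (e \<bullet> X t w)\<^sup>2))"
        using second_moment_diag[of _ e] by (intro integrable_mult_right Bochner_Integration.integrable_sum)
          (auto simp: has_bochner_integral_iff)
      show "AE w in M. norm ((Z w)\<^sup>2) \<le> norm ((\<Sum>t\<in>{1..T}. (\<kappa> t)\<^sup>2) * (\<Sum>t\<in>{1..T}. (e \<bullet> X t w)\<^sup>2))"
        unfolding Z_def by (intro always_eventually allI) (simp add: Cauchy_Schwarz_ineq_sum sum_nonneg)
    qed (use mZ in simp)
    have "(\<integral>w. ((Z w)\<^sup>2 - v) * F w \<partial>M) = 0"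
      unfolding F_eq
    proof (rule gaussian_conditional_variance[OF _ mZ ZZ Y _ f' f(2)])
      show "finite K" by (simp add: K_def)
      fix u :: real and a :: "nat \<times> 'p \<Rightarrow> real"
      define y where "y t = (\<Sum>c\<in>UNIV. a (t, c) *\<^sub>R yc c)" for t
      define d where "d t = (u * \<kappa> t) *\<^sub>R e + y t" for t
      have "u * Z w + (\<Sum>k\<in>K. a k * Y k w) = (\<Sum>t\<in>{1..T}. d t \<bullet> X t w)" for w
        by (simp add: K_def Y_def sum.cartesian_product[symmetric] Z_def d_def y_def inner_add_left
            sum.distrib inner_sum_left sum_distrib_left mult.assoc)
          (simp add: sum.cartesian_product case_prod_beta)
      then have "(\<integral>w. iexp (u * Z w + (\<Sum>k\<in>K. a k * Y k w)) \<partial>M)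
          = of_real (exp (- (\<Sum>t\<in>{1..T}. Q (d t) (d t)) / 2))"
        using char_joint[where T = T and d = d] by simp
      also have "Q (d t) (d t) = (u * \<kappa> t)\<^sup>2 * Q e e + Q (y t) (y t)" for t
      proof -
        have "Q e (y t) = 0" by (simp add: y_def Q_sum_right Q_simps orth)
        then show ?thesis by (simp add: d_def Q_simps Q_sym[of "y t" e] power2_eq_square)
      qed
      then have "(\<Sum>t\<in>{1..T}. Q (d t) (d t)) = u\<^sup>2 * v + (\<Sum>t\<in>{1..T}. Q (y t) (y t))"
        by (simp add: sum.distrib v_def power_mult_distrib sum_distrib_left sum_distrib_right mult.assoc)
      finally show "(\<integral>w. iexp (u * Z w + (\<Sum>k\<in>K. a k * Y k w)) \<partial>M) = of_real (exp (- u\<^sup>2 * v / 2))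
          * of_real (exp (- (\<Sum>t\<in>{1..T}. Q (\<Sum>c\<in>UNIV. a (t, c) *\<^sub>R yc c) (\<Sum>c\<in>UNIV. a (t, c) *\<^sub>R yc c)) / 2))"
        by (simp add: y_def add_divide_distrib diff_divide_distrib flip: exp_add of_real_mult)
    qed
    moreover have "integrable M (\<lambda>w. (Z w)\<^sup>2 * F w)" by (rule mult_F[OF ZZ])
    ultimately show ?thesis using intF
      by (simp add: has_bochner_integral_iff left_diff_distrib v_def Z_def)
  qed
  show ?thesis
  proof (cases "s = t")
    case True
    have "(\<Sum>r\<in>{1..T}. (if r = t then 1 else 0) * (e \<bullet> X r w)) = e \<bullet> X t w" for w
      using st by (simp add: if_distrib[of "\<lambda>x. x * _"] cong: if_cong)
    moreover have "(\<Sum>r\<in>{1..T}. (if r = t then 1 else 0 :: real)\<^sup>2) = 1"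
      using st by (simp add: if_distrib[of "\<lambda>x. x\<^sup>2"] cong: if_cong)
    ultimately show ?thesis using main[of "\<lambda>r. if r = t then 1 else 0"] True
      by (simp add: power2_eq_square)
  next
    case False
    have lin: "(\<Sum>r\<in>{1..T}. (if r = s then 1 else if r = t then b else 0) * (e \<bullet> X r w)) = e \<bullet> X s w + b * (e \<bullet> X t w)" for w b
    proof -
      have "(\<Sum>r\<in>{1..T}. (if r = s then 1 else if r = t then b else 0) * (e \<bullet> X r w))
          = (\<Sum>r\<in>{1..T}. (if r = s then e \<bullet> X r w else 0) + (if r = t then b * (e \<bullet> X r w) else 0))"
        using False by (intro sum.cong) auto
      then show ?thesis using st by (simp add: sum.distrib)
    qed
    have sq: "(\<Sum>r\<in>{1..T}. (if r = s then 1 else if r = t then b else 0)\<^sup>2) = 1 + b\<^sup>2" for b :: real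
    proof -
      have "(\<Sum>r\<in>{1..T}. (if r = s then 1 else if r = t then b else 0)\<^sup>2)
          = (\<Sum>r\<in>{1..T}. (if r = s then 1 else 0) + (if r = t then b\<^sup>2 else 0))"
        using False by (intro sum.cong) auto
      then show ?thesis using st by (simp add: sum.distrib)
    qed
    have "has_bochner_integral M (\<lambda>w. (1 / 4) * ((e \<bullet> X s w + 1 * (e \<bullet> X t w))\<^sup>2 * F w - (e \<bullet> X s w + (- 1) * (e \<bullet> X t w))\<^sup>2 * F w))
       ((1 / 4) * ((1 + 1\<^sup>2) * Q e e * (\<integral>w. F w \<partial>M) - (1 + (- 1)\<^sup>2) * Q e e * (\<integral>w. F w \<partial>M)))"
      using main[of "\<lambda>r. if r = s then 1 else if r = t then 1 else 0"]
        main[of "\<lambda>r. if r = s then 1 else if r = t then - 1 else 0"]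
      unfolding lin sq by (intro has_bochner_integral_mult_right has_bochner_integral_diff)
    moreover have "(1 / 4) * ((e \<bullet> X s w + 1 * (e \<bullet> X t w))\<^sup>2 * F w - (e \<bullet> X s w + (- 1) * (e \<bullet> X t w))\<^sup>2 * F w)
        = (e \<bullet> X s w) * (e \<bullet> X t w) * F w" for w
      by (simp add: power2_eq_square algebra_simps)
    ultimately show ?thesis using False by simp
  qed
qed

end

section \<open>How much one agent can gain by hindsight\<close>

lemma norm_vec_squared: "(norm x)\<^sup>2 = (\<Sum>c\<in>UNIV. (x $ c)\<^sup>2)" for x :: "real^'n"
  by (simp add: norm_vec_def L2_set_def sum_nonneg)

context gaussian_sequence
begin

text \<open>
  The centred sample covariance \<open>\<Sum>\<^sub>t ((u \<bullet> \<eta>\<^sub>t) \<eta>\<^sub>t - S u)\<close> of a Gaussian vector with covariance \<open>S\<close>.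
\<close>

lemma sample_covariance_fluctuation:
  fixes yc :: "'p::finite \<Rightarrow> 'e" and u :: "real^'p"
  defines "S \<equiv> \<chi> c d. Q (yc c) (yc d)"
  defines "\<eta> \<equiv> \<lambda>t w. \<chi> c. yc c \<bullet> X t w"
  shows "has_bochner_integral M
    (\<lambda>w. (norm (\<Sum>t\<in>{1..T}. (u \<bullet> \<eta> t w) *\<^sub>R \<eta> t w - S *v u))\<^sup>2)
    (real T * ((u \<bullet> (S *v u)) * (\<Sum>c\<in>UNIV. Q (yc c) (yc c)) + (norm (S *v u))\<^sup>2))"
proof -
  define h where "h = (\<Sum>c\<in>UNIV. u $ c *\<^sub>R yc c)"
  have u\<eta>: "u \<bullet> \<eta> t w = h \<bullet> X t w" for t w
    by (simp add: \<eta>_def h_def inner_vec_def inner_sum_left)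
  have Qh: "Q h (yc c) = (S *v u) $ c" for c
    by (simp add: h_def Q_sum_left Q_simps S_def matrix_vector_mult_def Q_sym[of "yc c"] mult.commute)
  have Qhh: "Q h h = u \<bullet> (S *v u)"
  proof -
    have "Q h h = (\<Sum>c\<in>UNIV. u $ c * Q h (yc c))" by (subst (2) h_def) (simp add: Q_sum_right Q_simps)
    then show ?thesis by (simp add: Qh inner_vec_def)
  qed
  have comp: "has_bochner_integral M
      (\<lambda>w. (\<Sum>t\<in>{1..T}. (h \<bullet> X t w) * (yc c \<bullet> X t w) - (S *v u) $ c)\<^sup>2)
      (real T * (Q h h * Q (yc c) (yc c) + ((S *v u) $ c)\<^sup>2))" for c
  proof (rule second_moment_of_sum[where f = "\<lambda>x. (h \<bullet> x) * (yc c \<bullet> x) - (S *v u) $ c"])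
    fix t assume t: "t \<in> {1..T}"
    let ?g = "(S *v u) $ c"
    have m2: "has_bochner_integral M (\<lambda>w. (h \<bullet> X t w) * (yc c \<bullet> X t w)) ?g"
      using second_moment[of t h "yc c"] t by (simp add: Qh)
    have m4: "has_bochner_integral M (\<lambda>w. (h \<bullet> X t w)\<^sup>2 * (yc c \<bullet> X t w)\<^sup>2) (Q h h * Q (yc c) (yc c) + 2 * ?g\<^sup>2)"
      using fourth_moment[of t h "yc c"] t by (simp add: Qh)
    have const: "has_bochner_integral M (\<lambda>w. b) b" for b :: real
      by (simp add: has_bochner_integral_iff prob_space)
    show "(\<integral>w. (h \<bullet> X t w) * (yc c \<bullet> X t w) - ?g \<partial>M) = 0"
      using has_bochner_integral_diff[OF m2 const[of ?g]] by (simp add: has_bochner_integral_iff)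
    have "has_bochner_integral M
        (\<lambda>w. ((h \<bullet> X t w)\<^sup>2 * (yc c \<bullet> X t w)\<^sup>2 - (2 * ?g) * ((h \<bullet> X t w) * (yc c \<bullet> X t w))) + ?g\<^sup>2)
        (((Q h h * Q (yc c) (yc c) + 2 * ?g\<^sup>2) - (2 * ?g) * ?g) + ?g\<^sup>2)"
      by (intro has_bochner_integral_add has_bochner_integral_diff has_bochner_integral_mult_right m4 m2 const)
    moreover have "((h \<bullet> X t w)\<^sup>2 * (yc c \<bullet> X t w)\<^sup>2 - (2 * ?g) * ((h \<bullet> X t w) * (yc c \<bullet> X t w))) + ?g\<^sup>2
        = ((h \<bullet> X t w) * (yc c \<bullet> X t w) - ?g)\<^sup>2" for w
      by (simp add: power2_eq_square algebra_simps)
    moreover have "((Q h h * Q (yc c) (yc c) + 2 * ?g\<^sup>2) - (2 * ?g) * ?g) + ?g\<^sup>2 = Q h h * Q (yc c) (yc c) + ?g\<^sup>2"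
      by (simp add: power2_eq_square)
    ultimately have "has_bochner_integral M (\<lambda>w. ((h \<bullet> X t w) * (yc c \<bullet> X t w) - ?g)\<^sup>2)
        (Q h h * Q (yc c) (yc c) + ?g\<^sup>2)" by (simp only:)
    then show "integrable M (\<lambda>w. ((h \<bullet> X t w) * (yc c \<bullet> X t w) - ?g)\<^sup>2)"
      "(\<integral>w. ((h \<bullet> X t w) * (yc c \<bullet> X t w) - ?g)\<^sup>2 \<partial>M) = Q h h * Q (yc c) (yc c) + ?g\<^sup>2"
      by (simp_all add: has_bochner_integral_iff)
  qed simp
  have "has_bochner_integral M
      (\<lambda>w. \<Sum>c\<in>UNIV. (\<Sum>t\<in>{1..T}. (h \<bullet> X t w) * (yc c \<bullet> X t w) - (S *v u) $ c)\<^sup>2)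
      (\<Sum>c\<in>UNIV. real T * (Q h h * Q (yc c) (yc c) + ((S *v u) $ c)\<^sup>2))"
    by (intro has_bochner_integral_sum comp)
  moreover have "(\<Sum>c\<in>UNIV. (\<Sum>t\<in>{1..T}. (h \<bullet> X t w) * (yc c \<bullet> X t w) - (S *v u) $ c)\<^sup>2)
      = (norm (\<Sum>t\<in>{1..T}. (u \<bullet> \<eta> t w) *\<^sub>R \<eta> t w - S *v u))\<^sup>2" for w
  proof -
    have comp_eq: "(\<Sum>t\<in>{1..T}. (u \<bullet> \<eta> t w) *\<^sub>R \<eta> t w - S *v u) $ c
        = (\<Sum>t\<in>{1..T}. (h \<bullet> X t w) * (yc c \<bullet> X t w) - (S *v u) $ c)" for c
      unfolding sum_component by (intro sum.cong refl) (simp add: u\<eta>, simp add: \<eta>_def)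
    show ?thesis by (simp only: norm_vec_squared comp_eq)
  qed
  moreover have "(\<Sum>c\<in>UNIV. real T * (Q h h * Q (yc c) (yc c) + ((S *v u) $ c)\<^sup>2))
      = real T * ((u \<bullet> (S *v u)) * (\<Sum>c\<in>UNIV. Q (yc c) (yc c)) + (norm (S *v u))\<^sup>2)"
    by (simp add: sum_distrib_left[symmetric] sum.distrib Qhh
        sum_distrib_right[symmetric] norm_vec_squared)
  ultimately show ?thesis by (simp only:)
qed

text \<open>
  The noise part of the regression: given the regressors the errors are white noise of variance
  \<open>Q e e\<close>, so the expected gain of a least-squares fit to them is this variance times the effective number of
  degrees of freedom. That is why the gain stays bounded in \<open>T\<close>.
\<close>

lemma ridge_gain_expectation:
  fixes yc :: "'p::finite \<Rightarrow> 'e"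
  assumes orth: "\<And>c. Q e (yc c) = 0" and \<rho>: "\<rho> > 0"
  defines "\<eta> \<equiv> \<lambda>t w. \<chi> c. yc c \<bullet> X t w"
  obtains v where "has_bochner_integral M (\<lambda>w. \<Sum>s\<in>{1..T}. \<Sum>t\<in>{1..T}. (e \<bullet> X s w) * (e \<bullet> X t w)
      * (\<eta> s w \<bullet> ridge_solve \<rho> {1..T} (\<lambda>t. \<eta> t w) (\<eta> t w))) v"
    "v \<le> Q e e * real CARD('p)"
proof -
  define hat :: "nat \<Rightarrow> nat \<Rightarrow> (nat \<times> 'p \<Rightarrow> real) \<Rightarrow> real" where
    "hat s t y = (\<chi> c. y (s, c)) \<bullet> ridge_solve \<rho> {1..T} (\<lambda>t. \<chi> c. y (t, c)) (\<chi> c. y (t, c))" for s t y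
  define Y where "Y w = (\<lambda>(t, c)\<in>{1..T} \<times> UNIV. yc c \<bullet> X t w)" for w
  have hat_eq: "hat s t (Y w) = \<eta> s w \<bullet> ridge_solve \<rho> {1..T} (\<lambda>t. \<eta> t w) (\<eta> t w)"
    if "s \<in> {1..T}" "t \<in> {1..T}" for s t w
  proof -
    have Yt: "(\<chi> c. Y w (t, c)) = \<eta> t w" if "t \<in> {1..T}" for t
      using that by (simp add: Y_def \<eta>_def vec_eq_iff)
    have rm: "ridge_matrix \<rho> {1..T} (\<lambda>t. \<chi> c. Y w (t, c)) = ridge_matrix \<rho> {1..T} (\<lambda>t. \<eta> t w)"
      unfolding ridge_matrix_def using Yt by (auto intro!: arg_cong2[where f = "(+)"] sum.cong)
    show ?thesis unfolding hat_def ridge_solve_def rm Yt[OF that(1)] Yt[OF that(2)] ..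
  qed
  have meas: "hat s t \<in> borel_measurable (PiM ({1..T} \<times> UNIV) (\<lambda>_. borel))" if "s \<in> {1..T}" "t \<in> {1..T}" for s t
    unfolding hat_def
  proof (rule measurable_ridge_hat)
    fix t assume t: "t \<in> {1..T}"
    have "(\<lambda>y. y (t, c)) \<in> borel_measurable (PiM ({1..T} \<times> (UNIV::'p set)) (\<lambda>_. borel :: real measure))" for c
      by (rule measurable_component_singleton) (use t in auto)
    then show "(\<lambda>y. \<chi> c. y (t, c)) \<in> borel_measurable (PiM ({1..T} \<times> (UNIV::'p set)) (\<lambda>_. borel :: real measure))"
      by (subst borel_measurable_euclidean_space) (auto simp: Basis_vec_def inner_axis)
  qed (use that in auto)
  have bound: "\<bar>hat s t y\<bar> \<le> 1" if "s \<in> {1..T}" "t \<in> {1..T}" for s t y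
    unfolding hat_def by (rule ridge_hat_bound[OF \<rho>]) (use that in auto)
  have entry: "has_bochner_integral M (\<lambda>w. (e \<bullet> X s w) * (e \<bullet> X t w) * hat s t (Y w))
      (if s = t then Q e e * (\<integral>w. hat s t (Y w) \<partial>M) else 0)"
    if st: "s \<in> {1..T}" "t \<in> {1..T}" for s t
    unfolding Y_def using residual_white_noise[OF orth meas[OF st] bound[OF st] st] .
  define v where "v = (\<Sum>s\<in>{1..T}. \<Sum>t\<in>{1..T}. if s = t then Q e e * (\<integral>w. hat s t (Y w) \<partial>M) else 0)"
  have "has_bochner_integral M (\<lambda>w. \<Sum>s\<in>{1..T}. \<Sum>t\<in>{1..T}. (e \<bullet> X s w) * (e \<bullet> X t w) * hat s t (Y w)) v"
    unfolding v_def by (intro has_bochner_integral_sum entry)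
  moreover have "(\<Sum>s\<in>{1..T}. \<Sum>t\<in>{1..T}. (e \<bullet> X s w) * (e \<bullet> X t w) * hat s t (Y w))
      = (\<Sum>s\<in>{1..T}. \<Sum>t\<in>{1..T}. (e \<bullet> X s w) * (e \<bullet> X t w)
          * (\<eta> s w \<bullet> ridge_solve \<rho> {1..T} (\<lambda>t. \<eta> t w) (\<eta> t w)))" for w
    by (intro sum.cong refl) (simp only: hat_eq)
  ultimately have 1: "has_bochner_integral M (\<lambda>w. \<Sum>s\<in>{1..T}. \<Sum>t\<in>{1..T}. (e \<bullet> X s w) * (e \<bullet> X t w)
      * (\<eta> s w \<bullet> ridge_solve \<rho> {1..T} (\<lambda>t. \<eta> t w) (\<eta> t w))) v" by (simp only:)
  have mY: "Y \<in> measurable M (PiM ({1..T} \<times> UNIV) (\<lambda>_. borel))"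
    unfolding Y_def by (rule measurable_restrict) (auto simp: case_prod_beta intro: measurable_coord)
  have int_hat: "integrable M (\<lambda>w. hat s t (Y w))" if "s \<in> {1..T}" "t \<in> {1..T}" for s t
    using bound[OF that] measurable_compose[OF mY meas[OF that]]
    by (intro integrable_const_bound[where B = 1]) auto
  have "v = Q e e * (\<Sum>t\<in>{1..T}. \<integral>w. hat t t (Y w) \<partial>M)"
    by (simp add: v_def sum_distrib_left)
  also have "(\<Sum>t\<in>{1..T}. \<integral>w. hat t t (Y w) \<partial>M) = (\<integral>w. (\<Sum>t\<in>{1..T}. hat t t (Y w)) \<partial>M)"
    by (subst Bochner_Integration.integral_sum) (auto intro: int_hat)
  also have "\<dots> \<le> (\<integral>w. real CARD('p) \<partial>M)"
  proof (rule integral_mono)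
    show "(\<Sum>t\<in>{1..T}. hat t t (Y w)) \<le> real CARD('p)" for w
      unfolding hat_def by (rule ridge_hat_trace[OF \<rho>])
    show "integrable M (\<lambda>w. \<Sum>t\<in>{1..T}. hat t t (Y w))"
      by (rule Bochner_Integration.integrable_sum) (rule int_hat)
  qed simp
  also have "\<dots> = real CARD('p)" by (simp add: prob_space)
  finally have "v \<le> Q e e * real CARD('p)" using Q_nonneg[of e] by (simp add: mult_left_mono)
  with 1 that show ?thesis by blast
qed

text \<open>
  One agent observes \<open>\<eta>\<close>, its loss gradient is built from \<open>\<zeta>\<close>, and \<open>K0\<close> is stationary for the expected
  loss on the operator-norm ball. The linear term \<open>2 \<zeta> \<bullet> (K - K0) \<eta>\<close> is split by regressing \<open>\<zeta>\<close> on
  \<open>\<eta>\<close>: the residual is white noise given \<open>\<eta>\<close> and is paid for by the curvature \<open>s |(K - K0) \<eta>|\<^sup>2\<close> of the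
  loss; the regression part is nonzero only because of the constraint, and its fluctuation is paid for
  by the curvature of the ball. Both payments are made for every realization of \<open>\<eta>\<close>, however ill-conditioned
  its sample covariance.
\<close>

lemma hindsight_gain:
  fixes yc :: "'p::finite \<Rightarrow> 'e" and zc :: "'m::finite \<Rightarrow> 'e" and K0 :: "real^'p^'m"
  defines "\<eta> \<equiv> \<lambda>t w. \<chi> c. yc c \<bullet> X t w" and "\<zeta> \<equiv> \<lambda>t w. \<chi> r. zc r \<bullet> X t w"
  defines "S \<equiv> \<chi> c d. Q (yc c) (yc d)" and "\<Gamma> \<equiv> \<chi> r c. 2 * Q (zc r) (yc c)"
  assumes T: "T \<ge> 1" and b: "b > 0" and s: "s > 0" and \<sigma>: "\<sigma> > 0" and \<rho>: "\<rho> > 0"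
    and K0: "opnorm K0 \<le> b"
    and opt: "\<And>K. opnorm K \<le> b \<Longrightarrow> 0 \<le> \<Gamma> \<bullet> (K - K0)"
    and solve: "\<And>a. \<exists>u. S *v u = a v* K0 \<and> \<sigma> * (u \<bullet> (a v* K0)) \<le> (norm (a v* K0))\<^sup>2"
    and trace: "(\<Sum>c\<in>UNIV. Q (yc c) (yc c)) \<le> \<tau>"
  obtains R where "integrable M R"
    "\<And>w K. opnorm K \<le> b \<Longrightarrow> - R w - s * \<rho> * (norm (K - K0))\<^sup>2
      \<le> (\<Sum>t\<in>{1..T}. 2 * (\<zeta> t w \<bullet> ((K - K0) *v \<eta> t w)) + s * (norm ((K - K0) *v \<eta> t w))\<^sup>2)"
    "(\<integral>w. R w \<partial>M) \<le> real CARD('p) / s * (\<Sum>r\<in>UNIV. Q (zc r) (zc r)) + (\<tau> / \<sigma> + 1) * (- (\<Gamma> \<bullet> K0) / 2)"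
proof -
  obtain a :: "nat \<Rightarrow> real^'m" and n where
    \<Gamma>_dyads: "\<Gamma> = - 2 *\<^sub>R (\<Sum>k<n. outer (a k) (a k v* K0))"
    and energy: "(\<Sum>k<n. (norm (a k v* K0))\<^sup>2) = - (\<Gamma> \<bullet> K0) / 2"
    and growth: "\<And>K. opnorm K \<le> b \<Longrightarrow> (\<Sum>k<n. (norm (a k v* (K - K0)))\<^sup>2) \<le> \<Gamma> \<bullet> (K - K0)"
    using opball_normal_cone[OF b K0 opt] by blast
  have "\<forall>k. \<exists>u. S *v u = a k v* K0 \<and> \<sigma> * (u \<bullet> (a k v* K0)) \<le> (norm (a k v* K0))\<^sup>2"
    using solve by blast
  from choice[OF this] obtain u where u: "\<And>k. S *v u k = a k v* K0"
    and u\<sigma>: "\<And>k. \<sigma> * (u k \<bullet> (a k v* K0)) \<le> (norm (a k v* K0))\<^sup>2"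
    by blast
  define g where "g k = a k v* K0" for k
  \<comment> \<open>the regression matrix of \<open>\<zeta>\<close> on \<open>\<eta>\<close>: it is \<open>\<Gamma> / 2\<close> times the inverse covariance, hence a sum of dyads\<close>
  define A where "A = - (\<Sum>k<n. outer (a k) (u k))"
  define ec where "ec r = zc r - (\<Sum>c\<in>UNIV. A $ r $ c *\<^sub>R yc c)" for r
  have A_rc: "A $ r $ c = - (\<Sum>k<n. a k $ r * u k $ c)" for r c
    by (simp add: A_def outer_def)
  have orth: "Q (ec r) (yc c) = 0" for r c
  proof -
    have "(\<Sum>d\<in>UNIV. A $ r $ d * Q (yc d) (yc c)) = - (\<Sum>k<n. a k $ r * (S *v u k) $ c)"
    proof -
      have "(\<Sum>d\<in>UNIV. A $ r $ d * Q (yc d) (yc c)) = - (\<Sum>d\<in>UNIV. \<Sum>k<n. a k $ r * u k $ d * Q (yc d) (yc c))"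
        by (simp add: A_rc sum_distrib_right sum_negf)
      also have "\<dots> = - (\<Sum>k<n. \<Sum>d\<in>UNIV. a k $ r * (S $ c $ d * u k $ d))"
        by (subst sum.swap) (simp add: S_def Q_sym[of "yc c"] ac_simps)
      finally show ?thesis by (simp add: matrix_vector_mult_def sum_distrib_left)
    qed
    also have "\<dots> = \<Gamma> $ r $ c / 2"
      by (simp add: \<Gamma>_dyads outer_def u)
    also have "\<dots> = Q (zc r) (yc c)" by (simp add: \<Gamma>_def)
    finally show ?thesis by (simp add: ec_def Q_simps Q_sum_left)
  qed
  have ec_var: "Q (ec r) (ec r) \<le> Q (zc r) (zc r)" for r
  proof -
    define h where "h = (\<Sum>c\<in>UNIV. A $ r $ c *\<^sub>R yc c)"
    have "zc r = ec r + h" by (simp add: ec_def h_def)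
    moreover have "Q (ec r) h = 0" by (simp add: h_def Q_sum_right Q_simps orth)
    ultimately show ?thesis using Q_nonneg[of h] by (simp add: Q_simps Q_sym[of h "ec r"])
  qed
  define gain where "gain r w = (\<Sum>s\<in>{1..T}. \<Sum>t\<in>{1..T}. (ec r \<bullet> X s w) * (ec r \<bullet> X t w)
      * (\<eta> s w \<bullet> ridge_solve \<rho> {1..T} (\<lambda>t. \<eta> t w) (\<eta> t w)))" for r w
  have "\<exists>v. has_bochner_integral M (gain r) v \<and> v \<le> Q (ec r) (ec r) * real CARD('p)" for r
  proof (rule ridge_gain_expectation[OF orth[of r] \<rho>, where T = T])
    fix v
    assume "v \<le> Q (ec r) (ec r) * real CARD('p)"
      and "has_bochner_integral M (\<lambda>w. \<Sum>s\<in>{1..T}. \<Sum>t\<in>{1..T}. (ec r \<bullet> X s w) * (ec r \<bullet> X t w)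
        * ((\<chi> c. yc c \<bullet> X s w) \<bullet> ridge_solve \<rho> {1..T} (\<lambda>t. \<chi> c. yc c \<bullet> X t w) (\<chi> c. yc c \<bullet> X t w))) v"
    then show ?thesis unfolding gain_def[abs_def] \<eta>_def by (intro exI[of _ v] conjI)
  qed
  then have "\<forall>r. \<exists>v. has_bochner_integral M (gain r) v \<and> v \<le> Q (ec r) (ec r) * real CARD('p)" by blast
  from choice[OF this] obtain v where gain: "\<And>r. has_bochner_integral M (gain r) (v r)"
    and v: "\<And>r. v r \<le> Q (ec r) (ec r) * real CARD('p)" by blast
  \<comment> \<open>the fluctuation of the regression part in the direction of the dyad \<open>k\<close>\<close>
  define m where "m k w = (\<Sum>t\<in>{1..T}. (u k \<bullet> \<eta> t w) *\<^sub>R \<eta> t w - g k)" for k w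
  have m: "has_bochner_integral M (\<lambda>w. (norm (m k w))\<^sup>2)
      (real T * ((u k \<bullet> g k) * (\<Sum>c\<in>UNIV. Q (yc c) (yc c)) + (norm (g k))\<^sup>2))" for k
    using sample_covariance_fluctuation[where yc = yc and u = "u k" and T = T]
    unfolding S_def[symmetric] m_def u g_def \<eta>_def .
  define R where "R w = (1 / s) * (\<Sum>r\<in>UNIV. gain r w) + (1 / real T) * (\<Sum>k<n. (norm (m k w))\<^sup>2)" for w
  define Rv where "Rv = (1 / s) * (\<Sum>r\<in>UNIV. v r)
      + (1 / real T) * (\<Sum>k<n. real T * ((u k \<bullet> g k) * (\<Sum>c\<in>UNIV. Q (yc c) (yc c)) + (norm (g k))\<^sup>2))"
  have R: "has_bochner_integral M R Rv"
    unfolding R_def Rv_def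
    by (intro has_bochner_integral_add has_bochner_integral_mult_right has_bochner_integral_sum gain m)
  have "Rv \<le> real CARD('p) / s * (\<Sum>r\<in>UNIV. Q (zc r) (zc r)) + (\<tau> / \<sigma> + 1) * (- (\<Gamma> \<bullet> K0) / 2)"
  proof -
    have "v r \<le> real CARD('p) * Q (zc r) (zc r)" for r
      using order.trans[OF v[of r] mult_right_mono[OF ec_var[of r], of "real CARD('p)"]] by (simp add: mult.commute)
    then have "(\<Sum>r\<in>UNIV. v r) \<le> real CARD('p) * (\<Sum>r\<in>UNIV. Q (zc r) (zc r))"
      by (simp add: sum_distrib_left sum_mono)
    then have 1: "(1 / s) * (\<Sum>r\<in>UNIV. v r) \<le> real CARD('p) / s * (\<Sum>r\<in>UNIV. Q (zc r) (zc r))"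
      using s by (simp add: field_simps)
    have tr_nn: "0 \<le> (\<Sum>c\<in>UNIV. Q (yc c) (yc c))" by (intro sum_nonneg Q_nonneg)
    have "(u k \<bullet> g k) * (\<Sum>c\<in>UNIV. Q (yc c) (yc c)) \<le> (norm (g k))\<^sup>2 / \<sigma> * \<tau>" for k
    proof (rule mult_mono)
      show "u k \<bullet> g k \<le> (norm (g k))\<^sup>2 / \<sigma>" using u\<sigma>[of k] \<sigma> by (simp add: g_def field_simps)
    qed (use trace tr_nn \<sigma> in auto)
    then have "(u k \<bullet> g k) * (\<Sum>c\<in>UNIV. Q (yc c) (yc c)) + (norm (g k))\<^sup>2 \<le> (\<tau> / \<sigma> + 1) * (norm (g k))\<^sup>2" for k
      by (simp add: algebra_simps)
    then have "(\<Sum>k<n. (u k \<bullet> g k) * (\<Sum>c\<in>UNIV. Q (yc c) (yc c)) + (norm (g k))\<^sup>2)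
        \<le> (\<tau> / \<sigma> + 1) * (\<Sum>k<n. (norm (g k))\<^sup>2)"
      unfolding sum_distrib_left by (rule sum_mono)
    then have "(1 / real T) * (\<Sum>k<n. real T * ((u k \<bullet> g k) * (\<Sum>c\<in>UNIV. Q (yc c) (yc c)) + (norm (g k))\<^sup>2))
        \<le> (\<tau> / \<sigma> + 1) * (- (\<Gamma> \<bullet> K0) / 2)"
      using T energy by (simp add: g_def flip: sum_distrib_left)
    with 1 show ?thesis unfolding Rv_def by linarith
  qed
  moreover have "- R w - s * \<rho> * (norm (K - K0))\<^sup>2
      \<le> (\<Sum>t\<in>{1..T}. 2 * (\<zeta> t w \<bullet> ((K - K0) *v \<eta> t w)) + s * (norm ((K - K0) *v \<eta> t w))\<^sup>2)"
    if K: "opnorm K \<le> b" for w K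
  proof -
    define \<Delta> where "\<Delta> = K - K0"
    define \<epsilon> where "\<epsilon> t = (\<chi> r. ec r \<bullet> X t w)" for t
    have \<zeta>_split: "\<zeta> t w = \<epsilon> t + A *v \<eta> t w" for t
      by (simp add: vec_eq_iff \<zeta>_def \<epsilon>_def ec_def \<eta>_def matrix_vector_mult_def inner_diff_left inner_sum_left)
    have noise: "(\<Sum>t\<in>{1..T}. 2 * (\<epsilon> t \<bullet> (\<Delta> *v \<eta> t w)) + s * (norm (\<Delta> *v \<eta> t w))\<^sup>2)
        \<ge> - (1 / s) * (\<Sum>r\<in>UNIV. gain r w) - s * \<rho> * (norm \<Delta>)\<^sup>2"
    proof -
      have "\<epsilon> t \<bullet> (\<Delta> *v \<eta> t w) = (\<Sum>r\<in>UNIV. (ec r \<bullet> X t w) * (\<Delta> $ r \<bullet> \<eta> t w))" for t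
        unfolding inner_vec_def[of "\<epsilon> t"] by (simp add: \<epsilon>_def matrix_vector_mul_component)
      moreover have "(norm (\<Delta> *v \<eta> t w))\<^sup>2 = (\<Sum>r\<in>UNIV. (\<Delta> $ r \<bullet> \<eta> t w)\<^sup>2)" for t
        by (simp add: norm_vec_squared matrix_vector_mul_component)
      ultimately have "2 * (\<epsilon> t \<bullet> (\<Delta> *v \<eta> t w)) + s * (norm (\<Delta> *v \<eta> t w))\<^sup>2
          = (\<Sum>r\<in>UNIV. 2 * (ec r \<bullet> X t w) * (\<Delta> $ r \<bullet> \<eta> t w) + s * (\<Delta> $ r \<bullet> \<eta> t w)\<^sup>2)" for t
        by (simp add: sum.distrib sum_distrib_left mult.assoc)
      then have "(\<Sum>t\<in>{1..T}. 2 * (\<epsilon> t \<bullet> (\<Delta> *v \<eta> t w)) + s * (norm (\<Delta> *v \<eta> t w))\<^sup>2)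
          = (\<Sum>r\<in>UNIV. \<Sum>t\<in>{1..T}. 2 * (ec r \<bullet> X t w) * (\<Delta> $ r \<bullet> \<eta> t w) + s * (\<Delta> $ r \<bullet> \<eta> t w)\<^sup>2)"
        by (subst sum.swap) simp
      also have "\<dots> \<ge> (\<Sum>r\<in>UNIV. - gain r w / s - s * \<rho> * (norm (\<Delta> $ r))\<^sup>2)"
        unfolding gain_def by (intro sum_mono ridge_lower_bound \<rho> s)
      moreover have "(norm \<Delta>)\<^sup>2 = (\<Sum>r\<in>UNIV. (norm (\<Delta> $ r))\<^sup>2)"
        by (simp add: power2_norm_eq_inner inner_vec_def[of \<Delta>])
      ultimately show ?thesis
        by (simp add: sum_subtractf sum_distrib_left sum_negf sum_divide_distrib)
    qed
    define \<delta> where "\<delta> k = a k v* \<Delta>" for k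
    have A\<Delta>: "(A *v \<eta> t w) \<bullet> (\<Delta> *v \<eta> t w) = - (\<Sum>k<n. (u k \<bullet> \<eta> t w) * (\<delta> k \<bullet> \<eta> t w))" for t
    proof -
      have "A *v \<eta> t w = - (\<Sum>k<n. (u k \<bullet> \<eta> t w) *\<^sub>R a k)"
        using sum_matrix_vector_mult[of "\<lambda>k. outer (a k) (u k)" "{..<n}" "\<eta> t w"]
        by (simp add: A_def outer_mult_vector)
          (simp add: matrix_vector_mult_def vec_eq_iff sum_negf)
      then show ?thesis by (simp add: inner_sum_left \<delta>_def dot_lmul_matrix)
    qed
    have m_eq: "(\<Sum>t\<in>{1..T}. (u k \<bullet> \<eta> t w) * (\<delta> k \<bullet> \<eta> t w)) = \<delta> k \<bullet> m k w + real T * (\<delta> k \<bullet> g k)" for k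
      unfolding m_def inner_sum_right inner_diff_right by (simp add: sum_subtractf)
    have \<Gamma>\<Delta>: "\<Gamma> \<bullet> \<Delta> = - 2 * (\<Sum>k<n. \<delta> k \<bullet> g k)"
      by (simp add: \<Gamma>_dyads inner_sum_left inner_outer dot_lmul_matrix \<delta>_def g_def)
    have "(\<Sum>t\<in>{1..T}. 2 * ((A *v \<eta> t w) \<bullet> (\<Delta> *v \<eta> t w)))
        = - 2 * (\<Sum>k<n. \<Sum>t\<in>{1..T}. (u k \<bullet> \<eta> t w) * (\<delta> k \<bullet> \<eta> t w))"
      by (subst sum.swap) (simp add: A\<Delta> sum_distrib_left sum_negf)
    also have "\<dots> = real T * (\<Gamma> \<bullet> \<Delta>) - 2 * (\<Sum>k<n. \<delta> k \<bullet> m k w)"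
      unfolding m_eq sum.distrib \<Gamma>\<Delta> sum_distrib_left[symmetric] by (simp add: algebra_simps)
    also have "\<dots> \<ge> real T * (\<Sum>k<n. (norm (\<delta> k))\<^sup>2) - 2 * (\<Sum>k<n. \<delta> k \<bullet> m k w)"
      using growth[OF K] by (simp add: \<delta>_def \<Delta>_def mult_left_mono)
    moreover have "- (norm (m k w))\<^sup>2 / real T \<le> real T * (norm (\<delta> k))\<^sup>2 - 2 * (\<delta> k \<bullet> m k w)" for k
    proof -
      have "0 \<le> (norm (real T *\<^sub>R \<delta> k - m k w))\<^sup>2" by simp
      also have "\<dots> = real T * (real T * (norm (\<delta> k))\<^sup>2 - 2 * (\<delta> k \<bullet> m k w)) + (norm (m k w))\<^sup>2"
        by (simp add: power2_norm_eq_inner inner_diff_left inner_diff_right inner_commute algebra_simps)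
      finally show ?thesis using T by (simp add: field_simps)
    qed
    then have "(\<Sum>k<n. - (norm (m k w))\<^sup>2 / real T) \<le> (\<Sum>k<n. real T * (norm (\<delta> k))\<^sup>2 - 2 * (\<delta> k \<bullet> m k w))"
      by (rule sum_mono)
    ultimately have signal: "(\<Sum>t\<in>{1..T}. 2 * ((A *v \<eta> t w) \<bullet> (\<Delta> *v \<eta> t w))) \<ge> - (1 / real T) * (\<Sum>k<n. (norm (m k w))\<^sup>2)"
      by (simp add: sum_subtractf sum_negf sum_divide_distrib flip: sum_distrib_left)
    have "(\<Sum>t\<in>{1..T}. 2 * (\<zeta> t w \<bullet> (\<Delta> *v \<eta> t w)) + s * (norm (\<Delta> *v \<eta> t w))\<^sup>2)
        = (\<Sum>t\<in>{1..T}. 2 * (\<epsilon> t \<bullet> (\<Delta> *v \<eta> t w)) + s * (norm (\<Delta> *v \<eta> t w))\<^sup>2)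
          + (\<Sum>t\<in>{1..T}. 2 * ((A *v \<eta> t w) \<bullet> (\<Delta> *v \<eta> t w)))"
      by (simp add: \<zeta>_split inner_add_left sum.distrib)
    then show ?thesis using noise signal by (simp add: R_def \<Delta>_def)
  qed
  ultimately show ?thesis using R by (intro that[of R]) (auto simp: has_bochner_integral_iff)
qed

end

section \<open>Blocks of the agents\<close>

lemma inner_block_vec: "block_vec own i a \<bullet> y = a \<bullet> block_vec own i y"
  unfolding inner_vec_def by (intro sum.cong) (auto simp: block_vec_def)

lemma sum_norm_block_vec: "(\<Sum>i\<in>UNIV. (norm (block_vec own i y))\<^sup>2) = (norm y)\<^sup>2"
  for own :: "'k::finite \<Rightarrow> 'a::finite"
proof -
  have "(\<Sum>i\<in>UNIV. (block_vec own i y $ k)\<^sup>2) = (y $ k)\<^sup>2" for k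
    by (simp add: block_vec_def if_distrib[of "\<lambda>x. x\<^sup>2"] cong: if_cong)
  then show ?thesis unfolding norm_vec_squared by (subst sum.swap) simp
qed

lemma norm_block_vec_le: "norm (block_vec own i y) \<le> norm y" for own :: "'k::finite \<Rightarrow> 'a"
proof -
  have "(norm (block_vec own i y))\<^sup>2 \<le> (norm y)\<^sup>2"
    unfolding norm_vec_squared by (intro sum_mono) (simp add: block_vec_def)
  then show ?thesis by simp
qed

lemma agent_observation_block: "agent_observation own_y C i x v = block_vec own_y i (observation C x v)"
  by (simp add: agent_observation_def observation_def block_row_def block_vec_def vec_eq_iff
      matrix_vector_mult_def)

lemma block_row_transpose_mult: "block_row own_u i (transpose D) *v z = block_vec own_u i (z v* D)"
  by (simp add: block_row_def block_vec_def vec_eq_iff matrix_vector_mult_def vector_matrix_mult_def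
      transpose_def mult.commute)

lemma block_space_zero:
  "A \<in> block_space own_u own_y i \<Longrightarrow> \<not> (own_u r = i \<and> own_y c = i) \<Longrightarrow> A $ r $ c = 0"
  by (auto simp: block_space_def)

lemma block_space_mult:
  assumes "A \<in> block_space own_u own_y i"
  shows "A *v block_vec own_y i y = A *v y" and "block_vec own_u i (A *v y) = A *v y"
proof -
  have col: "A $ r $ c * block_vec own_y i y $ c = A $ r $ c * y $ c" for r c
    using assms by (auto simp: block_space_def block_vec_def)
  show "A *v block_vec own_y i y = A *v y"
    unfolding vec_eq_iff matrix_vector_mult_def by (simp add: col)
  have row: "(A *v y) $ r = 0" if "own_u r \<noteq> i" for r
  proof -
    have "A $ r $ c = 0" for c using assms that by (auto simp: block_space_def)
    then show ?thesis by (simp add: matrix_vector_mult_def)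
  qed
  then show "block_vec own_u i (A *v y) = A *v y"
    by (simp add: block_vec_def vec_eq_iff)
qed

text \<open>The orthogonal projection onto the space of gains of one agent.\<close>

definition block_part :: "('m \<Rightarrow> 'a) \<Rightarrow> ('p \<Rightarrow> 'a) \<Rightarrow> 'a \<Rightarrow> real^'p^'m \<Rightarrow> real^'p^'m" where
  "block_part own_u own_y i K = (\<chi> r c. if own_u r = i \<and> own_y c = i then K $ r $ c else 0)"

lemma block_part_in_space: "block_part own_u own_y i K \<in> block_space own_u own_y i"
  by (simp add: block_part_def block_space_def)

lemma block_part_mult: "block_part own_u own_y i K *v y = block_vec own_u i (K *v block_vec own_y i y)"
proof -
  have "(block_part own_u own_y i K *v y) $ r = block_vec own_u i (K *v block_vec own_y i y) $ r" for r
  proof (cases "own_u r = i")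
    case True
    have "block_part own_u own_y i K $ r $ c * y $ c = K $ r $ c * block_vec own_y i y $ c" for c
      using True by (simp add: block_part_def block_vec_def)
    then have "(block_part own_u own_y i K *v y) $ r = (K *v block_vec own_y i y) $ r"
      unfolding matrix_vector_mult_def by simp
    also have "\<dots> = block_vec own_u i (K *v block_vec own_y i y) $ r"
      using True by (simp add: block_vec_def[of own_u])
    finally show ?thesis .
  next
    case False
    then show ?thesis by (simp add: matrix_vector_mult_def block_part_def block_vec_def[of own_u])
  qed
  then show ?thesis unfolding vec_eq_iff by blast
qed

lemma block_part_self: "A \<in> block_space own_u own_y i \<Longrightarrow> block_part own_u own_y i A = A"
  by (auto simp: block_part_def block_space_def vec_eq_iff)

lemma inner_block_part: "block_part own_u own_y i A \<bullet> B = A \<bullet> block_part own_u own_y i B"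
  unfolding inner_vec_def by (intro sum.cong refl) (auto simp: block_part_def)

lemma opnorm_block_part: "opnorm (block_part own_u own_y i K) \<le> opnorm K"
  for K :: "real^'p::finite^'m::finite"
  unfolding opnorm_le_iff
proof (intro conjI allI opnorm_nonneg)
  fix x
  have "norm (block_part own_u own_y i K *v x) \<le> norm (K *v block_vec own_y i x)"
    unfolding block_part_mult by (rule norm_block_vec_le)
  also have "\<dots> \<le> opnorm K * norm (block_vec own_y i x)" by (rule norm_matrix_vector_le_opnorm)
  also have "\<dots> \<le> opnorm K * norm x" by (intro mult_left_mono norm_block_vec_le opnorm_nonneg)
  finally show "norm (block_part own_u own_y i K *v x) \<le> opnorm K * norm x" .
qed

lemma Diag_component:
  fixes Ks :: "'a::finite \<Rightarrow> real^'p^'m"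
  assumes "\<And>i. Ks i \<in> block_space own_u own_y i"
  shows "Diag Ks $ r $ c = Ks (own_u r) $ r $ c"
proof -
  have eq: "Ks i $ r $ c = (if i = own_u r then Ks i $ r $ c else 0)" for i
    using block_space_zero[OF assms[of i], of r c] by (cases "i = own_u r") auto
  have "(\<Sum>i\<in>UNIV. Ks i $ r $ c) = (\<Sum>i\<in>UNIV. if i = own_u r then Ks i $ r $ c else 0)"
    by (rule sum.cong[OF refl eq])
  then show ?thesis by (simp add: Diag_def sum_component)
qed

lemma block_part_Diag:
  fixes Ks :: "'a::finite \<Rightarrow> real^'p^'m"
  assumes Ks: "\<And>i. Ks i \<in> block_space own_u own_y i"
  shows "block_part own_u own_y i (Diag Ks) = Ks i"
proof -
  have "block_part own_u own_y i (Diag Ks) $ r $ c = Ks i $ r $ c" for r c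
  proof (cases "own_u r = i \<and> own_y c = i")
    case True
    then show ?thesis by (simp add: block_part_def Diag_component[OF Ks])
  next
    case False
    then show ?thesis using block_space_zero[OF Ks False] by (auto simp: block_part_def)
  qed
  then show ?thesis by (simp add: vec_eq_iff)
qed

lemma Diag_block_part:
  fixes own_u :: "'m::finite \<Rightarrow> 'a::finite"
  assumes "K \<in> block_diagonal own_u own_y"
  shows "Diag (\<lambda>i. block_part own_u own_y i K) = K"
proof -
  obtain Ks where "K = Diag Ks" "\<And>i. Ks i \<in> block_space own_u own_y i"
    using assms by (auto simp: block_diagonal_def)
  then show ?thesis by (simp add: block_part_Diag)
qed

lemma Diag_mult:
  fixes Ks :: "'a::finite \<Rightarrow> real^'p::finite^'m::finite"
  assumes "\<And>i. Ks i \<in> block_space own_u own_y i"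
  shows "Diag Ks *v y = (\<Sum>i\<in>UNIV. Ks i *v block_vec own_y i y)"
  by (simp add: Diag_def sum_matrix_vector_mult block_space_mult(1)[OF assms])

lemma norm_Diag_mult:
  fixes Ks :: "'a::finite \<Rightarrow> real^'p::finite^'m::finite"
  assumes "\<And>i. Ks i \<in> block_space own_u own_y i"
  shows "(norm (Diag Ks *v y))\<^sup>2 = (\<Sum>i\<in>UNIV. (norm (Ks i *v block_vec own_y i y))\<^sup>2)"
proof -
  have "block_vec own_u i (Diag Ks *v y) = Ks i *v block_vec own_y i y" for i
  proof -
    have "block_part own_u own_y i (Diag Ks) *v y = Ks i *v y" by (simp add: block_part_Diag[OF assms])
    moreover have "block_vec own_u i (Diag Ks *v block_vec own_y i y) = block_vec own_u i (Diag Ks *v y)"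
    proof -
      have "(Diag Ks *v block_vec own_y i y) $ r = (Diag Ks *v y) $ r" if "own_u r = i" for r
      proof -
        have eq: "Diag Ks $ r $ c * block_vec own_y i y $ c = Diag Ks $ r $ c * y $ c" for c
        proof (cases "own_y c = i")
          case False
          have "Ks i $ r $ c = 0" by (rule block_space_zero[OF assms]) (use False in simp)
          then show ?thesis using that by (simp add: Diag_component[OF assms])
        qed (simp add: block_vec_def)
        show ?thesis unfolding matrix_vector_mult_def vec_lambda_beta by (rule sum.cong[OF refl eq])
      qed
      then show ?thesis by (simp add: block_vec_def[of own_u] vec_eq_iff)
    qed
    ultimately show ?thesis by (simp add: block_part_mult block_space_mult(1)[OF assms])
  qed
  then show ?thesis using sum_norm_block_vec[of own_u "Diag Ks *v y"] by simp
qed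

lemma opnorm_Diag_le_iff:
  fixes Ks :: "'a::finite \<Rightarrow> real^'p::finite^'m::finite"
  assumes Ks: "\<And>i. Ks i \<in> block_space own_u own_y i"
  shows "opnorm (Diag Ks) \<le> b \<longleftrightarrow> (\<forall>i. opnorm (Ks i) \<le> b)"
proof
  assume "opnorm (Diag Ks) \<le> b"
  then show "\<forall>i. opnorm (Ks i) \<le> b"
    using opnorm_block_part[of own_u own_y _ "Diag Ks"] block_part_Diag[OF Ks] by (auto intro: order.trans)
next
  assume *: "\<forall>i. opnorm (Ks i) \<le> b"
  then have b: "0 \<le> b" using opnorm_nonneg order.trans by blast
  have "norm (Diag Ks *v y) \<le> b * norm y" for y
  proof (rule power2_le_imp_le)
    have "(norm (Ks i *v block_vec own_y i y))\<^sup>2 \<le> b\<^sup>2 * (norm (block_vec own_y i y))\<^sup>2" for i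
      using * power_mono[of "norm (Ks i *v block_vec own_y i y)" "b * norm (block_vec own_y i y)" 2]
      by (simp add: opnorm_le_iff power_mult_distrib)
    then have "(\<Sum>i\<in>UNIV. (norm (Ks i *v block_vec own_y i y))\<^sup>2)
        \<le> (\<Sum>i\<in>UNIV. b\<^sup>2 * (norm (block_vec own_y i y))\<^sup>2)" by (rule sum_mono)
    then show "(norm (Diag Ks *v y))\<^sup>2 \<le> (b * norm y)\<^sup>2"
      by (simp add: norm_Diag_mult[OF Ks] sum_distrib_left[symmetric] sum_norm_block_vec power_mult_distrib)
  qed (use b in simp)
  then show "opnorm (Diag Ks) \<le> b" using b by (simp add: opnorm_le_iff)
qed

lemma norm_Diag:
  fixes Ks :: "'a::finite \<Rightarrow> real^'p::finite^'m::finite"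
  assumes Ks: "\<And>i. Ks i \<in> block_space own_u own_y i"
  shows "(norm (Diag Ks))\<^sup>2 = (\<Sum>i\<in>UNIV. (norm (Ks i))\<^sup>2)"
proof -
  have "Diag Ks \<bullet> Diag Ks = (\<Sum>i\<in>UNIV. Diag Ks \<bullet> Ks i)" by (subst (2) Diag_def) (rule inner_sum_right)
  also have "\<dots> = (\<Sum>i\<in>UNIV. Ks i \<bullet> Ks i)"
  proof (intro sum.cong refl)
    fix i
    have "Diag Ks \<bullet> Ks i = Diag Ks \<bullet> block_part own_u own_y i (Ks i)" by (simp add: block_part_self[OF Ks])
    also have "\<dots> = Ks i \<bullet> Ks i" by (simp add: block_part_Diag[OF Ks] flip: inner_block_part)
    finally show "Diag Ks \<bullet> Ks i = Ks i \<bullet> Ks i" .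
  qed
  finally show ?thesis by (simp add: power2_norm_eq_inner)
qed

lemma Diag_diff: "Diag (\<lambda>i. A i - B i) = Diag A - Diag B"
  by (simp add: Diag_def sum_subtractf)

lemma block_space_diff:
  "A \<in> block_space own_u own_y i \<Longrightarrow> B \<in> block_space own_u own_y i \<Longrightarrow> A - B \<in> block_space own_u own_y i"
  by (auto simp: block_space_def)

lemma opnorm_convex:
  fixes A B :: "real^'p::finite^'m::finite"
  assumes "opnorm A \<le> b" "opnorm B \<le> b" "0 \<le> s" "s \<le> 1"
  shows "opnorm ((1 - s) *\<^sub>R A + s *\<^sub>R B) \<le> b"
  unfolding opnorm_le_iff
proof (intro conjI allI)
  show "0 \<le> b" using assms by (simp add: opnorm_le_iff)
  fix x
  have "norm (((1 - s) *\<^sub>R A + s *\<^sub>R B) *v x) = norm ((1 - s) *\<^sub>R (A *v x) + s *\<^sub>R (B *v x))"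
    by (simp add: matrix_vector_mult_add_rdistrib flip: scaleR_matrix_vector_assoc)
  also have "\<dots> \<le> (1 - s) * norm (A *v x) + s * norm (B *v x)"
    using assms by (intro order.trans[OF norm_triangle_ineq]) simp
  also have "\<dots> \<le> (1 - s) * (b * norm x) + s * (b * norm x)"
  proof -
    have "norm (A *v x) \<le> b * norm x" "norm (B *v x) \<le> b * norm x"
      using assms(1,2) by (simp_all add: opnorm_le_iff)
    then show ?thesis using assms(3,4) by (intro add_mono mult_left_mono) simp_all
  qed
  finally show "norm (((1 - s) *\<^sub>R A + s *\<^sub>R B) *v x) \<le> b * norm x" by (simp add: algebra_simps)
qed

lemma closed_opnorm_ball: "closed {A :: real^'p::finite^'m::finite. opnorm A \<le> b}"
proof -
  have "{A :: real^'p^'m. opnorm A \<le> b} = (if 0 \<le> b then (\<Inter>x. {A. norm (A *v x) \<le> b * norm x}) else {})"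
    by (auto simp: opnorm_le_iff)
  moreover have "continuous_on UNIV (\<lambda>A :: real^'p^'m. A *v x)" for x
    unfolding matrix_vector_mult_def by (intro continuous_intros)
  then have "closed {A :: real^'p^'m. norm (A *v x) \<le> b * norm x}" for x
    by (intro closed_Collect_le continuous_intros) auto
  ultimately show ?thesis by auto
qed

lemma norm_le_opnorm: "(norm K)\<^sup>2 \<le> real CARD('m) * (opnorm K)\<^sup>2" for K :: "real^'p::finite^'m::finite"
proof -
  have row: "norm (K $ r) \<le> opnorm K" for r
  proof -
    have "axis r 1 v* K = K $ r"
      by (simp add: vector_matrix_mult_def vec_eq_iff axis_def if_distrib[of "\<lambda>x. x * _"] cong: if_cong)
    then show ?thesis using norm_vector_matrix_le_opnorm[of "axis r 1" K] by simp
  qed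
  have "(norm K)\<^sup>2 = (\<Sum>r\<in>UNIV. (norm (K $ r))\<^sup>2)"
    by (simp add: power2_norm_eq_inner inner_vec_def[of K])
  also have "\<dots> \<le> (\<Sum>r\<in>(UNIV::'m set). (opnorm K)\<^sup>2)"
    by (intro sum_mono power_mono row) auto
  finally show ?thesis by simp
qed

definition block_ball :: "('m \<Rightarrow> 'a) \<Rightarrow> ('p \<Rightarrow> 'a) \<Rightarrow> real \<Rightarrow> 'a \<Rightarrow> (real^'p^'m) set" where
  "block_ball own_u own_y b i = {A \<in> block_space own_u own_y i. opnorm A \<le> b}"

lemma block_ball:
  fixes own_u :: "'m::finite \<Rightarrow> 'a" and own_y :: "'p::finite \<Rightarrow> 'a"
  assumes "0 \<le> b"
  shows "convex (block_ball own_u own_y b i)" "closed (block_ball own_u own_y b i)"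
    "block_ball own_u own_y b i \<noteq> {}"
proof -
  show "convex (block_ball own_u own_y b i)"
    unfolding convex_alt block_ball_def
  proof safe
    fix A B :: "real^'p^'m" and s :: real
    assume *: "A \<in> block_space own_u own_y i" "B \<in> block_space own_u own_y i" "opnorm A \<le> b" "opnorm B \<le> b" "0 \<le> s" "s \<le> 1"
    then show "(1 - s) *\<^sub>R A + s *\<^sub>R B \<in> block_space own_u own_y i" by (auto simp: block_space_def)
    show "opnorm ((1 - s) *\<^sub>R A + s *\<^sub>R B) \<le> b" using * by (intro opnorm_convex)
  qed
  have "block_space own_u own_y i
      = (\<Inter>(r, c)\<in>{(r, c). \<not> (own_u r = i \<and> own_y c = i)}. {A :: real^'p^'m. A $ r $ c = 0})"
    by (auto simp: block_space_def)
  also have "closed \<dots>"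
    by (intro closed_INT ballI) (auto intro!: closed_Collect_eq continuous_intros)
  finally have "closed (block_space own_u own_y i :: (real^'p^'m) set)" .
  moreover have "block_ball own_u own_y b i = block_space own_u own_y i \<inter> {A. opnorm A \<le> b}"
    by (auto simp: block_ball_def)
  ultimately show "closed (block_ball own_u own_y b i)" using closed_opnorm_ball by auto
  have "0 \<in> block_ball own_u own_y b i"
    using assms by (simp add: block_ball_def block_space_def opnorm_le_iff)
  then show "block_ball own_u own_y b i \<noteq> {}" by blast
qed

section \<open>The gains as functions of the past\<close>

lemma borel_measurable_vecI:
  fixes f :: "'w \<Rightarrow> real^'n::finite"
  assumes "\<And>i. (\<lambda>w. f w $ i) \<in> borel_measurable M"
  shows "f \<in> borel_measurable M"
  by (subst borel_measurable_euclidean_space) (use assms in \<open>auto simp: Basis_vec_def inner_axis\<close>)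

lemma borel_measurable_matrixI:
  fixes f :: "'w \<Rightarrow> real^'n::finite^'m::finite"
  assumes "\<And>r c. (\<lambda>w. f w $ r $ c) \<in> borel_measurable M"
  shows "f \<in> borel_measurable M"
  by (subst borel_measurable_euclidean_space) (use assms in \<open>auto simp: Basis_vec_def inner_axis\<close>)

lemma borel_measurable_matrix_nth:
  fixes f :: "'w \<Rightarrow> real^'n::finite^'m::finite"
  assumes "f \<in> borel_measurable M"
  shows "(\<lambda>w. f w $ r $ c) \<in> borel_measurable M"
  by (rule measurable_compose[OF assms borel_measurable_continuous_onI]) (intro continuous_intros)

lemma borel_measurable_matrix_vector_mult:
  fixes A :: "'w \<Rightarrow> real^'n::finite^'m::finite"
  assumes "A \<in> borel_measurable M" "y \<in> borel_measurable M"
  shows "(\<lambda>w. A w *v y w) \<in> borel_measurable M"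
proof (rule borel_measurable_vecI)
  fix i
  show "(\<lambda>w. (A w *v y w) $ i) \<in> borel_measurable M"
    unfolding matrix_vector_mult_def vec_lambda_beta
    by (intro borel_measurable_sum borel_measurable_times borel_measurable_matrix_nth[OF assms(1)]
        borel_measurable_vec_nth[OF assms(2)])
qed

lemma borel_measurable_loss:
  fixes K :: "'w \<Rightarrow> real^'p::finite^'m::finite" and H :: "real^'n::finite^'q::finite"
  assumes "x \<in> borel_measurable M" "v \<in> borel_measurable M" "K \<in> borel_measurable M"
  shows "(\<lambda>w. loss H D C (x w) (v w) (K w)) \<in> borel_measurable M"
proof -
  have [measurable]: "(\<lambda>w. H *v x w + D *v (K w *v (C *v x w + v w))) \<in> borel_measurable M"
    using assms by (intro borel_measurable_add borel_measurable_matrix_vector_mult borel_measurable_const)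
  show ?thesis unfolding loss_def observation_def by measurable
qed

lemma borel_measurable_partial_gradient:
  fixes Ks :: "'w \<Rightarrow> 'a::finite \<Rightarrow> real^'p::finite^'m::finite" and H :: "real^'n::finite^'q::finite"
  assumes "x \<in> borel_measurable M" "v \<in> borel_measurable M" "\<And>i. (\<lambda>w. Ks w i) \<in> borel_measurable M"
  shows "(\<lambda>w. partial_gradient own_u own_y H D C (x w) (v w) (Ks w) i) \<in> borel_measurable M"
proof (rule borel_measurable_matrixI)
  fix r c
  have bv: "(\<lambda>w. block_vec own_y i (f w)) \<in> borel_measurable M"
    if "f \<in> borel_measurable M" for f :: "'w \<Rightarrow> real^'p" and i
    by (rule borel_measurable_vecI) (use borel_measurable_vec_nth[OF that] in \<open>simp add: block_vec_def\<close>)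
  have obs: "(\<lambda>w. agent_observation own_y C i (x w) (v w)) \<in> borel_measurable M" for i
    unfolding agent_observation_def using assms
    by (intro borel_measurable_add borel_measurable_matrix_vector_mult borel_measurable_const bv)
  have "(\<lambda>w. outcome own_y H D C (x w) (v w) (Ks w)) \<in> borel_measurable M"
    unfolding outcome_def using assms
    by (intro borel_measurable_add borel_measurable_matrix_vector_mult borel_measurable_const
        borel_measurable_sum obs)
  then have "(\<lambda>w. (block_row own_u i (transpose D) *v outcome own_y H D C (x w) (v w) (Ks w)) $ r) \<in> borel_measurable M"
    by (intro borel_measurable_vec_nth borel_measurable_matrix_vector_mult borel_measurable_const)
  then show "(\<lambda>w. partial_gradient own_u own_y H D C (x w) (v w) (Ks w) i $ r $ c) \<in> borel_measurable M"
    using borel_measurable_vec_nth[OF obs] by (simp add: partial_gradient_def outer_def)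
qed

text \<open>
  The gains after \<open>n\<close> rounds as a function of the sample path \<open>\<xi>\<close> of signal and noise, which
  makes explicit that they depend on the first \<open>n\<close> entries of the path only.
\<close>

primrec gains ::
    "('m \<Rightarrow> 'a::finite) \<Rightarrow> ('p \<Rightarrow> 'a) \<Rightarrow> real^'n^'q \<Rightarrow> real^'m^'q \<Rightarrow> real^'n^'p
      \<Rightarrow> real \<Rightarrow> (nat \<Rightarrow> real) \<Rightarrow> ('a \<Rightarrow> real^'p^'m) \<Rightarrow> (nat \<Rightarrow> (real^'n) \<times> (real^'p)) \<Rightarrow> nat \<Rightarrow> 'a \<Rightarrow> real^'p^'m" where
  "gains own_u own_y H D C b \<eta> K1 \<xi> 0 = K1"
| "gains own_u own_y H D C b \<eta> K1 \<xi> (Suc n) = (\<lambda>i. closest_point (block_ball own_u own_y b i)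
      (gains own_u own_y H D C b \<eta> K1 \<xi> n i - \<eta> (Suc n) *\<^sub>R
        partial_gradient own_u own_y H D C (fst (\<xi> (Suc n))) (snd (\<xi> (Suc n)))
          (gains own_u own_y H D C b \<eta> K1 \<xi> n) i))"

lemma gains_run:
  assumes "partial_gradient_run own_u own_y H D C b \<eta> T x v K1 Ks" "n \<le> T"
  shows "Ks (Suc n) = gains own_u own_y H D C b \<eta> K1 (\<lambda>t. (x t, v t)) n"
  using assms(2)
proof (induction n)
  case 0
  then show ?case using assms(1) by (simp add: partial_gradient_run_def)
next
  case (Suc n)
  then have "Suc n \<in> {1..T}" by simp
  with assms(1) have "Ks (Suc (Suc n)) i = closest_point (block_ball own_u own_y b i)
      (Ks (Suc n) i - \<eta> (Suc n) *\<^sub>R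
        partial_gradient own_u own_y H D C (x (Suc n)) (v (Suc n)) (Ks (Suc n)) i)" for i
    unfolding partial_gradient_run_def block_ball_def by blast
  moreover have "Ks (Suc n) = gains own_u own_y H D C b \<eta> K1 (\<lambda>t. (x t, v t)) n" using Suc by simp
  ultimately show ?case by (intro ext) simp
qed

lemma gains_cong:
  assumes "\<And>t. t \<in> {1..n} \<Longrightarrow> \<xi> t = \<xi>' t"
  shows "gains own_u own_y H D C b \<eta> K1 \<xi> n = gains own_u own_y H D C b \<eta> K1 \<xi>' n"
  using assms by (induction n) simp_all

lemma gains_in_block_ball:
  fixes own_u :: "'m::finite \<Rightarrow> 'a::finite" and own_y :: "'p::finite \<Rightarrow> 'a"
  assumes "0 \<le> b" "\<And>i. K1 i \<in> block_ball own_u own_y b i"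
  shows "gains own_u own_y H D C b \<eta> K1 \<xi> n i \<in> block_ball own_u own_y b i"
proof (cases n)
  case (Suc k)
  show ?thesis unfolding Suc gains.simps by (rule closest_point_in_set[OF block_ball(2,3)[OF assms(1)]])
qed (use assms in simp)

lemma borel_measurable_gains:
  fixes own_u :: "'m::finite \<Rightarrow> 'a::finite" and own_y :: "'p::finite \<Rightarrow> 'a" and H :: "real^'n::finite^'q::finite"
  assumes b: "0 \<le> b" and \<xi>: "\<And>t. t \<in> {1..n} \<Longrightarrow> (\<lambda>w. \<xi> w t) \<in> borel_measurable M"
  shows "(\<lambda>w. gains own_u own_y H D C b \<eta> K1 (\<xi> w) n i) \<in> borel_measurable M"
  using \<xi>
proof (induction n arbitrary: i)
  case (Suc n)
  have IH: "(\<lambda>w. gains own_u own_y H D C b \<eta> K1 (\<xi> w) n i) \<in> borel_measurable M" for i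
    using Suc by simp
  have xi: "(\<lambda>w. \<xi> w (Suc n)) \<in> borel_measurable M" using Suc.prems by simp
  have cp: "closest_point (block_ball own_u own_y b i) \<in> borel_measurable borel"
    by (intro borel_measurable_continuous_onI continuous_on_closest_point block_ball b)
  have fs: "(\<lambda>w. fst (\<xi> w (Suc n))) \<in> borel_measurable M" "(\<lambda>w. snd (\<xi> w (Suc n))) \<in> borel_measurable M"
    by (rule measurable_compose[OF xi borel_measurable_continuous_onI], intro continuous_intros)+
  show ?case
    unfolding gains.simps
    by (intro measurable_compose[OF _ cp] borel_measurable_diff borel_measurable_scaleR
        borel_measurable_const borel_measurable_partial_gradient IH fs)
qed simp

section \<open>Two scalar estimates\<close>

text \<open>
  The difference decreases in \<open>T\<close>. At \<open>T = 3\<close> the claim is \<open>11/6 - 3/4 = 13/12 \<le> ln 3\<close>, that is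
  \<open>e\<^sup>1\<^sup>3 \<le> 3\<^sup>1\<^sup>2\<close>; already at \<open>T = 2\<close> it fails.
\<close>

lemma harm_le_ln:
  assumes "T \<ge> 3"
  shows "harm T \<le> ln (real T) + 3 / 4"
  using assms
proof (induction T rule: dec_induct)
  case base
  have "exp (1::real) ^ 13 \<le> (272 / 100) ^ 13"
    using e_less_272 by (intro power_mono) auto
  also have "\<dots> \<le> (3::real) ^ 12" by (simp add: power_divide)
  finally have "exp (13 / 12 :: real) ^ 12 \<le> 3 ^ 12" by (simp flip: exp_of_nat_mult)
  then have "exp (13 / 12 :: real) \<le> 3" using power_le_imp_le_base[of "exp (13 / 12 :: real)" 11 3] by simp
  then have "13 / 12 \<le> ln (3::real)" by (subst ln_ge_iff) auto
  moreover have "harm 3 = (11 / 6 :: real)" by (simp add: harm_def numeral_eq_Suc)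
  ultimately show ?case by simp
next
  case (step n)
  have "ln (real n / real (Suc n)) \<le> real n / real (Suc n) - 1"
    using step by (intro ln_le_minus_one) simp
  then have "1 / real (Suc n) \<le> ln (real (Suc n)) - ln (real n)"
    using step by (simp add: ln_div field_simps)
  with step show ?case by (simp add: harm_Suc inverse_eq_divide)
qed

text \<open>The best weight is \<open>\<beta> / f\<close>; both are perturbed because either may vanish.\<close>

lemma le_mult_of_weighted_am_gm:
  fixes e f \<beta> :: real
  assumes "\<And>s. s > 0 \<Longrightarrow> 2 * e \<le> s * f\<^sup>2 + \<beta>\<^sup>2 / s" "0 \<le> f" "0 \<le> \<beta>"
  shows "e \<le> f * \<beta>"
proof -
  have "e \<le> (f + \<epsilon>) * (\<beta> + \<epsilon>)" if \<epsilon>: "\<epsilon> > 0" for \<epsilon>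
  proof -
    define s where "s = (\<beta> + \<epsilon>) / (f + \<epsilon>)"
    have pos: "f + \<epsilon> > 0" "\<beta> + \<epsilon> > 0" using assms \<epsilon> by auto
    then have "s > 0" by (simp add: s_def)
    have "s * f\<^sup>2 \<le> s * (f + \<epsilon>)\<^sup>2" "\<beta>\<^sup>2 / s \<le> (\<beta> + \<epsilon>)\<^sup>2 / s"
      using \<open>s > 0\<close> assms \<epsilon> by (auto intro!: mult_left_mono divide_right_mono power_mono)
    moreover have "s * (f + \<epsilon>)\<^sup>2 = (f + \<epsilon>) * (\<beta> + \<epsilon>)" "(\<beta> + \<epsilon>)\<^sup>2 / s = (f + \<epsilon>) * (\<beta> + \<epsilon>)"
      using pos by (simp_all add: s_def power2_eq_square)
    ultimately show ?thesis using assms(1)[OF \<open>s > 0\<close>] by linarith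
  qed
  moreover have "((\<lambda>\<epsilon>. (f + \<epsilon>) * (\<beta> + \<epsilon>)) \<longlongrightarrow> (f + 0) * (\<beta> + 0)) (at_right 0)"
    by (intro tendsto_intros)
  ultimately show ?thesis
    by (intro tendsto_lowerbound[of "\<lambda>\<epsilon>. (f + \<epsilon>) * (\<beta> + \<epsilon>)" "f * \<beta>" "at_right 0"])
      (auto intro: eventually_mono[OF eventually_at_right_less])
qed

section \<open>The signal and the noise as one Gaussian vector\<close>

lemma Int_stable_vimage_borel: "Int_stable {X -` A \<inter> S |A. A \<in> sets borel}"
proof (rule Int_stableI)
  fix a b
  assume "a \<in> {X -` A \<inter> S |A. A \<in> sets borel}" "b \<in> {X -` A \<inter> S |A. A \<in> sets borel}"
  then obtain A B where "A \<in> sets borel" "B \<in> sets borel" "a = X -` A \<inter> S" "b = X -` B \<inter> S" by blast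
  then show "a \<inter> b \<in> {X -` A \<inter> S |A. A \<in> sets borel}"
    by (intro CollectI exI[of _ "A \<inter> B"]) auto
qed

lemma indep_var_of_independent_rv:
  fixes X :: "'w \<Rightarrow> 'b::topological_space" and Y :: "'w \<Rightarrow> 'c::topological_space"
    and f :: "'b \<Rightarrow> 'd::topological_space" and g :: "'c \<Rightarrow> 'd"
  assumes P: "prob_space P" and ind: "independent_rv P X Y"
    and f: "f \<in> borel_measurable borel" and g: "g \<in> borel_measurable borel"
  shows "prob_space.indep_var P borel (\<lambda>w. f (X w)) borel (\<lambda>w. g (Y w))"
proof -
  interpret prob_space P by fact
  define MX MY where "MX = {X -` A \<inter> space P |A. A \<in> sets borel}" and "MY = {Y -` B \<inter> space P |B. B \<in> sets borel}"
  have m: "X \<in> borel_measurable P" "Y \<in> borel_measurable P" and ind': "indep_set MX MY"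
    using ind by (auto simp: independent_rv_def MX_def MY_def)
  have "Int_stable MX" "Int_stable MY"
    unfolding MX_def MY_def by (rule Int_stable_vimage_borel)+
  with ind' have "indep_set (sigma_sets (space P) MX) (sigma_sets (space P) MY)"
    by (intro indep_set_sigma_sets)
  moreover have "{(\<lambda>w. f (X w)) -` A \<inter> space P |A. A \<in> sets borel} \<subseteq> MX"
  proof safe
    fix A :: "'d set" assume "A \<in> sets borel"
    then have "f -` A \<in> sets borel" using f by (metis measurable_sets_borel)
    then show "(\<lambda>w. f (X w)) -` A \<inter> space P \<in> MX"
      unfolding MX_def by (intro CollectI exI[of _ "f -` A"]) auto
  qed
  moreover have "{(\<lambda>w. g (Y w)) -` A \<inter> space P |A. A \<in> sets borel} \<subseteq> MY"
  proof safe
    fix A :: "'d set" assume "A \<in> sets borel"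
    then have "g -` A \<in> sets borel" using g by (metis measurable_sets_borel)
    then show "(\<lambda>w. g (Y w)) -` A \<inter> space P \<in> MY"
      unfolding MY_def by (intro CollectI exI[of _ "g -` A"]) auto
  qed
  ultimately have "indep_set (sigma_sets (space P) {(\<lambda>w. f (X w)) -` A \<inter> space P |A. A \<in> sets borel})
      (sigma_sets (space P) {(\<lambda>w. g (Y w)) -` A \<inter> space P |A. A \<in> sets borel})"
    unfolding indep_set_def
    by (elim indep_sets_mono_sets) (auto split: bool.split intro: sigma_sets_mono' [THEN subsetD])
  then show ?thesis
    unfolding indep_var_eq using m f g by (auto intro: measurable_compose)
qed

definition joint_covariance :: "real^'n^'n \<Rightarrow> real^'p^'p \<Rightarrow> (real^'n) \<times> (real^'p) \<Rightarrow> (real^'n) \<times> (real^'p) \<Rightarrow> real" where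
  "joint_covariance Vx Vv c d = fst c \<bullet> (Vx *v fst d) + snd c \<bullet> (Vv *v snd d)"

text \<open>
  A projection of the pair is a sum of two independent centred normal variables. Characteristic functions
  cover the degenerate variances along with the others.
\<close>

lemma gaussian_sequence_pair:
  fixes x :: "nat \<Rightarrow> 'w \<Rightarrow> real^'n::finite" and v :: "nat \<Rightarrow> 'w \<Rightarrow> real^'p::finite"
  assumes P: "prob_space P"
    and x: "\<And>t. t \<ge> 1 \<Longrightarrow> centered_gaussian P Vx (x t)"
    and v: "\<And>t. t \<ge> 1 \<Longrightarrow> centered_gaussian P Vv (v t)"
    and xv: "\<And>t. t \<ge> 1 \<Longrightarrow> independent_rv P (x t) (v t)"
    and time: "prob_space.indep_vars P (\<lambda>_. borel) (\<lambda>t w. (x t w, v t w)) {1..}"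
  shows "gaussian_sequence P (\<lambda>t w. (x t w, v t w)) (joint_covariance Vx Vv)"
proof -
  interpret prob_space P by fact
  have psd: "positive_semidefinite Vx" "positive_semidefinite Vv"
    using x[of 1] v[of 1] by (auto simp: centered_gaussian_def)
  have sym: "a \<bullet> (V *v b) = b \<bullet> (V *v a)" if "positive_semidefinite V" for V :: "real^'k::finite^'k" and a b
    using that by (metis dot_lmul_matrix inner_commute positive_semidefinite_def transpose_matrix_vector)
  have nn: "0 \<le> a \<bullet> (V *v a)" if "positive_semidefinite V" for V :: "real^'k::finite^'k" and a
    using that by (simp add: positive_semidefinite_def)
  have char1: "(\<integral>w. iexp (u * (a \<bullet> X w)) \<partial>P) = of_real (exp (- (u\<^sup>2 * (a \<bullet> (V *v a))) / 2))"
    if "centered_gaussian P V X" for u a and X :: "'w \<Rightarrow> real^'k::finite" and V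
  proof -
    have "X \<in> borel_measurable P" "positive_semidefinite V"
      "distr P borel (\<lambda>w. a \<bullet> X w) = normal_law 0 (sqrt (a \<bullet> (V *v a)))"
      using that by (auto simp: centered_gaussian_def)
    then have "(\<integral>w. iexp (u * (a \<bullet> X w)) \<partial>P) = (\<integral>s. iexp (u * s) \<partial>normal_law 0 (sqrt (a \<bullet> (V *v a))))"
      by (subst integral_distr[symmetric, where N = borel and f = "\<lambda>s. iexp (u * s)"]) auto
    also have "\<dots> = of_real (exp (- (u\<^sup>2 * (sqrt (a \<bullet> (V *v a)))\<^sup>2) / 2))"
      by (rule normal_law_moments(3)) (use nn[OF \<open>positive_semidefinite V\<close>] in simp)
    finally show ?thesis using nn[OF \<open>positive_semidefinite V\<close>] by simp
  qed
  show ?thesis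
  proof (unfold_locales)
    show "bilinear (joint_covariance Vx Vv)"
      by (simp add: bilinear_def linear_iff joint_covariance_def matrix_vector_right_distrib
          matrix_vector_mult_scaleR inner_add_left inner_add_right algebra_simps)
    show "joint_covariance Vx Vv c d = joint_covariance Vx Vv d c" for c d
      unfolding joint_covariance_def sym[OF psd(1), of "fst c"] sym[OF psd(2), of "snd c"] ..
    show Qnn: "0 \<le> joint_covariance Vx Vv c c" for c
      using nn[OF psd(1)] nn[OF psd(2)] by (simp add: joint_covariance_def)
    show "indep_vars (\<lambda>_. borel) (\<lambda>t w. (x t w, v t w)) {1..}" by (rule time)
    fix t :: nat and c :: "(real^'n) \<times> (real^'p)"
    assume t: "t \<ge> 1"
    have [measurable]: "x t \<in> borel_measurable P" "v t \<in> borel_measurable P"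
      using x[OF t] v[OF t] by (auto simp: centered_gaussian_def)
    have mc: "(\<lambda>w. c \<bullet> (x t w, v t w)) \<in> borel_measurable P"
      by (simp add: inner_prod_def)
    define q where "q = joint_covariance Vx Vv c c"
    have q: "0 \<le> sqrt q" using Qnn by (simp add: q_def)
    show "distr P borel (\<lambda>w. c \<bullet> (x t w, v t w)) = normal_law 0 (sqrt (joint_covariance Vx Vv c c))"
      unfolding q_def[symmetric]
    proof (rule Levy_uniqueness)
      show "real_distribution (distr P borel (\<lambda>w. c \<bullet> (x t w, v t w)))" using mc by simp
      show "real_distribution (normal_law 0 (sqrt q))"
      proof (cases "sqrt q = 0")
        case True
        then show ?thesis
          by (auto simp: normal_law_def real_distribution_def real_distribution_axioms_def intro!: prob_space_return)
      next
        case False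
        then show ?thesis using q prob_space_normal_density[of "sqrt q" 0]
          by (simp add: normal_law_def real_distribution_def real_distribution_axioms_def)
      qed
      show "char (distr P borel (\<lambda>w. c \<bullet> (x t w, v t w))) = char (normal_law 0 (sqrt q))"
      proof
        fix u
        have "char (distr P borel (\<lambda>w. c \<bullet> (x t w, v t w))) u = (\<integral>w. iexp (u * (c \<bullet> (x t w, v t w))) \<partial>P)"
          unfolding char_def using mc by (subst integral_distr) auto
        also have "\<dots> = (\<integral>w. iexp (u * (fst c \<bullet> x t w)) * iexp (u * (snd c \<bullet> v t w)) \<partial>P)"
          by (simp add: inner_prod_def algebra_simps flip: exp_add)
        also have "\<dots> = (\<integral>w. iexp (u * (fst c \<bullet> x t w)) \<partial>P) * (\<integral>w. iexp (u * (snd c \<bullet> v t w)) \<partial>P)"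
        proof (rule indep_var_lebesgue_integral)
          show "indep_var borel (\<lambda>w. iexp (u * (fst c \<bullet> x t w))) borel (\<lambda>w. iexp (u * (snd c \<bullet> v t w)))"
            by (rule indep_var_of_independent_rv[OF P xv[OF t], of "\<lambda>y. iexp (u * (fst c \<bullet> y))" "\<lambda>y. iexp (u * (snd c \<bullet> y))"])
              (intro borel_measurable_continuous_onI continuous_intros)+
        qed (rule integrable_const_bound[where B = 1]; auto)+
        also have "\<dots> = of_real (exp (- (u\<^sup>2 * (fst c \<bullet> (Vx *v fst c))) / 2) * exp (- (u\<^sup>2 * (snd c \<bullet> (Vv *v snd c))) / 2))"
          unfolding char1[OF x[OF t]] char1[OF v[OF t]] by simp
        also have "\<dots> = of_real (exp (- (u\<^sup>2 * (sqrt q)\<^sup>2) / 2))"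
          using Qnn[of c] by (simp add: q_def joint_covariance_def ring_distribs add_divide_distrib flip: exp_add)
        also have "\<dots> = char (normal_law 0 (sqrt q)) u"
          unfolding char_def by (rule normal_law_moments(3)[OF q, symmetric])
        finally show "char (distr P borel (\<lambda>w. c \<bullet> (x t w, v t w))) u = char (normal_law 0 (sqrt q)) u" .
      qed
    qed
  qed
qed

section \<open>The team problem\<close>

text \<open>
  Here \<open>s\<close> and \<open>\<sigma>\<close> are lower bounds for \<open>D\<^sup>T D\<close> and for the covariance \<open>C Vx C\<^sup>T + Vv\<close> of the observation.
\<close>

locale team_problem = prob_space P for P :: "'w measure" +
  fixes own_u :: "'m::finite \<Rightarrow> 'a::finite" and own_y :: "'p::finite \<Rightarrow> 'a"
    and H :: "real^'n::finite^'q::finite" and D :: "real^'m^'q" and C :: "real^'n^'p"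
    and Vx :: "real^'n^'n" and Vv :: "real^'p^'p"
    and x :: "nat \<Rightarrow> 'w \<Rightarrow> real^'n" and v :: "nat \<Rightarrow> 'w \<Rightarrow> real^'p"
    and \<kappa>x \<kappa>v b s \<sigma> :: real
  assumes gaussian: "gaussian_sequence P (\<lambda>t w. (x t w, v t w)) (joint_covariance Vx Vv)"
    and x_fourth: "\<And>t. t \<ge> 1 \<Longrightarrow> integrable P (\<lambda>w. (x t w \<bullet> x t w)\<^sup>2) \<and> (\<integral>w. (x t w \<bullet> x t w)\<^sup>2 \<partial>P) \<le> \<kappa>x"
    and v_fourth: "\<And>t. t \<ge> 1 \<Longrightarrow> integrable P (\<lambda>w. (v t w \<bullet> v t w)\<^sup>2) \<and> (\<integral>w. (v t w \<bullet> v t w)\<^sup>2 \<partial>P) \<le> \<kappa>v"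
    and s: "s > 0" "\<And>u. s * (norm u)\<^sup>2 \<le> (norm (D *v u))\<^sup>2"
    and \<sigma>: "\<sigma> > 0" "\<And>u. \<sigma> * (norm u)\<^sup>2 \<le> (u v* C) \<bullet> (Vx *v (u v* C)) + u \<bullet> (Vv *v u)"
    and b: "b \<ge> 0"
begin

sublocale gaussian_sequence P "\<lambda>t w. (x t w, v t w)" "joint_covariance Vx Vv"
  by (rule gaussian)

abbreviation Q where "Q \<equiv> joint_covariance Vx Vv"
abbreviation X where "X t w \<equiv> (x t w, v t w)"

text \<open>
  The coordinates of the observation \<open>Y\<close>, of the outcome \<open>Z K\<close> and of \<open>D\<^sup>T Z\<close> are projections of the pair
  \<open>X\<close>; \<open>yc\<close>, \<open>zq\<close> and \<open>zr\<close> are the covectors. Thus \<open>F\<close> is the expected loss, \<open>\<Gamma>\<close> its gradient, \<open>S\<close> the covariance of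
  the observation, and \<open>\<tau>y\<close>, \<open>\<tau>\<close> are the second moments of \<open>Y\<close> and \<open>X\<close>. The fourth moment of \<open>X\<close> is at most
  \<open>E4\<close>, and \<open>A\<close> bounds the outcome of any gain in \<open>W\<close> relative to \<open>X\<close>.
\<close>

definition Y where "Y t w = observation C (x t w) (v t w)"
definition Z where "Z K t w = H *v x t w + D *v (K *v Y t w)"

definition yc :: "'p \<Rightarrow> (real^'n) \<times> (real^'p)" where "yc c = (C $ c, axis c 1)"
definition zq :: "real^'p^'m \<Rightarrow> 'q \<Rightarrow> (real^'n) \<times> (real^'p)" where
  "zq K i = ((H + D ** K ** C) $ i, (D ** K) $ i)"
definition zr :: "real^'p^'m \<Rightarrow> 'm \<Rightarrow> (real^'n) \<times> (real^'p)" where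
  "zr K r = (\<Sum>i\<in>UNIV. D $ i $ r *\<^sub>R zq K i)"

definition F where "F K = (\<Sum>i\<in>UNIV. Q (zq K i) (zq K i))"
definition \<Gamma> where "\<Gamma> K = (\<chi> r c. 2 * Q (zr K r) (yc c))"
definition S where "S = (\<chi> c d. Q (yc c) (yc d))"
definition \<tau>y where "\<tau>y = (\<Sum>c\<in>UNIV. Q (yc c) (yc c))"
definition \<tau> where "\<tau> = trace Vx + trace Vv"
definition A where "A = opnorm H + b * opnorm D * (opnorm C + 1)"
definition E4 where "E4 = \<kappa>x + 2 * trace Vx * trace Vv + \<kappa>v"
definition W where "W = {K \<in> block_diagonal own_u own_y. opnorm K \<le> b}"

lemma loss_eq: "loss H D C (x t w) (v t w) K = (norm (Z K t w))\<^sup>2"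
  by (simp add: loss_def Z_def Y_def)

lemma yc_X: "yc c \<bullet> X t w = Y t w $ c"
  by (simp add: yc_def Y_def observation_def inner_prod_def inner_axis' matrix_vector_mul_component)

lemma zq_X: "zq K i \<bullet> X t w = Z K t w $ i"
proof -
  have "Z K t w = (H + D ** K ** C) *v x t w + (D ** K) *v v t w"
    by (simp add: Z_def Y_def observation_def matrix_vector_mult_add_rdistrib matrix_vector_right_distrib
        flip: matrix_vector_mul_assoc)
  then show ?thesis by (simp add: zq_def inner_prod_def matrix_vector_mul_component)
qed

lemma zr_X: "zr K r \<bullet> X t w = (Z K t w v* D) $ r"
  by (simp add: zr_def inner_sum_left zq_X vector_matrix_mult_def mult.commute)

lemma Z_diff: "Z K t w = Z K0 t w + D *v ((K - K0) *v Y t w)"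
  by (simp add: Z_def matrix_vector_mult_diff_rdistrib matrix_vector_mult_diff_distrib)

lemma norm_functional:
  "t \<ge> 1 \<Longrightarrow> has_bochner_integral P (\<lambda>w. \<Sum>i\<in>I. (a i \<bullet> X t w)\<^sup>2) (\<Sum>i\<in>I. Q (a i) (a i))"
  by (intro has_bochner_integral_sum second_moment_diag)

lemma expected_loss: "t \<ge> 1 \<Longrightarrow> has_bochner_integral P (\<lambda>w. (norm (Z K t w))\<^sup>2) (F K)"
  using norm_functional[of t "zq K" UNIV] by (simp only: zq_X norm_vec_squared F_def)

lemma expected_observation: "t \<ge> 1 \<Longrightarrow> has_bochner_integral P (\<lambda>w. (norm (Y t w))\<^sup>2) \<tau>y"
  using norm_functional[of t yc UNIV] by (simp only: yc_X norm_vec_squared \<tau>y_def)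

lemma expected_gradient:
  assumes "t \<ge> 1"
  shows "has_bochner_integral P (\<lambda>w. 2 * (Z K t w \<bullet> (D *v (\<Delta> *v Y t w)))) (\<Gamma> K \<bullet> \<Delta>)"
proof -
  have "has_bochner_integral P (\<lambda>w. \<Sum>r\<in>UNIV. \<Sum>c\<in>UNIV. (2 * \<Delta> $ r $ c) * ((zr K r \<bullet> X t w) * (yc c \<bullet> X t w)))
      (\<Sum>r\<in>UNIV. \<Sum>c\<in>UNIV. (2 * \<Delta> $ r $ c) * Q (zr K r) (yc c))"
    by (intro has_bochner_integral_sum has_bochner_integral_mult_right second_moment assms)
  moreover have "(\<Sum>r\<in>UNIV. \<Sum>c\<in>UNIV. (2 * \<Delta> $ r $ c) * ((zr K r \<bullet> X t w) * (yc c \<bullet> X t w)))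
      = 2 * (Z K t w \<bullet> (D *v (\<Delta> *v Y t w)))" for w
    unfolding dot_lmul_matrix[of "Z K t w" D, symmetric] zr_X yc_X
    unfolding inner_vec_def[of "Z K t w v* D"]
    by (simp add: matrix_vector_mult_def sum_distrib_left ac_simps)
  moreover have "(\<Sum>r\<in>UNIV. \<Sum>c\<in>UNIV. (2 * \<Delta> $ r $ c) * Q (zr K r) (yc c)) = \<Gamma> K \<bullet> \<Delta>"
    by (simp add: \<Gamma>_def inner_vec_def ac_simps)
  ultimately show ?thesis by (simp only:)
qed

lemma S_quadratic: "\<sigma> * (norm u)\<^sup>2 \<le> u \<bullet> (S *v u)"
proof -
  define h where "h = (\<Sum>c\<in>UNIV. u $ c *\<^sub>R yc c)"
  have "u \<bullet> (S *v u) = Q h h"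
    by (simp add: h_def Q_sum_left Q_sum_right Q_simps S_def inner_vec_def matrix_vector_mult_def
        sum_distrib_left ac_simps) (intro sum.cong refl, simp add: Q_sym)
  moreover have "h = (u v* C, u)"
    by (simp add: h_def yc_def prod_eq_iff fst_sum snd_sum vec_eq_iff vector_matrix_mult_def axis_def
        sum_component if_distrib[of "\<lambda>x. _ * x"] mult.commute cong: if_cong)
  ultimately show ?thesis using \<sigma>(2)[of u] by (simp add: joint_covariance_def)
qed

lemma S_diag: "\<sigma> \<le> S $ c $ c"
  using S_quadratic[of "axis c 1"] by (simp add: inner_axis' matrix_vector_mul_component inner_axis)

lemma S_row_quadratic: "\<sigma> * (norm \<Delta>)\<^sup>2 \<le> (\<Sum>r\<in>UNIV. \<Delta> $ r \<bullet> (S *v \<Delta> $ r))" for \<Delta> :: "real^'p^'m"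
proof -
  have "\<sigma> * (norm \<Delta>)\<^sup>2 = (\<Sum>r\<in>UNIV. \<sigma> * (norm (\<Delta> $ r))\<^sup>2)"
    by (simp add: power2_norm_eq_inner inner_vec_def[of \<Delta>] sum_distrib_left)
  also have "\<dots> \<le> (\<Sum>r\<in>UNIV. \<Delta> $ r \<bullet> (S *v \<Delta> $ r))" by (intro sum_mono S_quadratic)
  finally show ?thesis .
qed

lemma norm_mult_Y_expand:
  "(norm (\<Delta> *v Y t w))\<^sup>2 = (\<Sum>r\<in>UNIV. \<Sum>c\<in>UNIV. \<Sum>d\<in>UNIV. (\<Delta> $ r $ c * \<Delta> $ r $ d) * ((yc c \<bullet> X t w) * (yc d \<bullet> X t w)))"
  unfolding yc_X norm_vec_squared matrix_vector_mult_def
  by (simp add: power2_eq_square sum_product ac_simps)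

lemma S_row_expand:
  "(\<Sum>r\<in>UNIV. \<Delta> $ r \<bullet> (S *v \<Delta> $ r)) = (\<Sum>r\<in>UNIV. \<Sum>c\<in>UNIV. \<Sum>d\<in>UNIV. (\<Delta> $ r $ c * \<Delta> $ r $ d) * Q (yc c) (yc d))"
  for \<Delta> :: "real^'p^'m"
  by (simp add: S_def inner_vec_def matrix_vector_mult_def sum_distrib_left ac_simps)

lemma expected_increment:
  fixes \<Delta> :: "real^'p^'m"
  assumes t: "t \<ge> 1"
  shows "has_bochner_integral P (\<lambda>w. (norm (\<Delta> *v Y t w))\<^sup>2) (\<Sum>r\<in>UNIV. \<Delta> $ r \<bullet> (S *v \<Delta> $ r))"
  unfolding norm_mult_Y_expand S_row_expand
  by (intro has_bochner_integral_sum has_bochner_integral_mult_right second_moment t)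

text \<open>The number \<open>q\<close> is the expected square of the change \<open>D \<Delta> Y\<close> of the outcome.\<close>

lemma F_expand:
  obtains q where "q \<ge> s * \<sigma> * (norm \<Delta>)\<^sup>2" "\<And>c. F (K0 + c *\<^sub>R \<Delta>) = F K0 + c * (\<Gamma> K0 \<bullet> \<Delta>) + c\<^sup>2 * q"
proof -
  define q where "q = (\<integral>w. (norm (D *v (\<Delta> *v Y 1 w)))\<^sup>2 \<partial>P)"
  have expand: "(norm (Z (K0 + c *\<^sub>R \<Delta>) 1 w))\<^sup>2 = ((norm (Z K0 1 w))\<^sup>2 + c * (2 * (Z K0 1 w \<bullet> (D *v (\<Delta> *v Y 1 w)))))
      + c\<^sup>2 * (norm (D *v (\<Delta> *v Y 1 w)))\<^sup>2" for c w
  proof -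
    have "Z (K0 + c *\<^sub>R \<Delta>) 1 w = Z K0 1 w + c *\<^sub>R (D *v (\<Delta> *v Y 1 w))"
      using Z_diff[of "K0 + c *\<^sub>R \<Delta>" 1 w K0]
      by (simp add: matrix_vector_mult_scaleR flip: scaleR_matrix_vector_assoc)
    then show ?thesis
      by (simp add: power2_norm_eq_inner inner_add_left inner_add_right inner_commute power2_eq_square[of c] algebra_simps)
  qed
  have intq: "integrable P (\<lambda>w. (norm (D *v (\<Delta> *v Y 1 w)))\<^sup>2)"
  proof -
    have "integrable P (\<lambda>w. (norm (Z (K0 + 1 *\<^sub>R \<Delta>) 1 w))\<^sup>2 - ((norm (Z K0 1 w))\<^sup>2 + 1 * (2 * (Z K0 1 w \<bullet> (D *v (\<Delta> *v Y 1 w))))))"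
      using expected_loss[of 1] expected_gradient[of 1 K0 \<Delta>]
      by (intro Bochner_Integration.integrable_diff Bochner_Integration.integrable_add integrable_mult_right)
        (auto simp: has_bochner_integral_iff)
    then show ?thesis unfolding expand by simp
  qed
  have "F (K0 + c *\<^sub>R \<Delta>) = F K0 + c * (\<Gamma> K0 \<bullet> \<Delta>) + c\<^sup>2 * q" for c
  proof -
    have big: "has_bochner_integral P (\<lambda>w. ((norm (Z K0 1 w))\<^sup>2 + c * (2 * (Z K0 1 w \<bullet> (D *v (\<Delta> *v Y 1 w)))))
      + c\<^sup>2 * (norm (D *v (\<Delta> *v Y 1 w)))\<^sup>2) ((F K0 + c * (\<Gamma> K0 \<bullet> \<Delta>)) + c\<^sup>2 * q)"
      unfolding q_def using intq
      by (intro has_bochner_integral_add has_bochner_integral_mult_right expected_loss expected_gradient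
          has_bochner_integral_integrable) simp_all
    have "has_bochner_integral P (\<lambda>w. (norm (Z (K0 + c *\<^sub>R \<Delta>) 1 w))\<^sup>2) (F (K0 + c *\<^sub>R \<Delta>))"
      by (rule expected_loss) simp
    from has_bochner_integral_eq[OF this[unfolded expand] big] show ?thesis .
  qed
  moreover have "s * \<sigma> * (norm \<Delta>)\<^sup>2 \<le> q"
  proof -
    have "s * \<sigma> * (norm \<Delta>)\<^sup>2 \<le> s * (\<integral>w. (norm (\<Delta> *v Y 1 w))\<^sup>2 \<partial>P)"
      using S_row_quadratic[of \<Delta>] expected_increment[of 1 \<Delta>] s
      by (simp add: has_bochner_integral_iff mult.assoc)
    also have "\<dots> = (\<integral>w. s * (norm (\<Delta> *v Y 1 w))\<^sup>2 \<partial>P)" by simp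
    also have "\<dots> \<le> q"
      unfolding q_def using expected_increment[of 1 \<Delta>]
      by (intro integral_mono intq s integrable_mult_right) (auto simp: has_bochner_integral_iff)
    finally show ?thesis .
  qed
  ultimately show ?thesis using that by blast
qed

subsection \<open>Bounds by the norm of the Gaussian vector\<close>

lemma norm_Y_le: "norm (Y t w) \<le> (opnorm C + 1) * norm (X t w)"
proof -
  have "norm (Y t w) \<le> opnorm C * norm (x t w) + norm (v t w)"
    unfolding Y_def observation_def
    using norm_triangle_ineq[of "C *v x t w" "v t w"] norm_matrix_vector_le_opnorm[of C "x t w"] by linarith
  also have "\<dots> \<le> opnorm C * norm (X t w) + norm (X t w)"
    using norm_fst_le[of "x t w" "v t w"] norm_snd_le[of "v t w" "x t w"]
    by (intro add_mono mult_left_mono opnorm_nonneg) auto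
  finally show ?thesis by (simp add: algebra_simps)
qed

lemma norm_DKY_le:
  assumes "opnorm K \<le> b"
  shows "norm (D *v (K *v Y t w)) \<le> b * opnorm D * (opnorm C + 1) * norm (X t w)"
proof -
  have "norm (D *v (K *v Y t w)) \<le> opnorm D * norm (K *v Y t w)" by (rule norm_matrix_vector_le_opnorm)
  also have "\<dots> \<le> opnorm D * (b * norm (Y t w))"
    using assms by (intro mult_left_mono opnorm_nonneg) (simp add: opnorm_le_iff)
  also have "\<dots> \<le> opnorm D * (b * ((opnorm C + 1) * norm (X t w)))"
    by (intro mult_left_mono opnorm_nonneg norm_Y_le b)
  finally show ?thesis by (simp add: ac_simps)
qed

lemma norm_Hx_le: "norm (H *v x t w) \<le> opnorm H * norm (X t w)"
  using norm_matrix_vector_le_opnorm[of H "x t w"]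
    mult_left_mono[OF norm_fst_le[of "x t w" "v t w"] opnorm_nonneg[of H]] by linarith

lemma norm_Z_le: "opnorm K \<le> b \<Longrightarrow> norm (Z K t w) \<le> A * norm (X t w)"
  unfolding Z_def A_def
  using norm_triangle_ineq[of "H *v x t w" "D *v (K *v Y t w)"] norm_Hx_le[of t w] norm_DKY_le[of K t w]
  by (simp add: algebra_simps)

lemma expected_norm_x: "t \<ge> 1 \<Longrightarrow> has_bochner_integral P (\<lambda>w. (norm (x t w))\<^sup>2) (trace Vx)"
  using norm_functional[of t "\<lambda>i. (axis i 1, 0)" UNIV]
  by (simp add: inner_prod_def inner_axis' norm_vec_squared joint_covariance_def trace_def
      matrix_vector_mul_component inner_axis)

lemma expected_norm_v: "t \<ge> 1 \<Longrightarrow> has_bochner_integral P (\<lambda>w. (norm (v t w))\<^sup>2) (trace Vv)"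
  using norm_functional[of t "\<lambda>i. (0, axis i 1)" UNIV]
  by (simp add: inner_prod_def inner_axis' norm_vec_squared joint_covariance_def trace_def
      matrix_vector_mul_component inner_axis)

lemma norm_X_squared: "(norm (X t w))\<^sup>2 = (norm (x t w))\<^sup>2 + (norm (v t w))\<^sup>2"
  by (simp add: norm_prod_def)

lemma expected_norm_X: "t \<ge> 1 \<Longrightarrow> has_bochner_integral P (\<lambda>w. (norm (X t w))\<^sup>2) \<tau>"
  unfolding norm_X_squared \<tau>_def by (intro has_bochner_integral_add expected_norm_x expected_norm_v)

lemma expected_norm_X_fourth:
  assumes t: "t \<ge> 1"
  shows "integrable P (\<lambda>w. (norm (X t w)) ^ 4)" "(\<integral>w. (norm (X t w)) ^ 4 \<partial>P) \<le> E4"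
proof -
  have cross: "has_bochner_integral P (\<lambda>w. (norm (x t w))\<^sup>2 * (norm (v t w))\<^sup>2) (trace Vx * trace Vv)"
  proof -
    have "has_bochner_integral P (\<lambda>w. \<Sum>i\<in>UNIV. \<Sum>j\<in>UNIV. ((axis i 1, 0) \<bullet> X t w)\<^sup>2 * ((0, axis j 1) \<bullet> X t w)\<^sup>2)
      (\<Sum>i\<in>UNIV. \<Sum>j\<in>UNIV. Q (axis i 1, 0) (axis i 1, 0) * Q (0, axis j 1) (0, axis j 1)
        + 2 * (Q (axis i 1, 0) (0, axis j 1))\<^sup>2)"
      by (intro has_bochner_integral_sum fourth_moment t)
    then show ?thesis
      by (simp add: inner_prod_def inner_axis' joint_covariance_def norm_vec_squared sum_product trace_def
          matrix_vector_mul_component inner_axis)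
  qed
  have x4: "(norm (x t w)) ^ 4 = (x t w \<bullet> x t w)\<^sup>2" and v4: "(norm (v t w)) ^ 4 = (v t w \<bullet> v t w)\<^sup>2" for w
    by (simp_all add: dot_square_norm flip: power_mult)
  have eq: "(norm (X t w)) ^ 4 = (x t w \<bullet> x t w)\<^sup>2 + 2 * ((norm (x t w))\<^sup>2 * (norm (v t w))\<^sup>2) + (v t w \<bullet> v t w)\<^sup>2" for w
  proof -
    have "(norm (X t w)) ^ 4 = ((norm (X t w))\<^sup>2)\<^sup>2" by (simp flip: power_mult)
    then show ?thesis unfolding norm_X_squared
      by (simp add: power2_sum dot_square_norm)
  qed
  have int: "integrable P (\<lambda>w. (x t w \<bullet> x t w)\<^sup>2)" "integrable P (\<lambda>w. (v t w \<bullet> v t w)\<^sup>2)"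
    "integrable P (\<lambda>w. (norm (x t w))\<^sup>2 * (norm (v t w))\<^sup>2)"
    using x_fourth[OF t] v_fourth[OF t] cross by (auto simp: has_bochner_integral_iff)
  show "integrable P (\<lambda>w. (norm (X t w)) ^ 4)" unfolding eq using int by simp
  have "(\<integral>w. (norm (X t w)) ^ 4 \<partial>P) = (\<integral>w. (x t w \<bullet> x t w)\<^sup>2 \<partial>P) + 2 * (trace Vx * trace Vv) + (\<integral>w. (v t w \<bullet> v t w)\<^sup>2 \<partial>P)"
    unfolding eq using int cross by (simp add: has_bochner_integral_iff)
  then show "(\<integral>w. (norm (X t w)) ^ 4 \<partial>P) \<le> E4"
    using x_fourth[OF t] v_fourth[OF t] by (simp add: E4_def)
qed

lemma F_le: "opnorm K \<le> b \<Longrightarrow> F K \<le> A\<^sup>2 * \<tau>"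
proof -
  assume K: "opnorm K \<le> b"
  have "F K = (\<integral>w. (norm (Z K 1 w))\<^sup>2 \<partial>P)" using expected_loss[of 1 K] by (simp add: has_bochner_integral_iff)
  also have "\<dots> \<le> (\<integral>w. A\<^sup>2 * (norm (X 1 w))\<^sup>2 \<partial>P)"
  proof (rule integral_mono)
    show "(norm (Z K 1 w))\<^sup>2 \<le> A\<^sup>2 * (norm (X 1 w))\<^sup>2" for w
      using power_mono[OF norm_Z_le[OF K, of 1 w], of 2] by (simp add: power_mult_distrib)
  qed (use expected_loss[of 1 K] expected_norm_X[of 1] in \<open>auto simp: has_bochner_integral_iff\<close>)
  also have "\<dots> = A\<^sup>2 * \<tau>" using expected_norm_X[of 1] by (simp add: has_bochner_integral_iff)
  finally show ?thesis .
qed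

lemma F_zero_le: "F 0 \<le> (opnorm H)\<^sup>2 * \<tau>"
proof -
  have "F 0 = (\<integral>w. (norm (Z 0 1 w))\<^sup>2 \<partial>P)" using expected_loss[of 1 0] by (simp add: has_bochner_integral_iff)
  also have "\<dots> \<le> (\<integral>w. (opnorm H)\<^sup>2 * (norm (X 1 w))\<^sup>2 \<partial>P)"
  proof (rule integral_mono)
    show "(norm (Z 0 1 w))\<^sup>2 \<le> (opnorm H)\<^sup>2 * (norm (X 1 w))\<^sup>2" for w
      using power_mono[OF norm_Hx_le[of 1 w], of 2] by (simp add: power_mult_distrib Z_def)
  qed (use expected_loss[of 1 0] expected_norm_X[of 1] in \<open>auto simp: has_bochner_integral_iff\<close>)
  also have "\<dots> = (opnorm H)\<^sup>2 * \<tau>" using expected_norm_X[of 1] by (simp add: has_bochner_integral_iff)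
  finally show ?thesis .
qed

lemma F_nonneg: "0 \<le> F K"
  unfolding F_def by (intro sum_nonneg Q_nonneg)

subsection \<open>Moments of the observation\<close>

lemma trace_bounds: "real CARD('p) * \<sigma> \<le> \<tau>y" "\<tau>y \<le> (opnorm C + 1)\<^sup>2 * \<tau>"
proof -
  have "(\<Sum>c\<in>(UNIV::'p set). \<sigma>) \<le> (\<Sum>c\<in>UNIV. S $ c $ c)" by (intro sum_mono S_diag)
  then show "real CARD('p) * \<sigma> \<le> \<tau>y" by (simp add: \<tau>y_def S_def)
  have "\<tau>y = (\<integral>w. (norm (Y 1 w))\<^sup>2 \<partial>P)" using expected_observation[of 1] by (simp add: has_bochner_integral_iff)
  also have "\<dots> \<le> (\<integral>w. (opnorm C + 1)\<^sup>2 * (norm (X 1 w))\<^sup>2 \<partial>P)"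
  proof (rule integral_mono)
    show "(norm (Y 1 w))\<^sup>2 \<le> (opnorm C + 1)\<^sup>2 * (norm (X 1 w))\<^sup>2" for w
      using power_mono[OF norm_Y_le[of 1 w], of 2] by (simp add: power_mult_distrib)
  qed (use expected_observation[of 1] expected_norm_X[of 1] in \<open>auto simp: has_bochner_integral_iff\<close>)
  also have "\<dots> = (opnorm C + 1)\<^sup>2 * \<tau>" using expected_norm_X[of 1] by (simp add: has_bochner_integral_iff)
  finally show "\<tau>y \<le> (opnorm C + 1)\<^sup>2 * \<tau>" .
qed

lemma observation_fourth:
  "has_bochner_integral P (\<lambda>w. (norm (Y 1 w)) ^ 4) (\<tau>y\<^sup>2 + 2 * (\<Sum>c\<in>UNIV. \<Sum>d\<in>UNIV. (S $ c $ d)\<^sup>2))"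
proof -
  have "has_bochner_integral P (\<lambda>w. \<Sum>c\<in>UNIV. \<Sum>d\<in>UNIV. (yc c \<bullet> X 1 w)\<^sup>2 * (yc d \<bullet> X 1 w)\<^sup>2)
      (\<Sum>c\<in>UNIV. \<Sum>d\<in>UNIV. Q (yc c) (yc c) * Q (yc d) (yc d) + 2 * (Q (yc c) (yc d))\<^sup>2)"
    by (intro has_bochner_integral_sum fourth_moment) simp
  moreover have "(norm (Y 1 w)) ^ 4 = (\<Sum>c\<in>UNIV. \<Sum>d\<in>UNIV. (yc c \<bullet> X 1 w)\<^sup>2 * (yc d \<bullet> X 1 w)\<^sup>2)" for w
  proof -
    have "(norm (Y 1 w)) ^ 4 = (norm (Y 1 w))\<^sup>2 * (norm (Y 1 w))\<^sup>2" by (simp add: power4_eq_xxxx power2_eq_square)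
    then show ?thesis by (simp only: norm_vec_squared sum_product yc_X)
  qed
  moreover have "(\<Sum>c\<in>UNIV. \<Sum>d\<in>UNIV. Q (yc c) (yc c) * Q (yc d) (yc d) + 2 * (Q (yc c) (yc d))\<^sup>2)
      = \<tau>y\<^sup>2 + 2 * (\<Sum>c\<in>UNIV. \<Sum>d\<in>UNIV. (S $ c $ d)\<^sup>2)"
    by (simp add: sum.distrib \<tau>y_def power2_eq_square[of "sum _ _"] sum_product S_def
        flip: sum_distrib_left)
  ultimately show ?thesis by (simp only:)
qed

text \<open>
  The fourth moment in the gradient bound exceeds the squared second moments by enough to pay, besides
  for the trace of the covariance of the observation, for one more unit of its least eigenvalue. If most
  of the Gaussian vector is not observed then Jensen's inequality suffices; otherwise the surplus is that
  of a Gaussian fourth moment over the square of the second.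
\<close>

lemma fourth_moment_surplus: "\<tau> * (\<tau>y + \<sigma>) \<le> (opnorm C + 1)\<^sup>2 * E4"
proof -
  define m where "m = (opnorm C + 1)\<^sup>2"
  define r where "r w = (norm (X 1 w))\<^sup>2" for w
  define a where "a w = (norm (Y 1 w))\<^sup>2 / m" for w
  have "opnorm C + 1 \<ge> 1" using opnorm_nonneg[of C] by simp
  then have m: "m \<ge> 1" unfolding m_def by (simp add: one_le_power)
  have ar: "a w \<le> r w" for w
  proof -
    have "(norm (Y 1 w))\<^sup>2 \<le> m * r w"
      using power_mono[OF norm_Y_le[of 1 w], of 2] by (simp only: r_def m_def power_mult_distrib norm_ge_zero)
    then show ?thesis using m by (simp add: a_def field_simps)
  qed
  have an: "0 \<le> a w" for w using m by (simp add: a_def)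
  have intr: "has_bochner_integral P r \<tau>" unfolding r_def using expected_norm_X[of 1] by simp
  have inta: "has_bochner_integral P a (\<tau>y / m)"
    unfolding a_def using expected_observation[of 1] by (intro has_bochner_integral_divide) simp
  have r2: "(r w)\<^sup>2 = (norm (X 1 w)) ^ 4" for w by (simp add: r_def flip: power_mult)
  have intr2: "integrable P (\<lambda>w. (r w)\<^sup>2)" and Er2: "(\<integral>w. (r w)\<^sup>2 \<partial>P) \<le> E4"
    unfolding r2 using expected_norm_X_fourth[of 1] by auto
  have a2: "(a w)\<^sup>2 = (norm (Y 1 w)) ^ 4 / m\<^sup>2" for w by (simp add: a_def power_divide flip: power_mult)
  define G where "G = \<tau>y\<^sup>2 + 2 * (\<Sum>c\<in>UNIV. \<Sum>d\<in>UNIV. (S $ c $ d)\<^sup>2)"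
  have inta2: "has_bochner_integral P (\<lambda>w. (a w)\<^sup>2) (G / m\<^sup>2)"
    unfolding a2 G_def by (intro has_bochner_integral_divide observation_fourth)
  have jensen: "(e)\<^sup>2 \<le> (\<integral>w. (f w)\<^sup>2 \<partial>P)" if f: "has_bochner_integral P f e" and f2: "integrable P (\<lambda>w. (f w)\<^sup>2)"
    for f :: "'w \<Rightarrow> real" and e
  proof -
    have "0 \<le> (\<integral>w. (f w - e)\<^sup>2 \<partial>P)" by (rule Bochner_Integration.integral_nonneg) simp
    also have "\<dots> = (\<integral>w. (f w)\<^sup>2 - (2 * e) * f w + e\<^sup>2 \<partial>P)"
      by (intro Bochner_Integration.integral_cong) (auto simp: power2_eq_square algebra_simps)
    also have "\<dots> = (\<integral>w. (f w)\<^sup>2 \<partial>P) - (2 * e) * e + e\<^sup>2"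
      using f f2 by (simp add: has_bochner_integral_iff prob_space)
    finally show ?thesis by (simp add: power2_eq_square)
  qed
  have S2: "\<sigma> * \<tau>y \<le> (\<Sum>c\<in>UNIV. \<Sum>d\<in>UNIV. (S $ c $ d)\<^sup>2)"
  proof -
    have "\<sigma> * S $ c $ c \<le> (\<Sum>d\<in>UNIV. (S $ c $ d)\<^sup>2)" for c
    proof -
      have "\<sigma> * S $ c $ c \<le> S $ c $ c * S $ c $ c"
        using S_diag[of c] \<sigma>(1) by (intro mult_right_mono) auto
      also have "\<dots> \<le> (\<Sum>d\<in>UNIV. (S $ c $ d)\<^sup>2)"
        using member_le_sum[of c UNIV "\<lambda>d. (S $ c $ d)\<^sup>2"] by (simp add: power2_eq_square)
      finally show ?thesis .
    qed
    then have "(\<Sum>c\<in>UNIV. \<sigma> * S $ c $ c) \<le> (\<Sum>c\<in>UNIV. \<Sum>d\<in>UNIV. (S $ c $ d)\<^sup>2)" by (rule sum_mono)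
    then show ?thesis by (simp add: \<tau>y_def S_def sum_distrib_left)
  qed
  have "1 \<le> real CARD('p)" by (simp add: Suc_leI)
  then have "\<sigma> \<le> real CARD('p) * \<sigma>" using \<sigma>(1) by simp
  then have ty: "\<sigma> \<le> \<tau>y" using trace_bounds(1) by linarith
  have tym: "\<tau>y \<le> m * \<tau>" using trace_bounds(2) by (simp add: m_def)
  have "0 < m * \<tau>" using ty tym \<sigma>(1) by linarith
  then have \<tau>: "\<tau> > 0" using m by (simp add: zero_less_mult_iff)
  show ?thesis
  proof (cases "\<tau>y + \<sigma> \<le> m * \<tau>")
    case True
    then have "\<tau> * (\<tau>y + \<sigma>) \<le> \<tau> * (m * \<tau>)" using \<tau> by simp
    also have "\<dots> = m * \<tau>\<^sup>2" by (simp add: power2_eq_square)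
    also have "\<dots> \<le> m * E4" using jensen[OF intr intr2] Er2 m by (intro mult_left_mono) auto
    finally show ?thesis by (simp add: m_def)
  next
    case False
    define u where "u = m * \<tau> - \<tau>y"
    have u: "0 \<le> u" "u < \<sigma>" using False tym by (auto simp: u_def)
    have diff: "has_bochner_integral P (\<lambda>w. r w - a w) (\<tau> - \<tau>y / m)"
      by (intro has_bochner_integral_diff intr inta)
    have diff2: "integrable P (\<lambda>w. (r w - a w)\<^sup>2)"
    proof (rule Bochner_Integration.integrable_bound[OF intr2])
      show "(\<lambda>w. (r w - a w)\<^sup>2) \<in> borel_measurable P" using diff by (auto simp: has_bochner_integral_iff)
      show "AE w in P. norm ((r w - a w)\<^sup>2) \<le> norm ((r w)\<^sup>2)"
        using ar an by (intro always_eventually allI) (simp add: power_mono)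
    qed
    have "G / m\<^sup>2 + (u / m)\<^sup>2 \<le> (\<integral>w. (a w)\<^sup>2 \<partial>P) + (\<integral>w. (r w - a w)\<^sup>2 \<partial>P)"
      using jensen[OF diff diff2] inta2 m by (simp add: has_bochner_integral_iff u_def field_simps)
    also have "\<dots> = (\<integral>w. (a w)\<^sup>2 + (r w - a w)\<^sup>2 \<partial>P)"
      using inta2 diff2 by (simp add: has_bochner_integral_iff)
    also have "\<dots> \<le> (\<integral>w. (r w)\<^sup>2 \<partial>P)"
    proof (rule integral_mono)
      show "(a w)\<^sup>2 + (r w - a w)\<^sup>2 \<le> (r w)\<^sup>2" for w
        using mult_nonneg_nonneg[OF an[of w], of "r w - a w"] ar[of w] by (simp add: power2_eq_square algebra_simps)
    qed (use inta2 diff2 intr2 in \<open>auto simp: has_bochner_integral_iff\<close>)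
    also have "\<dots> \<le> E4" by (rule Er2)
    finally have "G + u\<^sup>2 \<le> m\<^sup>2 * E4" using m by (simp add: power_divide field_simps)
    moreover have "(m * \<tau>) * (\<tau>y + \<sigma>) \<le> G + u\<^sup>2"
    proof -
      have "0 \<le> (\<sigma> - u) * (\<tau>y - u)" using u ty by (intro mult_nonneg_nonneg) auto
      moreover have "\<tau>y\<^sup>2 + 2 * (\<sigma> * \<tau>y) \<le> G" using S2 by (simp add: G_def)
      moreover have "m * \<tau> = \<tau>y + u" by (simp add: u_def)
      ultimately show ?thesis by (simp add: power2_eq_square algebra_simps)
    qed
    ultimately have "m * (\<tau> * (\<tau>y + \<sigma>)) \<le> m * (m * E4)" by (simp add: power2_eq_square mult.assoc)
    then have "\<tau> * (\<tau>y + \<sigma>) \<le> m * E4" using m by (subst (asm) mult_le_cancel_left_pos) auto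
    then show ?thesis by (simp add: m_def)
  qed
qed

end

lemma block_diagonal_iff:
  fixes own_u :: "'m::finite \<Rightarrow> 'a::finite" and own_y :: "'p::finite \<Rightarrow> 'a"
  shows "K \<in> block_diagonal own_u own_y \<longleftrightarrow> (\<forall>r c. own_u r \<noteq> own_y c \<longrightarrow> K $ r $ c = 0)"
proof
  assume K: "K \<in> block_diagonal own_u own_y"
  show "\<forall>r c. own_u r \<noteq> own_y c \<longrightarrow> K $ r $ c = 0"
  proof (intro allI impI)
    fix r c assume ne: "own_u r \<noteq> own_y c"
    have "K $ r $ c = Diag (\<lambda>i. block_part own_u own_y i K) $ r $ c"
      by (simp add: Diag_block_part[OF K])
    also have "\<dots> = block_part own_u own_y (own_u r) K $ r $ c"
      by (rule Diag_component) (rule block_part_in_space)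
    also have "\<dots> = 0" using ne by (simp add: block_part_def)
    finally show "K $ r $ c = 0" .
  qed
next
  assume z: "\<forall>r c. own_u r \<noteq> own_y c \<longrightarrow> K $ r $ c = 0"
  have "Diag (\<lambda>i. block_part own_u own_y i K) $ r $ c = K $ r $ c" for r c
  proof -
    have "Diag (\<lambda>i. block_part own_u own_y i K) $ r $ c = block_part own_u own_y (own_u r) K $ r $ c"
      by (rule Diag_component) (rule block_part_in_space)
    also have "\<dots> = K $ r $ c" using z by (simp add: block_part_def)
    finally show ?thesis .
  qed
  then have "Diag (\<lambda>i. block_part own_u own_y i K) = K" by (simp add: vec_eq_iff)
  then show "K \<in> block_diagonal own_u own_y"
    unfolding block_diagonal_def
    by (intro CollectI exI[of _ "\<lambda>i. block_part own_u own_y i K"]) (simp add: block_part_in_space)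
qed

lemma DiagI: "(\<And>i. Ks i \<in> block_space own_u own_y i) \<Longrightarrow> Diag Ks \<in> block_diagonal own_u own_y"
  by (auto simp: block_diagonal_def)

context team_problem
begin

subsection \<open>The best fixed gain for the expected loss\<close>

lemma compact_W: "compact W"
proof -
  have "block_diagonal own_u own_y = (\<Inter>(r, c)\<in>{(r, c). own_u r \<noteq> own_y c}. {K. K $ r $ c = 0})"
    by (auto simp: block_diagonal_iff)
  also have "closed \<dots>" by (intro closed_INT ballI) (auto intro!: closed_Collect_eq continuous_intros)
  finally have "closed (block_diagonal own_u own_y \<inter> {K :: real^'p^'m. opnorm K \<le> b})"
    by (intro closed_Int closed_opnorm_ball)
  then have "closed W" by (simp add: W_def Collect_conj_eq)
  moreover have "bounded W"
    unfolding bounded_iff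
  proof (intro exI ballI)
    fix K assume "K \<in> W"
    then have "opnorm K \<le> b" by (simp add: W_def)
    then have "(norm K)\<^sup>2 \<le> real CARD('m) * b\<^sup>2"
      using norm_le_opnorm[of K] opnorm_nonneg[of K] by (meson mult_left_mono of_nat_0_le_iff order.trans power_mono)
    then show "norm K \<le> sqrt (real CARD('m) * b\<^sup>2)" by (rule real_le_rsqrt)
  qed
  ultimately show ?thesis by (simp add: compact_eq_bounded_closed)
qed

lemma continuous_F: "continuous_on UNIV F"
  unfolding F_def joint_covariance_def zq_def fst_conv snd_conv matrix_vector_mult_def matrix_matrix_mult_def
  by (simp, intro continuous_intros)

lemma zero_in_W: "0 \<in> W"
  using b by (simp add: W_def block_diagonal_iff opnorm_le_iff)

lemma minimizer: obtains K0 where "K0 \<in> W" "\<And>K. K \<in> W \<Longrightarrow> F K0 \<le> F K"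
  using continuous_attains_inf[OF compact_W _ continuous_on_subset[OF continuous_F]] zero_in_W by blast

lemma convex_W:
  assumes "K0 \<in> W" "K \<in> W" "0 \<le> c" "c \<le> 1"
  shows "K0 + c *\<^sub>R (K - K0) \<in> W"
proof -
  have eq: "K0 + c *\<^sub>R (K - K0) = (1 - c) *\<^sub>R K0 + c *\<^sub>R K" by (simp add: algebra_simps)
  show ?thesis
    unfolding eq using assms by (auto simp: W_def block_diagonal_iff intro!: opnorm_convex)
qed

text \<open>
  The expected loss is quadratic with curvature at least \<open>s \<sigma>\<close> along any segment, so at the minimum over a convex
  set the first-order term is nonnegative and the excess is at least the quadratic term.
\<close>

lemma first_order:
  assumes K0: "K0 \<in> W" "\<And>K. K \<in> W \<Longrightarrow> F K0 \<le> F K" and K: "K \<in> W"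
  shows "0 \<le> \<Gamma> K0 \<bullet> (K - K0)" "s * \<sigma> * (norm (K - K0))\<^sup>2 \<le> F K - F K0"
proof -
  obtain q where q: "q \<ge> s * \<sigma> * (norm (K - K0))\<^sup>2"
    and Fq: "\<And>c. F (K0 + c *\<^sub>R (K - K0)) = F K0 + c * (\<Gamma> K0 \<bullet> (K - K0)) + c\<^sup>2 * q"
    using F_expand[of "K - K0" K0] by blast
  have "- (c * q) \<le> \<Gamma> K0 \<bullet> (K - K0)" if c: "0 < c" "c \<le> 1" for c
  proof -
    have "F K0 \<le> F (K0 + c *\<^sub>R (K - K0))" using c K K0 by (intro K0(2) convex_W) auto
    then have "0 \<le> c * (\<Gamma> K0 \<bullet> (K - K0) + c * q)"
      unfolding Fq by (simp add: power2_eq_square distrib_left mult.assoc)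
    then show ?thesis using c by (simp add: zero_le_mult_iff)
  qed
  moreover have "((\<lambda>c. - (c * q)) \<longlongrightarrow> - (0 * q)) (at_right 0)" by (intro tendsto_intros)
  moreover have "\<forall>\<^sub>F c in at_right (0::real). 0 < c \<and> c \<le> 1"
    using eventually_at_right[of 0 "1::real"] by (auto intro: exI[of _ 1])
  ultimately show "0 \<le> \<Gamma> K0 \<bullet> (K - K0)"
    by (intro tendsto_upperbound[of "\<lambda>c. - (c * q)" 0 "at_right 0"]) (auto elim: eventually_mono)
  then show "s * \<sigma> * (norm (K - K0))\<^sup>2 \<le> F K - F K0" using q Fq[of 1] by simp
qed

lemma measurable_x: "t \<ge> 1 \<Longrightarrow> x t \<in> borel_measurable P"
  and measurable_v: "t \<ge> 1 \<Longrightarrow> v t \<in> borel_measurable P"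
proof -
  assume "t \<ge> 1"
  then have "X t \<in> borel_measurable P" by (rule measurable_X)
  then have "(\<lambda>w. fst (X t w)) \<in> borel_measurable P" "(\<lambda>w. snd (X t w)) \<in> borel_measurable P"
    by (rule measurable_compose[OF _ borel_measurable_continuous_onI], intro continuous_intros)+
  then show "x t \<in> borel_measurable P" "v t \<in> borel_measurable P" by simp_all
qed

lemma integrable_loss:
  assumes t: "t \<ge> 1" and K: "K \<in> borel_measurable P" "\<And>w. w \<in> space P \<Longrightarrow> opnorm (K w) \<le> b"
  shows "integrable P (\<lambda>w. (norm (Z (K w) t w))\<^sup>2)"
proof (rule Bochner_Integration.integrable_bound)
  show "integrable P (\<lambda>w. A\<^sup>2 * (norm (X t w))\<^sup>2)"
    using expected_norm_X[OF t] by (simp add: has_bochner_integral_iff)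
  show "(\<lambda>w. (norm (Z (K w) t w))\<^sup>2) \<in> borel_measurable P"
    using borel_measurable_loss[OF measurable_x[OF t] measurable_v[OF t] K(1), of H D C] by (simp add: loss_eq)
  show "AE w in P. norm ((norm (Z (K w) t w))\<^sup>2) \<le> norm (A\<^sup>2 * (norm (X t w))\<^sup>2)"
  proof (rule AE_I2)
    fix w assume "w \<in> space P"
    then have "norm (Z (K w) t w) \<le> A * norm (X t w)" by (intro norm_Z_le K)
    then show "norm ((norm (Z (K w) t w))\<^sup>2) \<le> norm (A\<^sup>2 * (norm (X t w))\<^sup>2)"
      using power_mono[of "norm (Z (K w) t w)" "A * norm (X t w)" 2] by (simp add: power_mult_distrib)
  qed
qed

end

section \<open>Online gradient descent\<close>

locale team_learning = team_problem P own_u own_y H D C Vx Vv x v \<kappa>x \<kappa>v b s \<sigma>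
  for P :: "'w measure"
    and own_u :: "'m::finite \<Rightarrow> 'a::finite" and own_y :: "'p::finite \<Rightarrow> 'a"
    and H :: "real^'n::finite^'q::finite" and D :: "real^'m^'q" and C :: "real^'n^'p"
    and Vx :: "real^'n^'n" and Vv :: "real^'p^'p"
    and x :: "nat \<Rightarrow> 'w \<Rightarrow> real^'n" and v :: "nat \<Rightarrow> 'w \<Rightarrow> real^'p"
    and \<kappa>x \<kappa>v b s \<sigma> :: real +
  fixes lam :: real and K1 :: "'a \<Rightarrow> real^'p^'m"
  assumes lam: "0 < lam" "lam \<le> 2 * s * \<sigma>" and K1: "\<And>i. K1 i \<in> block_ball own_u own_y b i"
begin

text \<open>The gain \<open>Kn n\<close>, formed after \<open>n\<close> rounds, is the one played in round \<open>Suc n\<close>.\<close>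

definition \<eta> where "\<eta> t = 1 / (lam * real t)" for t :: nat
definition gn where "gn n w = gains own_u own_y H D C b \<eta> K1 (\<lambda>t. X t w) n"
definition Kn where "Kn n w = Diag (gn n w)"

lemma gn_ball: "gn n w i \<in> block_ball own_u own_y b i"
  unfolding gn_def by (rule gains_in_block_ball[OF b K1])

lemma gn_space: "gn n w i \<in> block_space own_u own_y i"
  using gn_ball[of n w i] by (simp add: block_ball_def)

lemma Kn_W: "Kn n w \<in> W"
proof -
  have "opnorm (gn n w i) \<le> b" for i using gn_ball[of n w i] by (simp add: block_ball_def)
  then have "opnorm (Kn n w) \<le> b" unfolding Kn_def opnorm_Diag_le_iff[OF gn_space] by blast
  then show ?thesis unfolding W_def Kn_def using DiagI[OF gn_space] by simp
qed

lemma Kn_opnorm: "opnorm (Kn n w) \<le> b"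
  using Kn_W[of n w] by (simp add: W_def)

lemma Kn_measurable: "Kn n \<in> borel_measurable P"
proof -
  have "(\<lambda>w. gn n w i) \<in> borel_measurable P" for i
    unfolding gn_def by (rule borel_measurable_gains[OF b]) (simp add: measurable_X)
  then have "(\<lambda>w. \<Sum>i\<in>UNIV. gn n w i) \<in> borel_measurable P" by (intro borel_measurable_sum)
  then show ?thesis by (simp add: Kn_def[abs_def] Diag_def)
qed

lemma integrable_loss_Kn: "integrable P (\<lambda>w. (norm (Z (Kn n w) (Suc n) w))\<^sup>2)"
  by (rule integrable_loss) (simp_all add: Kn_measurable Kn_opnorm)

text \<open>
  Expanding the square of the projected step. The linear term is the derivative of a quadratic loss, so it
  exceeds the instantaneous regret by the square of the change in outcome.
\<close>

lemma gradient_step: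
  fixes n w and K0 :: "real^'p^'m"
  assumes K0: "K0 \<in> W"
  defines "t \<equiv> Suc n"
  shows "(norm (Kn t w - K0))\<^sup>2 \<le> (norm (Kn n w - K0))\<^sup>2
    - 2 * \<eta> t * ((norm (Z (Kn n w) t w))\<^sup>2 - (norm (Z K0 t w))\<^sup>2 + s * (norm ((Kn n w - K0) *v Y t w))\<^sup>2)
    + (\<eta> t)\<^sup>2 * (4 * (opnorm D)\<^sup>2 * A\<^sup>2 * (opnorm C + 1)\<^sup>2 * (norm (X t w)) ^ 4)"
proof -
  define K0s where "K0s i = block_part own_u own_y i K0" for i
  define G where "G i = partial_gradient own_u own_y H D C (x t w) (v t w) (gn n w) i" for i
  define M where "M i = gn n w i - K0s i" for i
  define z where "z = Z (Kn n w) t w"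
  have K0b: "K0 \<in> block_diagonal own_u own_y" "opnorm K0 \<le> b" using K0 by (auto simp: W_def)
  have K0s: "K0s i \<in> block_space own_u own_y i" for i by (simp add: K0s_def block_part_in_space)
  have K0D: "K0 = Diag K0s" using Diag_block_part[OF K0b(1)] by (simp add: K0s_def[abs_def])
  have M: "M i \<in> block_space own_u own_y i" for i
    unfolding M_def by (intro block_space_diff gn_space K0s)
  have KM: "Kn n w - K0 = Diag M" unfolding K0D Kn_def M_def by (rule Diag_diff[symmetric])
  have \<eta>0: "0 \<le> \<eta> t" using lam by (simp add: \<eta>_def)
  have ball: "K0s i \<in> block_ball own_u own_y b i" for i
    using K0s[of i] opnorm_block_part[of own_u own_y i K0] K0b(2) by (simp add: block_ball_def K0s_def)
  have out: "outcome own_y H D C (x t w) (v t w) (gn n w) = z"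
    by (simp add: outcome_def z_def Z_def Kn_def Diag_mult[OF gn_space] agent_observation_block Y_def)
  have G: "G i = 2 *\<^sub>R outer (block_vec own_u i (z v* D)) (block_vec own_y i (Y t w))" for i
    by (simp only: G_def partial_gradient_def out block_row_transpose_mult agent_observation_block Y_def)
  have GM: "(\<Sum>i\<in>UNIV. G i \<bullet> M i) = 2 * (z \<bullet> (D *v ((Kn n w - K0) *v Y t w)))"
  proof -
    have "G i \<bullet> M i = 2 * ((z v* D) \<bullet> (M i *v block_vec own_y i (Y t w)))" for i
      by (simp only: G inner_scaleR_left inner_outer inner_block_vec block_space_mult(2)[OF M])
    then have "(\<Sum>i\<in>UNIV. G i \<bullet> M i) = 2 * ((z v* D) \<bullet> (Diag M *v Y t w))"
      by (simp only: Diag_mult[OF M] inner_sum_right sum_distrib_left)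
    then show ?thesis by (simp only: KM dot_lmul_matrix)
  qed
  have GG: "(\<Sum>i\<in>UNIV. (norm (G i))\<^sup>2) \<le> 4 * (opnorm D)\<^sup>2 * A\<^sup>2 * (opnorm C + 1)\<^sup>2 * (norm (X t w)) ^ 4"
  proof -
    have "(norm (G i))\<^sup>2 \<le> 4 * ((norm (block_vec own_u i (z v* D)))\<^sup>2 * (norm (Y t w))\<^sup>2)" for i
      using mult_left_mono[OF power_mono[OF norm_block_vec_le[of own_y i "Y t w"], of 2],
          of "4 * (norm (block_vec own_u i (z v* D)))\<^sup>2"]
      by (simp add: G norm_outer power_mult_distrib)
    then have "(\<Sum>i\<in>UNIV. (norm (G i))\<^sup>2) \<le> (\<Sum>i\<in>UNIV. 4 * ((norm (block_vec own_u i (z v* D)))\<^sup>2 * (norm (Y t w))\<^sup>2))"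
      by (rule sum_mono)
    also have "\<dots> = 4 * ((norm (z v* D))\<^sup>2 * (norm (Y t w))\<^sup>2)"
      by (simp only: sum_distrib_left[symmetric] sum_distrib_right[symmetric] sum_norm_block_vec)
    also have "\<dots> \<le> 4 * ((opnorm D * (A * norm (X t w)))\<^sup>2 * ((opnorm C + 1) * norm (X t w))\<^sup>2)"
    proof (intro mult_left_mono mult_mono power_mono norm_Y_le)
      have "norm (z v* D) \<le> opnorm D * norm z" by (rule norm_vector_matrix_le_opnorm)
      also have "\<dots> \<le> opnorm D * (A * norm (X t w))"
        unfolding z_def by (intro mult_left_mono norm_Z_le Kn_opnorm opnorm_nonneg)
      finally show "norm (z v* D) \<le> opnorm D * (A * norm (X t w))" .
    qed simp_all
    also have "\<dots> = 4 * (opnorm D)\<^sup>2 * A\<^sup>2 * (opnorm C + 1)\<^sup>2 * (norm (X t w)) ^ 4"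
      by (simp only: power_mult_distrib power4_eq_xxxx power2_eq_square[of "norm (X t w)"] ac_simps)
    finally show ?thesis .
  qed
  have step: "(norm (gn t w i - K0s i))\<^sup>2 \<le> (norm (M i))\<^sup>2 - 2 * \<eta> t * (G i \<bullet> M i) + (\<eta> t)\<^sup>2 * (norm (G i))\<^sup>2" for i
  proof -
    have g: "gn t w i = closest_point (block_ball own_u own_y b i) (gn n w i - \<eta> t *\<^sub>R G i)"
      by (simp add: gn_def t_def G_def)
    have "norm (gn t w i - K0s i) \<le> norm (gn n w i - \<eta> t *\<^sub>R G i - K0s i)"
      using closest_point_lipschitz[OF block_ball[OF b], of own_u own_y i "gn n w i - \<eta> t *\<^sub>R G i" "K0s i"]
      by (simp add: g closest_point_self[OF ball] dist_norm)
    also have "gn n w i - \<eta> t *\<^sub>R G i - K0s i = M i - \<eta> t *\<^sub>R G i" by (simp add: M_def)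
    finally have "(norm (gn t w i - K0s i))\<^sup>2 \<le> (norm (M i - \<eta> t *\<^sub>R G i))\<^sup>2" by (intro power_mono) auto
    also have "\<dots> = (norm (M i))\<^sup>2 - 2 * \<eta> t * (G i \<bullet> M i) + (\<eta> t)\<^sup>2 * (norm (G i))\<^sup>2"
      by (simp only: power2_norm_eq_inner inner_diff_left inner_diff_right inner_scaleR_left inner_scaleR_right
          inner_commute[of "M i" "G i"]) (simp add: power2_eq_square algebra_simps)
    finally show ?thesis .
  qed
  have "(norm (Kn t w - K0))\<^sup>2 = (\<Sum>i\<in>UNIV. (norm (gn t w i - K0s i))\<^sup>2)"
    unfolding K0D Kn_def Diag_diff[symmetric] by (rule norm_Diag[OF block_space_diff[OF gn_space K0s]])
  also have "\<dots> \<le> (\<Sum>i\<in>UNIV. (norm (M i))\<^sup>2 - 2 * \<eta> t * (G i \<bullet> M i) + (\<eta> t)\<^sup>2 * (norm (G i))\<^sup>2)"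
    by (intro sum_mono step)
  also have "\<dots> = (norm (Kn n w - K0))\<^sup>2 - 2 * \<eta> t * (\<Sum>i\<in>UNIV. G i \<bullet> M i) + (\<eta> t)\<^sup>2 * (\<Sum>i\<in>UNIV. (norm (G i))\<^sup>2)"
    by (simp only: KM norm_Diag[OF M] sum.distrib sum_subtractf sum_distrib_left)
  finally have bound: "(norm (Kn t w - K0))\<^sup>2 \<le> (norm (Kn n w - K0))\<^sup>2
      - 2 * \<eta> t * (\<Sum>i\<in>UNIV. G i \<bullet> M i) + (\<eta> t)\<^sup>2 * (\<Sum>i\<in>UNIV. (norm (G i))\<^sup>2)" .
  have "(norm z)\<^sup>2 - (norm (Z K0 t w))\<^sup>2 + s * (norm ((Kn n w - K0) *v Y t w))\<^sup>2 \<le> (\<Sum>i\<in>UNIV. G i \<bullet> M i)"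
  proof -
    have "(norm (Z K0 t w))\<^sup>2 = (norm z)\<^sup>2 - 2 * (z \<bullet> (D *v ((Kn n w - K0) *v Y t w))) + (norm (D *v ((Kn n w - K0) *v Y t w)))\<^sup>2"
    proof -
      have "Z K0 t w = z - D *v ((Kn n w - K0) *v Y t w)" by (simp add: z_def Z_diff[of "Kn n w" t w K0])
      then show ?thesis
        by (simp add: power2_norm_eq_inner inner_diff_left inner_diff_right inner_commute)
    qed
    then show ?thesis using s(2)[of "(Kn n w - K0) *v Y t w"] unfolding GM by linarith
  qed
  then have "2 * \<eta> t * ((norm z)\<^sup>2 - (norm (Z K0 t w))\<^sup>2 + s * (norm ((Kn n w - K0) *v Y t w))\<^sup>2)
      \<le> 2 * \<eta> t * (\<Sum>i\<in>UNIV. G i \<bullet> M i)"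
    using \<eta>0 by (intro mult_left_mono) auto
  moreover have "(\<eta> t)\<^sup>2 * (\<Sum>i\<in>UNIV. (norm (G i))\<^sup>2)
      \<le> (\<eta> t)\<^sup>2 * (4 * (opnorm D)\<^sup>2 * A\<^sup>2 * (opnorm C + 1)\<^sup>2 * (norm (X t w)) ^ 4)"
    by (intro mult_left_mono GG) simp
  ultimately show ?thesis using bound unfolding z_def by linarith
qed

lemma integrable_gain_product:
  assumes "opnorm K0 \<le> b"
  shows "integrable P (\<lambda>w. (Kn n w - K0) $ r $ c * (Kn n w - K0) $ r $ d)"
proof (rule integrable_const_bound)
  have "\<bar>(Kn n w - K0) $ r $ c\<bar> \<le> 2 * b" for w c
    using abs_component_le_opnorm[of "Kn n w" r c] abs_component_le_opnorm[of K0 r c] Kn_opnorm[of n w] assms by simp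
  then show "AE w in P. norm ((Kn n w - K0) $ r $ c * (Kn n w - K0) $ r $ d) \<le> (2 * b) * (2 * b)"
    unfolding real_norm_def abs_mult using b by (intro AE_I2 mult_mono) auto
  have "(\<lambda>w. Kn n w - K0) \<in> borel_measurable P" by (intro borel_measurable_diff Kn_measurable borel_measurable_const)
  then show "(\<lambda>w. (Kn n w - K0) $ r $ c * (Kn n w - K0) $ r $ d) \<in> borel_measurable P"
    by (intro borel_measurable_times borel_measurable_matrix_nth)
qed

text \<open>The gain of a round depends on the earlier rounds only, hence is independent of its observation.\<close>

lemma gain_independent:
  assumes K0: "opnorm K0 \<le> b"
  shows "has_bochner_integral P
    (\<lambda>w. ((Kn n w - K0) $ r $ c * (Kn n w - K0) $ r $ d) * ((yc c \<bullet> X (Suc n) w) * (yc d \<bullet> X (Suc n) w)))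
    ((\<integral>w. (Kn n w - K0) $ r $ c * (Kn n w - K0) $ r $ d \<partial>P) * Q (yc c) (yc d))"
proof -
  define g where "g \<xi> = Diag (gains own_u own_y H D C b \<eta> K1 \<xi> n) - K0" for \<xi>
  define f1 where "f1 \<xi> = g \<xi> $ r $ c * g \<xi> $ r $ d" for \<xi>
  define f2 where "f2 \<xi> = (yc c \<bullet> \<xi> (Suc n)) * (yc d \<bullet> \<xi> (Suc n))" for \<xi> :: "nat \<Rightarrow> (real^'n) \<times> (real^'p)"
  have "(\<lambda>\<xi>. gains own_u own_y H D C b \<eta> K1 \<xi> n i) \<in> borel_measurable (PiM {1..n} (\<lambda>_. borel))" for i
    by (rule borel_measurable_gains[OF b]) (rule measurable_component_singleton)
  then have "g \<in> borel_measurable (PiM {1..n} (\<lambda>_. borel))"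
    unfolding g_def[abs_def] Diag_def by (intro borel_measurable_diff borel_measurable_sum borel_measurable_const)
  then have f1: "f1 \<in> borel_measurable (PiM {1..n} (\<lambda>_. borel))"
    unfolding f1_def[abs_def] by (intro borel_measurable_times borel_measurable_matrix_nth)
  have "(\<lambda>\<xi>. \<xi> (Suc n)) \<in> borel_measurable (PiM {Suc n} (\<lambda>_. borel :: ((real^'n) \<times> (real^'p)) measure))"
    by (rule measurable_component_singleton) simp
  then have f2: "f2 \<in> borel_measurable (PiM {Suc n} (\<lambda>_. borel))"
    unfolding f2_def[abs_def] by (intro borel_measurable_times borel_measurable_inner borel_measurable_const)
  have "indep_var borel (f1 \<circ> (\<lambda>w. restrict (\<lambda>i. X i w) {1..n})) borel (f2 \<circ> (\<lambda>w. restrict (\<lambda>i. X i w) {Suc n}))"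
    by (rule indep_var_compose[OF indep_var_restrict[OF indep] f1 f2]) auto
  moreover have "f1 \<circ> (\<lambda>w. restrict (\<lambda>i. X i w) {1..n}) = (\<lambda>w. (Kn n w - K0) $ r $ c * (Kn n w - K0) $ r $ d)"
  proof
    fix w
    have "gains own_u own_y H D C b \<eta> K1 (restrict (\<lambda>i. X i w) {1..n}) n = gn n w"
      unfolding gn_def by (rule gains_cong) simp
    then show "(f1 \<circ> (\<lambda>w. restrict (\<lambda>i. X i w) {1..n})) w = (Kn n w - K0) $ r $ c * (Kn n w - K0) $ r $ d"
      by (simp only: o_def f1_def g_def Kn_def)
  qed
  moreover have "f2 \<circ> (\<lambda>w. restrict (\<lambda>i. X i w) {Suc n}) = (\<lambda>w. (yc c \<bullet> X (Suc n) w) * (yc d \<bullet> X (Suc n) w))"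
    by (simp add: fun_eq_iff f2_def)
  ultimately have ind: "indep_var borel (\<lambda>w. (Kn n w - K0) $ r $ c * (Kn n w - K0) $ r $ d)
      borel (\<lambda>w. (yc c \<bullet> X (Suc n) w) * (yc d \<bullet> X (Suc n) w))" by (simp only:)
  have 2: "has_bochner_integral P (\<lambda>w. (yc c \<bullet> X (Suc n) w) * (yc d \<bullet> X (Suc n) w)) (Q (yc c) (yc d))"
    by (rule second_moment) simp
  note int = integrable_gain_product[OF K0, of n r c d] 2[unfolded has_bochner_integral_iff, THEN conjunct1]
  show ?thesis
    unfolding has_bochner_integral_iff
    using indep_var_integrable[OF ind int] indep_var_lebesgue_integral[OF ind int]
      2[unfolded has_bochner_integral_iff, THEN conjunct2] by simp
qed

lemma expected_curvature:
  assumes K0: "opnorm K0 \<le> b"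
  shows "integrable P (\<lambda>w. (norm (Kn n w - K0))\<^sup>2)"
    and "integrable P (\<lambda>w. (norm ((Kn n w - K0) *v Y (Suc n) w))\<^sup>2)"
    and "\<sigma> * (\<integral>w. (norm (Kn n w - K0))\<^sup>2 \<partial>P) \<le> (\<integral>w. (norm ((Kn n w - K0) *v Y (Suc n) w))\<^sup>2 \<partial>P)"
proof -
  let ?e = "\<Sum>r\<in>UNIV. \<Sum>c\<in>UNIV. \<Sum>d\<in>UNIV. (\<integral>w. (Kn n w - K0) $ r $ c * (Kn n w - K0) $ r $ d \<partial>P) * Q (yc c) (yc d)"
  have 1: "has_bochner_integral P (\<lambda>w. (norm ((Kn n w - K0) *v Y (Suc n) w))\<^sup>2) ?e"
    unfolding norm_mult_Y_expand by (intro has_bochner_integral_sum gain_independent K0)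
  have 2: "has_bochner_integral P (\<lambda>w. \<Sum>r\<in>UNIV. (Kn n w - K0) $ r \<bullet> (S *v (Kn n w - K0) $ r)) ?e"
    unfolding S_row_expand
    by (intro has_bochner_integral_sum has_bochner_integral_mult_left has_bochner_integral_integrable
        integrable_gain_product K0)
  have "(norm (Kn n w - K0))\<^sup>2 = (\<Sum>r\<in>UNIV. \<Sum>c\<in>UNIV. (Kn n w - K0) $ r $ c * (Kn n w - K0) $ r $ c)" for w
    by (simp only: power2_norm_eq_inner inner_vec_def inner_real_def)
  then show 3: "integrable P (\<lambda>w. (norm (Kn n w - K0))\<^sup>2)"
    by (simp only:) (intro Bochner_Integration.integrable_sum integrable_gain_product K0)
  show "integrable P (\<lambda>w. (norm ((Kn n w - K0) *v Y (Suc n) w))\<^sup>2)"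
    using 1 by (simp only: has_bochner_integral_iff)
  have "\<sigma> * (\<integral>w. (norm (Kn n w - K0))\<^sup>2 \<partial>P) = (\<integral>w. \<sigma> * (norm (Kn n w - K0))\<^sup>2 \<partial>P)" by simp
  also have "\<dots> \<le> (\<integral>w. (\<Sum>r\<in>UNIV. (Kn n w - K0) $ r \<bullet> (S *v (Kn n w - K0) $ r)) \<partial>P)"
    using 2 3 by (intro integral_mono S_row_quadratic) (auto simp: has_bochner_integral_iff)
  also have "\<dots> = (\<integral>w. (norm ((Kn n w - K0) *v Y (Suc n) w))\<^sup>2 \<partial>P)"
    using 1 2 by (simp only: has_bochner_integral_iff)
  finally show "\<sigma> * (\<integral>w. (norm (Kn n w - K0))\<^sup>2 \<partial>P) \<le> (\<integral>w. (norm ((Kn n w - K0) *v Y (Suc n) w))\<^sup>2 \<partial>P)" .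
qed

definition B where "B = 2 * (opnorm D)\<^sup>2 * A\<^sup>2 * (opnorm C + 1)\<^sup>2 * E4 / lam"

text \<open>
  The step \<open>1 / (lam t)\<close> is chosen so that strong convexity cancels the growth of \<open>1 / \<eta>\<close> from one round to the next, and the
  distances telescope.
\<close>

lemma round_regret:
  fixes n and K0 :: "real^'p^'m"
  assumes K0: "K0 \<in> W"
  defines "d \<equiv> \<lambda>n. (\<integral>w. (norm (Kn n w - K0))\<^sup>2 \<partial>P)"
  shows "(\<integral>w. (norm (Z (Kn n w) (Suc n) w))\<^sup>2 \<partial>P) - F K0
    \<le> lam / 2 * (real n * d n - real (Suc n) * d (Suc n)) + B / real (Suc n)"
proof -
  define t where "t = Suc n"
  define c where "c = 4 * (opnorm D)\<^sup>2 * A\<^sup>2 * (opnorm C + 1)\<^sup>2"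
  define \<delta> where "\<delta> = (\<integral>w. (norm (Z (Kn n w) t w))\<^sup>2 \<partial>P) - F K0"
  define e where "e = (\<integral>w. (norm ((Kn n w - K0) *v Y t w))\<^sup>2 \<partial>P)"
  have K0b: "opnorm K0 \<le> b" using K0 by (simp add: W_def)
  have c0: "c \<ge> 0" by (simp add: c_def)
  have t1: "t \<ge> 1" by (simp add: t_def)
  have \<eta>pos: "\<eta> t > 0" using lam t1 by (simp add: \<eta>_def)
  have hb: "has_bochner_integral P (\<lambda>w. (norm (Kn n w - K0))\<^sup>2
    - 2 * \<eta> t * ((norm (Z (Kn n w) t w))\<^sup>2 - (norm (Z K0 t w))\<^sup>2 + s * (norm ((Kn n w - K0) *v Y t w))\<^sup>2)
    + (\<eta> t)\<^sup>2 * (c * (norm (X t w)) ^ 4))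
    (d n - 2 * \<eta> t * ((\<integral>w. (norm (Z (Kn n w) t w))\<^sup>2 \<partial>P) - F K0 + s * e) + (\<eta> t)\<^sup>2 * (c * (\<integral>w. (norm (X t w)) ^ 4 \<partial>P)))"
    unfolding d_def e_def
    by (intro has_bochner_integral_add has_bochner_integral_diff has_bochner_integral_mult_right
        expected_loss[OF t1] has_bochner_integral_integrable expected_curvature(1)[OF K0b]
        expected_curvature(2)[OF K0b, of n, folded t_def] integrable_loss_Kn[of n, folded t_def]
        expected_norm_X_fourth(1)[OF t1])
  have dt: "d t = (\<integral>w. (norm (Kn t w - K0))\<^sup>2 \<partial>P)" by (simp add: d_def)
  have "d t \<le> d n - 2 * \<eta> t * (\<delta> + s * e) + (\<eta> t)\<^sup>2 * (c * (\<integral>w. (norm (X t w)) ^ 4 \<partial>P))"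
    unfolding \<delta>_def dt has_bochner_integral_integral_eq[OF hb, symmetric]
  proof (rule integral_mono)
    show "integrable P (\<lambda>w. (norm (Kn t w - K0))\<^sup>2)" by (rule expected_curvature(1)[OF K0b])
    show "integrable P (\<lambda>w. (norm (Kn n w - K0))\<^sup>2
      - 2 * \<eta> t * ((norm (Z (Kn n w) t w))\<^sup>2 - (norm (Z K0 t w))\<^sup>2 + s * (norm ((Kn n w - K0) *v Y t w))\<^sup>2)
      + (\<eta> t)\<^sup>2 * (c * (norm (X t w)) ^ 4))" using hb by (simp only: has_bochner_integral_iff)
  qed (unfold t_def c_def, rule gradient_step[OF K0])
  also have "\<dots> \<le> d n - 2 * \<eta> t * (\<delta> + lam / 2 * d n) + (\<eta> t)\<^sup>2 * (c * E4)"
  proof (intro add_mono diff_mono mult_left_mono order.refl expected_norm_X_fourth(2)[OF t1] c0)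
    have "0 \<le> d n" unfolding d_def by (intro Bochner_Integration.integral_nonneg) simp
    then have "lam / 2 * d n \<le> (s * \<sigma>) * d n" using lam by (intro mult_right_mono) auto
    also have "\<dots> \<le> s * e"
      using mult_left_mono[OF expected_curvature(3)[OF K0b, of n, folded t_def], of s] s(1)
      by (simp add: d_def e_def mult.assoc)
    finally show "lam / 2 * d n \<le> s * e" .
  qed (use \<eta>pos in simp_all)
  finally have "d t \<le> d n - 2 * \<eta> t * (\<delta> + lam / 2 * d n) + (\<eta> t)\<^sup>2 * (c * E4)" .
  then have "2 * \<eta> t * \<delta> \<le> d n - d t - 2 * \<eta> t * (lam / 2 * d n) + (\<eta> t)\<^sup>2 * (c * E4)" by (simp add: distrib_left)
  from mult_left_mono[OF this, of "lam * real t / 2"]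
  have "lam * real t / 2 * (2 * \<eta> t * \<delta>)
      \<le> lam * real t / 2 * (d n - d t - 2 * \<eta> t * (lam / 2 * d n) + (\<eta> t)\<^sup>2 * (c * E4))"
    using lam by simp
  also have "lam * real t / 2 * (2 * \<eta> t * \<delta>) = \<delta>" using lam t1 by (simp add: \<eta>_def)
  also have "lam * real t / 2 * (d n - d t - 2 * \<eta> t * (lam / 2 * d n) + (\<eta> t)\<^sup>2 * (c * E4))
      = lam / 2 * (real t * (d n - d t) - d n) + B / real t"
  proof -
    have "B = c * E4 / (2 * lam)" by (simp add: B_def c_def)
    then show ?thesis using lam t1 by (simp add: \<eta>_def field_simps power2_eq_square)
  qed
  also have "real t * (d n - d t) - d n = real n * d n - real t * d t" by (simp add: t_def algebra_simps)
  finally show ?thesis by (simp add: \<delta>_def t_def)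
qed

text \<open>
  The first round is charged to the bound on the expected loss instead of to the diameter of the ball, and
  so is the initial distance of the descent that starts with the second round: strong convexity turns an
  excess loss into a squared distance.
\<close>

lemma regret_against_best_fixed_gain:
  assumes T: "T \<ge> 1" and K0: "K0 \<in> W" "\<And>K. K \<in> W \<Longrightarrow> F K0 \<le> F K"
  shows "(\<Sum>n<T. (\<integral>w. (norm (Z (Kn n w) (Suc n) w))\<^sup>2 \<partial>P) - F K0) \<le> 2 * (A\<^sup>2 * \<tau> - F K0) + B * (harm T - 1)"
proof -
  define d where "d n = (\<integral>w. (norm (Kn n w - K0))\<^sup>2 \<partial>P)" for n
  define \<delta> where "\<delta> n = (\<integral>w. (norm (Z (Kn n w) (Suc n) w))\<^sup>2 \<partial>P) - F K0" for n
  have K0b: "opnorm K0 \<le> b" using K0 by (simp add: W_def)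
  have round: "\<delta> n \<le> lam / 2 * (real n * d n - real (Suc n) * d (Suc n)) + B / real (Suc n)" for n
    unfolding \<delta>_def d_def by (rule round_regret[OF K0(1)])
  have d0: "0 \<le> d n" for n unfolding d_def by (intro Bochner_Integration.integral_nonneg) simp
  have "Kn 0 w = Diag K1" for w by (simp add: Kn_def gn_def)
  then have "\<delta> 0 = F (Diag K1) - F K0"
    using expected_loss[of 1 "Diag K1"] by (simp add: \<delta>_def has_bochner_integral_iff)
  also have "\<dots> \<le> A\<^sup>2 * \<tau> - F K0"
    using F_le[OF Kn_opnorm, of 0] by (simp add: Kn_def gn_def)
  finally have first: "\<delta> 0 \<le> A\<^sup>2 * \<tau> - F K0" .
  have second: "lam / 2 * d 1 \<le> A\<^sup>2 * \<tau> - F K0"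
  proof -
    have "lam / 2 * d 1 \<le> (s * \<sigma>) * d 1" using lam d0[of 1] by (intro mult_right_mono) auto
    also have "\<dots> = (\<integral>w. s * \<sigma> * (norm (Kn 1 w - K0))\<^sup>2 \<partial>P)" by (simp add: d_def)
    also have "\<dots> \<le> (\<integral>w. A\<^sup>2 * \<tau> - F K0 \<partial>P)"
    proof (rule integral_mono)
      show "integrable P (\<lambda>w. s * \<sigma> * (norm (Kn 1 w - K0))\<^sup>2)"
        by (intro integrable_mult_right expected_curvature(1) K0b)
      show "s * \<sigma> * (norm (Kn 1 w - K0))\<^sup>2 \<le> A\<^sup>2 * \<tau> - F K0" for w
        using first_order(2)[OF K0 Kn_W[of 1 w]] F_le[OF Kn_opnorm[of 1 w]] by linarith
    qed simp
    also have "\<dots> = A\<^sup>2 * \<tau> - F K0" by (simp add: prob_space)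
    finally show ?thesis .
  qed
  have regroup: "(a + l * (e - p) + B * (h - 1)) + (l * (p - q) + B * r) = a + l * (e - q) + B * ((h + r) - 1)"
    for a l e p q h r B :: real by (simp add: algebra_simps)
  have "(\<Sum>n<T. \<delta> n) \<le> \<delta> 0 + lam / 2 * (d 1 - real T * d T) + B * (harm T - 1)"
    using T
  proof (induction T rule: dec_induct)
    case base
    then show ?case by (simp add: harm_def)
  next
    case (step n)
    have "(\<Sum>k<Suc n. \<delta> k) \<le> (\<delta> 0 + lam / 2 * (d 1 - real n * d n) + B * (harm n - 1))
        + (lam / 2 * (real n * d n - real (Suc n) * d (Suc n)) + B / real (Suc n))"
      using step.IH round[of n] by simp
    also have "\<dots> = \<delta> 0 + lam / 2 * (d 1 - real (Suc n) * d (Suc n)) + B * (harm (Suc n) - 1)"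
      unfolding harm_Suc divide_inverse[of B] by (rule regroup)
    finally show ?case .
  qed
  also have "\<dots> \<le> \<delta> 0 + lam / 2 * d 1 + B * (harm T - 1)"
    using lam d0[of T] by (intro add_right_mono add_left_mono mult_left_mono) auto
  also have "\<dots> \<le> (A\<^sup>2 * \<tau> - F K0) + (A\<^sup>2 * \<tau> - F K0) + B * (harm T - 1)"
    by (intro add_right_mono add_mono first second)
  finally show ?thesis by (simp only: \<delta>_def mult_2)
qed

end

context team_problem
begin

subsection \<open>What hindsight gains over the best fixed gain\<close>

text \<open>
  The excess loss of a gain over \<open>K0\<close> decouples over the agents: its linear term because the gain is
  block diagonal, its quadratic term because \<open>D\<^sup>T D \<ge> s\<close> removes the interaction through \<open>D\<close>. The
  minimizer \<open>K0\<close> is also optimal in each block separately, so the bound for one agent applies. The traces add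
  up to those of the whole problem, and \<open>- \<Gamma> K0 \<bullet> K0 / 2\<close> is a correlation of the outcome with the
  contribution of \<open>K0\<close> to it, which Cauchy-Schwarz bounds by \<open>f\<close> times a norm.
\<close>

lemma hindsight_gap:
  assumes T: "T \<ge> 1" and K0: "K0 \<in> W" "\<And>K. K \<in> W \<Longrightarrow> F K0 \<le> F K"
    and Ks_meas: "Kstar \<in> borel_measurable P" and Ks: "\<And>w. w \<in> space P \<Longrightarrow> Kstar w \<in> W"
    and f: "f\<^sup>2 = F K0" "f \<ge> 0"
  shows "(\<integral>w. (\<Sum>t\<in>{1..T}. (norm (Z K0 t w))\<^sup>2 - (norm (Z (Kstar w) t w))\<^sup>2) \<partial>P)
    \<le> real CARD('p) / s * ((opnorm D)\<^sup>2 * f\<^sup>2)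
      + (\<tau>y / \<sigma> + 1) * (f * (b * opnorm D * (opnorm C + 1) * sqrt \<tau>))"
    (is "?gap \<le> ?bound")
proof (cases "b = 0")
  \<comment> \<open>the ball is a point then, and the multiplier of the norm constraint does not exist\<close>
  case True
  have W0: "K = 0" if "K \<in> W" for K
  proof -
    have "opnorm K \<le> b" using that by (simp add: W_def)
    then have "opnorm K \<le> 0" using True by simp
    then show ?thesis using norm_le_opnorm[of K] opnorm_nonneg[of K] by simp
  qed
  have "(\<Sum>t\<in>{1..T}. (norm (Z K0 t w))\<^sup>2 - (norm (Z (Kstar w) t w))\<^sup>2) = 0" if "w \<in> space P" for w
    unfolding W0[OF K0(1)] W0[OF Ks[OF that]] by simp
  then have "?gap = (\<integral>w. 0 \<partial>P)" by (intro Bochner_Integration.integral_cong refl)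
  then have "?gap = 0" by simp
  moreover have "0 \<le> ?bound" using True s(1) by simp
  ultimately show ?thesis by simp
next
  case False
  with b have bpos: "b > 0" by simp
  define Kp where "Kp i K = block_part own_u own_y i K" for i K
  define yb where "yb i c = (if own_y c = i then yc c else 0)" for i c
  define zb where "zb i r = (if own_u r = i then zr K0 r else 0)" for i r
  define Gi where "Gi i = (\<chi> r c. 2 * Q (zb i r) (yb i c))" for i
  have Gi_block: "Gi i = Kp i (\<Gamma> K0)" for i
    by (auto simp: Gi_def Kp_def block_part_def \<Gamma>_def zb_def yb_def vec_eq_iff Q_simps)
  have K0b: "opnorm K0 \<le> b" "K0 \<in> block_diagonal own_u own_y" using K0 by (auto simp: W_def)
  have opt: "0 \<le> Gi i \<bullet> (K - Kp i K0)" if K: "opnorm K \<le> b" for i K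
  proof -
    define K' where "K' = Diag (\<lambda>j. if j = i then Kp i K else Kp j K0)"
    have sp: "(if j = i then Kp i K else Kp j K0) \<in> block_space own_u own_y j" for j
      by (simp add: Kp_def block_part_in_space)
    have "opnorm (Kp j L) \<le> b" if "opnorm L \<le> b" for j L
      using opnorm_block_part[of own_u own_y j L] that by (simp add: Kp_def)
    then have "opnorm K' \<le> b" unfolding K'_def opnorm_Diag_le_iff[OF sp] using K K0b by auto
    then have "K' \<in> W" unfolding W_def K'_def using DiagI[OF sp] by simp
    then have "0 \<le> \<Gamma> K0 \<bullet> (K' - K0)" using first_order(1)[OF K0] by blast
    also have "K' - K0 = Kp i (K - K0)"
    proof -
      have "K' - K0 = K' - Diag (\<lambda>j. Kp j K0)" using Diag_block_part[OF K0b(2)] by (simp add: Kp_def)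
      also have "\<dots> = Diag (\<lambda>j. (if j = i then Kp i K else Kp j K0) - Kp j K0)"
        unfolding K'_def by (rule Diag_diff[symmetric])
      also have "\<dots> = (\<Sum>j\<in>UNIV. if j = i then Kp i K - Kp i K0 else 0)"
        unfolding Diag_def by (intro sum.cong) auto
      also have "\<dots> = Kp i (K - K0)" by (simp add: Kp_def block_part_def vec_eq_iff)
      finally show ?thesis .
    qed
    also have "\<Gamma> K0 \<bullet> Kp i (K - K0) = Kp i (\<Gamma> K0) \<bullet> (K - Kp i K0)"
    proof -
      have "Kp i (K - K0) = Kp i (K - Kp i K0)" by (simp add: Kp_def block_part_def vec_eq_iff)
      then show ?thesis by (simp add: Kp_def inner_block_part)
    qed
    finally show ?thesis by (simp add: Gi_block)
  qed
  define Si where "Si i = (\<chi> c d. Q (yb i c) (yb i d))" for i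
  have solve: "\<exists>u. Si i *v u = a v* Kp i K0 \<and> \<sigma> * (u \<bullet> (a v* Kp i K0)) \<le> (norm (a v* Kp i K0))\<^sup>2" for i a
  proof -
    have Si_zero: "Si i $ c $ d = 0" if "c \<notin> {c. own_y c = i} \<or> d \<notin> {c. own_y c = i}" for c d
      using that by (auto simp: Si_def yb_def Q_simps)
    have Si_pd: "\<sigma> * (norm u)\<^sup>2 \<le> u \<bullet> (Si i *v u)" if u: "\<And>c. c \<notin> {c. own_y c = i} \<Longrightarrow> u $ c = 0" for u
    proof -
      have eq: "u $ c * (Si i $ c $ d * u $ d) = u $ c * (S $ c $ d * u $ d)" for c d
        using u[of c] u[of d] by (auto simp: Si_def S_def yb_def)
      have "u \<bullet> (Si i *v u) = u \<bullet> (S *v u)"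
        unfolding inner_vec_def matrix_vector_mult_def vec_lambda_beta inner_real_def sum_distrib_left
        by (intro sum.cong refl eq)
      then show ?thesis using S_quadratic[of u] by simp
    qed
    have "(a v* Kp i K0) $ c = 0" if "c \<notin> {c. own_y c = i}" for c
      using that by (simp add: Kp_def block_part_def vector_matrix_mult_def)
    then obtain u where "Si i *v u = a v* Kp i K0" "\<sigma> * (u \<bullet> (a v* Kp i K0)) \<le> (norm (a v* Kp i K0))\<^sup>2"
      using solve_on_block[of "{c. own_y c = i}" "Si i" \<sigma> "a v* Kp i K0", OF Si_zero Si_pd \<sigma>(1)] by blast
    then show ?thesis by (intro exI[of _ u] conjI)
  qed
  have trace: "(\<Sum>c\<in>UNIV. Q (yb i c) (yb i c)) \<le> \<tau>y" for i
    unfolding \<tau>y_def by (intro sum_mono) (use Q_nonneg in \<open>auto simp: yb_def Q_simps\<close>)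
  define const where "const = 4 * real CARD('m) * b\<^sup>2"
  have norm_W: "(norm K)\<^sup>2 \<le> real CARD('m) * b\<^sup>2" if "opnorm K \<le> b" for K :: "real^'p^'m"
    using norm_le_opnorm[of K] that opnorm_nonneg[of K] by (meson mult_left_mono of_nat_0_le_iff order.trans power_mono)
  \<comment> \<open>the ridge penalty \<open>\<rho>\<close> makes sample covariances invertible; in expectation it can be sent to zero\<close>
  have ridge: "?gap \<le> ?bound + s * \<rho> * const" if \<rho>: "\<rho> > 0" for \<rho>
  proof -
    define good where "good i R \<longleftrightarrow> integrable P R \<and> (\<forall>w K. opnorm K \<le> b \<longrightarrow> - R w - s * \<rho> * (norm (K - Kp i K0))\<^sup>2
        \<le> (\<Sum>t\<in>{1..T}. 2 * ((\<chi> r. zb i r \<bullet> X t w) \<bullet> ((K - Kp i K0) *v (\<chi> c. yb i c \<bullet> X t w)))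
            + s * (norm ((K - Kp i K0) *v (\<chi> c. yb i c \<bullet> X t w)))\<^sup>2)) \<and>
      (\<integral>w. R w \<partial>P) \<le> real CARD('p) / s * (\<Sum>r\<in>UNIV. Q (zb i r) (zb i r)) + (\<tau>y / \<sigma> + 1) * (- (Gi i \<bullet> Kp i K0) / 2)"
      for i R
    have "\<exists>R. good i R" for i
    proof (rule hindsight_gain[where T = T and b = b and s = s and \<sigma> = \<sigma> and \<rho> = \<rho> and ?K0.0 = "Kp i K0"
          and yc = "yb i" and zc = "zb i" and \<tau> = \<tau>y])
      show "opnorm (Kp i K0) \<le> b" using opnorm_block_part[of own_u own_y i K0] K0b by (simp add: Kp_def)
      show "0 \<le> (\<chi> r c. 2 * Q (zb i r) (yb i c)) \<bullet> (K - Kp i K0)" if "opnorm K \<le> b" for K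
        using opt[OF that, of i] by (simp add: Gi_def)
      show "\<exists>u. (\<chi> c d. Q (yb i c) (yb i d)) *v u = a v* Kp i K0 \<and> \<sigma> * (u \<bullet> (a v* Kp i K0)) \<le> (norm (a v* Kp i K0))\<^sup>2" for a
        using solve[of i a] by (simp only: Si_def)
      fix R
      assume R: "integrable P R"
        "\<And>w K. opnorm K \<le> b \<Longrightarrow> - R w - s * \<rho> * (norm (K - Kp i K0))\<^sup>2
          \<le> (\<Sum>t\<in>{1..T}. 2 * ((\<chi> r. zb i r \<bullet> X t w) \<bullet> ((K - Kp i K0) *v (\<chi> c. yb i c \<bullet> X t w)))
            + s * (norm ((K - Kp i K0) *v (\<chi> c. yb i c \<bullet> X t w)))\<^sup>2)"
        "(\<integral>w. R w \<partial>P) \<le> real CARD('p) / s * (\<Sum>r\<in>UNIV. Q (zb i r) (zb i r))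
          + (\<tau>y / \<sigma> + 1) * (- ((\<chi> r c. 2 * Q (zb i r) (yb i c)) \<bullet> Kp i K0) / 2)"
      show ?thesis
        unfolding good_def Gi_def by (intro exI[of _ R] conjI allI impI R)
    qed (use T bpos s(1) \<sigma>(1) \<rho> trace in simp_all)
    then have "\<forall>i. \<exists>R. good i R" by (rule allI)
    from choice[OF this] obtain R where R: "\<And>i. good i (R i)" by blast
    have R_int: "integrable P (R i)" for i using R[of i] by (simp add: good_def)
    have R_low: "- R i w - s * \<rho> * (norm (K - Kp i K0))\<^sup>2
        \<le> (\<Sum>t\<in>{1..T}. 2 * ((\<chi> r. zb i r \<bullet> X t w) \<bullet> ((K - Kp i K0) *v (\<chi> c. yb i c \<bullet> X t w)))
            + s * (norm ((K - Kp i K0) *v (\<chi> c. yb i c \<bullet> X t w)))\<^sup>2)" if "opnorm K \<le> b" for i w K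
      using R[of i] that unfolding good_def by blast
    have R_exp: "(\<integral>w. R i w \<partial>P) \<le> real CARD('p) / s * (\<Sum>r\<in>UNIV. Q (zb i r) (zb i r))
        + (\<tau>y / \<sigma> + 1) * (- (Gi i \<bullet> Kp i K0) / 2)" for i
      using R[of i] unfolding good_def by blast
    have zb_X: "(\<chi> r. zb i r \<bullet> X t w) = block_vec own_u i (Z K0 t w v* D)" for i t w
      by (simp add: vec_eq_iff zb_def block_vec_def zr_X)
    have yb_X: "(\<chi> c. yb i c \<bullet> X t w) = block_vec own_y i (Y t w)" for i t w
      by (simp add: vec_eq_iff yb_def block_vec_def yc_X)
    have pathwise: "(\<Sum>t\<in>{1..T}. (norm (Z K0 t w))\<^sup>2 - (norm (Z (Kstar w) t w))\<^sup>2)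
        \<le> (\<Sum>i\<in>UNIV. R i w) + s * \<rho> * const" if w: "w \<in> space P" for w
    proof -
      define K where "K = Kstar w"
      have K: "opnorm K \<le> b" "K \<in> block_diagonal own_u own_y" using Ks[OF w] by (auto simp: W_def K_def)
      define \<Delta> where "\<Delta> i = Kp i K - Kp i K0" for i
      have \<Delta>sp: "\<Delta> i \<in> block_space own_u own_y i" for i
        unfolding \<Delta>_def Kp_def by (intro block_space_diff block_part_in_space)
      have "Diag \<Delta> = Diag (\<lambda>i. Kp i K) - Diag (\<lambda>i. Kp i K0)"
        unfolding \<Delta>_def by (rule Diag_diff)
      then have \<Delta>: "K - K0 = Diag \<Delta>"
        unfolding Kp_def Diag_block_part[OF K(2)] Diag_block_part[OF K0b(2)] by (rule sym)
      have step: "(norm (Z K0 t w))\<^sup>2 - (norm (Z K t w))\<^sup>2 \<le> - (\<Sum>i\<in>UNIV.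
          2 * (block_vec own_u i (Z K0 t w v* D) \<bullet> (\<Delta> i *v block_vec own_y i (Y t w)))
            + s * (norm (\<Delta> i *v block_vec own_y i (Y t w)))\<^sup>2)" for t
      proof -
        have "(norm (Z K t w))\<^sup>2 = (norm (Z K0 t w))\<^sup>2 + 2 * (Z K0 t w \<bullet> (D *v ((K - K0) *v Y t w))) + (norm (D *v ((K - K0) *v Y t w)))\<^sup>2"
          unfolding Z_diff[of K t w K0]
          by (simp add: power2_norm_eq_inner inner_add_left inner_add_right inner_commute)
        moreover have "s * (\<Sum>i\<in>UNIV. (norm (\<Delta> i *v block_vec own_y i (Y t w)))\<^sup>2) \<le> (norm (D *v ((K - K0) *v Y t w)))\<^sup>2"
          using s(2)[of "(K - K0) *v Y t w"] unfolding \<Delta> norm_Diag_mult[OF \<Delta>sp] .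
        moreover have "Z K0 t w \<bullet> (D *v ((K - K0) *v Y t w))
            = (\<Sum>i\<in>UNIV. block_vec own_u i (Z K0 t w v* D) \<bullet> (\<Delta> i *v block_vec own_y i (Y t w)))"
        proof -
          have "Z K0 t w \<bullet> (D *v ((K - K0) *v Y t w)) = (Z K0 t w v* D) \<bullet> (Diag \<Delta> *v Y t w)"
            by (simp only: \<Delta> dot_lmul_matrix)
          also have "\<dots> = (\<Sum>i\<in>UNIV. (Z K0 t w v* D) \<bullet> (\<Delta> i *v block_vec own_y i (Y t w)))"
            by (simp only: Diag_mult[OF \<Delta>sp] inner_sum_right)
          also have "\<dots> = (\<Sum>i\<in>UNIV. block_vec own_u i (Z K0 t w v* D) \<bullet> (\<Delta> i *v block_vec own_y i (Y t w)))"
            by (intro sum.cong refl) (simp only: inner_block_vec block_space_mult(2)[OF \<Delta>sp])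
          finally show ?thesis .
        qed
        ultimately show ?thesis
          by (simp only: sum.distrib sum_distrib_left[symmetric])
      qed
      have "(\<Sum>t\<in>{1..T}. (norm (Z K0 t w))\<^sup>2 - (norm (Z K t w))\<^sup>2) \<le> (\<Sum>t\<in>{1..T}. - (\<Sum>i\<in>UNIV.
          2 * (block_vec own_u i (Z K0 t w v* D) \<bullet> (\<Delta> i *v block_vec own_y i (Y t w)))
            + s * (norm (\<Delta> i *v block_vec own_y i (Y t w)))\<^sup>2))"
        by (intro sum_mono step)
      also have "\<dots> = - (\<Sum>i\<in>UNIV. \<Sum>t\<in>{1..T}.
          2 * (block_vec own_u i (Z K0 t w v* D) \<bullet> (\<Delta> i *v block_vec own_y i (Y t w)))
            + s * (norm (\<Delta> i *v block_vec own_y i (Y t w)))\<^sup>2)"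
        unfolding sum_negf by (rule arg_cong[of _ _ uminus], rule sum.swap)
      also have "\<dots> \<le> - (\<Sum>i\<in>UNIV. - R i w - s * \<rho> * (norm (\<Delta> i))\<^sup>2)"
      proof (intro le_imp_neg_le sum_mono)
        fix i
        have "opnorm (Kp i K) \<le> b" using opnorm_block_part[of own_u own_y i K] K by (simp add: Kp_def)
        from R_low[OF this, of i w, unfolded zb_X yb_X]
        show "- R i w - s * \<rho> * (norm (\<Delta> i))\<^sup>2 \<le> (\<Sum>t\<in>{1..T}.
          2 * (block_vec own_u i (Z K0 t w v* D) \<bullet> (\<Delta> i *v block_vec own_y i (Y t w)))
            + s * (norm (\<Delta> i *v block_vec own_y i (Y t w)))\<^sup>2)" by (simp only: \<Delta>_def)
      qed
      also have "\<dots> = (\<Sum>i\<in>UNIV. R i w) + s * \<rho> * (\<Sum>i\<in>UNIV. (norm (\<Delta> i))\<^sup>2)"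
        by (simp add: sum_subtractf sum_negf sum_distrib_left)
      also have "\<dots> \<le> (\<Sum>i\<in>UNIV. R i w) + s * \<rho> * const"
      proof -
        have "(norm (K - K0))\<^sup>2 \<le> 2 * (norm K)\<^sup>2 + 2 * (norm K0)\<^sup>2"
          using zero_le_power2[of "norm (K + K0)"]
          by (simp add: power2_norm_eq_inner inner_diff_left inner_diff_right inner_add_left inner_add_right inner_commute)
        then have "(\<Sum>i\<in>UNIV. (norm (\<Delta> i))\<^sup>2) \<le> const"
          using norm_W[OF K(1)] norm_W[OF K0b(1)] unfolding const_def \<Delta> norm_Diag[OF \<Delta>sp] by simp
        then show ?thesis using s(1) \<rho> by (intro add_left_mono mult_left_mono) auto
      qed
      finally show ?thesis by (simp only: K_def)
    qed
    have int: "integrable P (\<lambda>w. (\<Sum>i\<in>UNIV. R i w) + s * \<rho> * const)"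
      using R_int by simp
    have "?gap \<le> (\<integral>w. (\<Sum>i\<in>UNIV. R i w) + s * \<rho> * const \<partial>P)"
    proof (rule integral_mono)
      have "integrable P (\<lambda>w. (norm (Z K0 t w))\<^sup>2)" "integrable P (\<lambda>w. (norm (Z (Kstar w) t w))\<^sup>2)" if "t \<in> {1..T}" for t
        using that K0b(1) Ks Ks_meas by (auto intro!: integrable_loss simp: W_def)
      then show "integrable P (\<lambda>w. \<Sum>t\<in>{1..T}. (norm (Z K0 t w))\<^sup>2 - (norm (Z (Kstar w) t w))\<^sup>2)"
        by (intro Bochner_Integration.integrable_sum Bochner_Integration.integrable_diff)
    qed (use int pathwise in auto)
    also have "\<dots> = (\<Sum>i\<in>UNIV. \<integral>w. R i w \<partial>P) + s * \<rho> * const"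
      using R_int by (simp add: prob_space)
    finally have gap1: "?gap \<le> (\<Sum>i\<in>UNIV. \<integral>w. R i w \<partial>P) + s * \<rho> * const" .
    have "(\<Sum>i\<in>UNIV. \<integral>w. R i w \<partial>P) \<le> (\<Sum>i\<in>UNIV. real CARD('p) / s * (\<Sum>r\<in>UNIV. Q (zb i r) (zb i r))
        + (\<tau>y / \<sigma> + 1) * (- (Gi i \<bullet> Kp i K0) / 2))" by (intro sum_mono R_exp)
    also have "\<dots> = real CARD('p) / s * (\<Sum>i\<in>UNIV. \<Sum>r\<in>UNIV. Q (zb i r) (zb i r))
        + (\<tau>y / \<sigma> + 1) * (- (\<Sum>i\<in>UNIV. Gi i \<bullet> Kp i K0) / 2)"
      by (simp only: sum.distrib sum_distrib_left[symmetric] sum_divide_distrib[symmetric] sum_negf)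
    also have "(\<Sum>i\<in>UNIV. \<Sum>r\<in>UNIV. Q (zb i r) (zb i r)) = (\<Sum>r\<in>UNIV. Q (zr K0 r) (zr K0 r))"
      by (subst sum.swap) (simp add: zb_def Q_simps if_distrib[of "\<lambda>x. Q x x"] cong: if_cong)
    also have "(\<Sum>i\<in>UNIV. Gi i \<bullet> Kp i K0) = \<Gamma> K0 \<bullet> K0"
    proof -
      have "Gi i \<bullet> Kp i K0 = \<Gamma> K0 \<bullet> Kp i K0" for i
        unfolding Gi_block Kp_def inner_block_part block_part_self[OF block_part_in_space] ..
      then have "(\<Sum>i\<in>UNIV. Gi i \<bullet> Kp i K0) = \<Gamma> K0 \<bullet> Diag (\<lambda>i. Kp i K0)" by (simp add: Diag_def inner_sum_right)
      then show ?thesis using Diag_block_part[OF K0b(2)] by (simp add: Kp_def)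
    qed
    finally have gap2: "(\<Sum>i\<in>UNIV. \<integral>w. R i w \<partial>P) \<le> real CARD('p) / s * (\<Sum>r\<in>UNIV. Q (zr K0 r) (zr K0 r))
        + (\<tau>y / \<sigma> + 1) * (- (\<Gamma> K0 \<bullet> K0) / 2)" .
    have noise: "(\<Sum>r\<in>UNIV. Q (zr K0 r) (zr K0 r)) \<le> (opnorm D)\<^sup>2 * f\<^sup>2"
    proof -
      have 1: "has_bochner_integral P (\<lambda>w. (norm (Z K0 1 w v* D))\<^sup>2) (\<Sum>r\<in>UNIV. Q (zr K0 r) (zr K0 r))"
        using norm_functional[of 1 "zr K0" UNIV] by (simp add: zr_X norm_vec_squared)
      have 2: "has_bochner_integral P (\<lambda>w. (opnorm D)\<^sup>2 * (norm (Z K0 1 w))\<^sup>2) ((opnorm D)\<^sup>2 * F K0)"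
        by (intro has_bochner_integral_mult_right expected_loss) simp
      have "(norm (Z K0 1 w v* D))\<^sup>2 \<le> (opnorm D)\<^sup>2 * (norm (Z K0 1 w))\<^sup>2" for w
        using power_mono[OF norm_vector_matrix_le_opnorm[of "Z K0 1 w" D], of 2] by (simp add: power_mult_distrib)
      then show ?thesis
        unfolding f(1) using 1 2 integral_mono[of P "\<lambda>w. (norm (Z K0 1 w v* D))\<^sup>2" "\<lambda>w. (opnorm D)\<^sup>2 * (norm (Z K0 1 w))\<^sup>2"]
        by (simp only: has_bochner_integral_iff)
    qed
    have signal: "- (\<Gamma> K0 \<bullet> K0) / 2 \<le> f * (b * opnorm D * (opnorm C + 1) * sqrt \<tau>)"
    proof (rule le_mult_of_weighted_am_gm)
      define \<beta> where "\<beta> = b * opnorm D * (opnorm C + 1)"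
      have \<tau>0: "\<tau> \<ge> 0"
      proof -
        have "0 \<le> (\<integral>w. (norm (X 1 w))\<^sup>2 \<partial>P)" by (intro Bochner_Integration.integral_nonneg) simp
        also have "\<dots> = \<tau>" using expected_norm_X[of 1] by (simp add: has_bochner_integral_iff)
        finally show ?thesis .
      qed
      show "0 \<le> b * opnorm D * (opnorm C + 1) * sqrt \<tau>"
        using b \<tau>0 opnorm_nonneg[of D] opnorm_nonneg[of C] by simp
      fix e :: real assume e: "e > 0"
      have 1: "has_bochner_integral P (\<lambda>w. - (2 * (Z K0 1 w \<bullet> (D *v (K0 *v Y 1 w))))) (- (\<Gamma> K0 \<bullet> K0))"
        by (intro has_bochner_integral_minus expected_gradient) simp
      have 2: "has_bochner_integral P (\<lambda>w. e * (norm (Z K0 1 w))\<^sup>2 + (\<beta>\<^sup>2 / e) * (norm (X 1 w))\<^sup>2) (e * F K0 + (\<beta>\<^sup>2 / e) * \<tau>)"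
        by (intro has_bochner_integral_add has_bochner_integral_mult_right expected_loss expected_norm_X) simp_all
      have 3: "- (2 * (Z K0 1 w \<bullet> (D *v (K0 *v Y 1 w)))) \<le> e * (norm (Z K0 1 w))\<^sup>2 + (\<beta>\<^sup>2 / e) * (norm (X 1 w))\<^sup>2" for w
      proof -
        let ?z = "Z K0 1 w" and ?d = "D *v (K0 *v Y 1 w)"
        have "0 \<le> (norm (e *\<^sub>R ?z + ?d))\<^sup>2 / e" using e by simp
        also have "\<dots> = e * (norm ?z)\<^sup>2 + 2 * (?z \<bullet> ?d) + (norm ?d)\<^sup>2 / e"
          using e by (simp add: power2_norm_eq_inner inner_add_left inner_add_right inner_commute field_simps)
        finally have "- (2 * (?z \<bullet> ?d)) \<le> e * (norm ?z)\<^sup>2 + (norm ?d)\<^sup>2 / e" by linarith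
        also have "(norm ?d)\<^sup>2 / e \<le> (\<beta>\<^sup>2 / e) * (norm (X 1 w))\<^sup>2"
          using power_mono[OF norm_DKY_le[OF K0b(1), of 1 w], of 2] e
          by (simp add: \<beta>_def[symmetric] power_mult_distrib divide_right_mono)
        finally show ?thesis by simp
      qed
      have "- (\<Gamma> K0 \<bullet> K0) \<le> e * F K0 + (\<beta>\<^sup>2 / e) * \<tau>"
      proof -
        have "(\<integral>w. - (2 * (Z K0 1 w \<bullet> (D *v (K0 *v Y 1 w)))) \<partial>P)
            \<le> (\<integral>w. e * (norm (Z K0 1 w))\<^sup>2 + (\<beta>\<^sup>2 / e) * (norm (X 1 w))\<^sup>2 \<partial>P)"
        proof (rule integral_mono)
          show "integrable P (\<lambda>w. - (2 * (Z K0 1 w \<bullet> (D *v (K0 *v Y 1 w)))))" by (rule integrable.intros[OF 1])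
          show "integrable P (\<lambda>w. e * (norm (Z K0 1 w))\<^sup>2 + (\<beta>\<^sup>2 / e) * (norm (X 1 w))\<^sup>2)"
            by (rule integrable.intros[OF 2])
          show "- (2 * (Z K0 1 w \<bullet> (D *v (K0 *v Y 1 w)))) \<le> e * (norm (Z K0 1 w))\<^sup>2 + (\<beta>\<^sup>2 / e) * (norm (X 1 w))\<^sup>2" for w
            by (rule 3)
        qed
        then show ?thesis
          by (simp only: has_bochner_integral_integral_eq[OF 1] has_bochner_integral_integral_eq[OF 2])
      qed
      then show "2 * (- (\<Gamma> K0 \<bullet> K0) / 2) \<le> e * f\<^sup>2 + (b * opnorm D * (opnorm C + 1) * sqrt \<tau>)\<^sup>2 / e"
        using \<tau>0 by (simp add: f(1) \<beta>_def[symmetric] power_mult_distrib)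
    qed (use f in simp)
    have "0 \<le> \<tau>y" unfolding \<tau>y_def by (intro sum_nonneg Q_nonneg)
    then have "0 \<le> \<tau>y / \<sigma> + 1" using \<sigma>(1) by simp
    then have "real CARD('p) / s * (\<Sum>r\<in>UNIV. Q (zr K0 r) (zr K0 r)) + (\<tau>y / \<sigma> + 1) * (- (\<Gamma> K0 \<bullet> K0) / 2) \<le> ?bound"
      using s(1) by (intro add_mono mult_left_mono noise signal) auto
    with gap1 gap2 show ?thesis by linarith
  qed
  have const: "const \<ge> 0" by (simp add: const_def)
  show ?thesis
  proof (rule field_le_epsilon)
    fix e :: real assume e: "e > 0"
    define \<rho> where "\<rho> = e / (s * (const + 1))"
    have "\<rho> > 0" using e s(1) const by (simp add: \<rho>_def)
    moreover have "s * \<rho> * const \<le> e"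
    proof -
      have "s * \<rho> * const = e * (const / (const + 1))" using s(1) const by (simp add: \<rho>_def)
      also have "\<dots> \<le> e * 1" using e const by (intro mult_left_mono) auto
      finally show ?thesis by simp
    qed
    ultimately show "?gap \<le> ?bound + e" using ridge[of \<rho>] by linarith
  qed
qed

end

section \<open>The regret\<close>

text \<open>
  Here \<open>a\<^sup>2\<close> bounds the expected loss of a round, \<open>f\<^sup>2\<close> is the loss of the best fixed gain and \<open>\<kappa> * a\<^sup>2\<close> is the
  coefficient of the logarithm. What the two uses of \<open>a\<^sup>2 - f\<^sup>2\<close> and the hindsight term \<open>\<kappa> * f * a\<close> cost
  is paid by the quarter that is lost when the harmonic number is replaced by the logarithm: the
  difference of the two sides is at least twice the square of \<open>a / 2 - f\<close>.
\<close>

lemma regret_budget: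
  fixes a f \<kappa> :: real
  assumes "2 \<le> \<kappa>" "0 \<le> f" "f \<le> a" "T \<ge> 3"
  shows "2 * (a\<^sup>2 - f\<^sup>2) + \<kappa> * a\<^sup>2 * (harm T - 1) + \<kappa> * (f * a) \<le> \<kappa> * a\<^sup>2 * (1 + ln (real T))"
proof -
  have "f * a \<le> a * a" using assms by (intro mult_right_mono) auto
  moreover have "0 \<le> a * a" by simp
  ultimately have pos: "0 \<le> 5 / 4 * a\<^sup>2 - f * a" unfolding power2_eq_square by linarith
  have "0 \<le> 2 * (a / 2 - f)\<^sup>2" by simp
  also have "\<dots> = 2 * (5 / 4 * a\<^sup>2 - f * a) - 2 * (a\<^sup>2 - f\<^sup>2)" by (simp add: power2_eq_square field_simps)
  finally have "2 * (a\<^sup>2 - f\<^sup>2) \<le> 2 * (5 / 4 * a\<^sup>2 - f * a)" by simp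
  also have "\<dots> \<le> \<kappa> * (5 / 4 * a\<^sup>2 - f * a)" by (rule mult_right_mono[OF assms(1) pos])
  finally have 1: "2 * (a\<^sup>2 - f\<^sup>2) \<le> \<kappa> * (5 / 4 * a\<^sup>2 - f * a)" .
  have 2: "\<kappa> * a\<^sup>2 * (harm T - 1) \<le> \<kappa> * a\<^sup>2 * (ln (real T) - 1 / 4)"
    using harm_le_ln[OF assms(4)] assms(1) by (intro mult_left_mono) auto
  have "\<kappa> * (5 / 4 * a\<^sup>2 - f * a) + \<kappa> * a\<^sup>2 * (ln (real T) - 1 / 4) + \<kappa> * (f * a) = \<kappa> * a\<^sup>2 * (1 + ln (real T))"
    by (simp add: algebra_simps)
  with 1 2 show ?thesis by linarith
qed

context team_learning
begin

text \<open>
  The number \<open>\<kappa>\<close> exceeds the coefficients \<open>(opnorm D)\<^sup>2 CARD('p) / s\<close> and \<open>r = \<tau>y / \<sigma> + 1\<close> of the hindsight bound because the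
  fourth moment exceeds \<open>\<tau> (\<tau>y + \<sigma>)\<close>, and it is at least \<open>2\<close> because \<open>r\<close> is. As the zero gain is admissible, \<open>f\<close> is at
  most the part of \<open>a\<close> that stems from \<open>H\<close>, which leaves the other part for \<open>\<beta>\<close>.
\<close>

lemma regret_bound:
  assumes T: "T \<ge> 1" and Ks_meas: "Kstar \<in> borel_measurable P" and Ks: "\<And>w. w \<in> space P \<Longrightarrow> Kstar w \<in> W"
  shows "(\<Sum>n<T. \<integral>w. (norm (Z (Kn n w) (Suc n) w))\<^sup>2 - (norm (Z (Kstar w) (Suc n) w))\<^sup>2 \<partial>P) \<le> B * (1 + ln (real T))"
proof -
  define m where "m = (opnorm C + 1)\<^sup>2"
  define d where "d = (opnorm D)\<^sup>2"
  define \<kappa> where "\<kappa> = 2 * d * m * E4 / (lam * \<tau>)"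
  define a where "a = A * sqrt \<tau>"
  define p where "p = real CARD('p)"
  have p1: "1 \<le> p" by (simp add: p_def Suc_leI)
  then have "\<sigma> \<le> p * \<sigma>" using \<sigma>(1) by simp
  then have ty: "\<sigma> \<le> \<tau>y" using trace_bounds(1) by (simp add: p_def)
  have "0 < m * \<tau>" using ty trace_bounds(2) \<sigma>(1) by (simp add: m_def)
  then have \<tau>0: "\<tau> > 0" by (simp add: zero_less_mult_iff m_def)
  have a2: "a\<^sup>2 = A\<^sup>2 * \<tau>" using \<tau>0 by (simp add: a_def power_mult_distrib)
  have B: "B = \<kappa> * a\<^sup>2" using \<tau>0 lam by (simp add: B_def \<kappa>_def a2 d_def m_def)
  have ds: "s \<le> d"
  proof -
    define u :: "real^'m" where "u = axis undefined 1"
    have "norm u = 1" by (simp add: u_def)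
    then have "s \<le> (norm (D *v u))\<^sup>2" using s(2)[of u] by simp
    also have "\<dots> \<le> d" using power_mono[OF norm_matrix_vector_le_opnorm[of D u], of 2] \<open>norm u = 1\<close> by (simp add: d_def)
    finally show ?thesis .
  qed
  define r where "r = \<tau>y / \<sigma> + 1"
  have r: "p \<le> r" "2 \<le> r"
    using trace_bounds(1) p1 \<sigma>(1) ty by (simp_all add: r_def p_def field_simps)
  have \<kappa>r: "d / s * r \<le> \<kappa>"
  proof -
    have "d / s * r = d * (\<tau> * (\<tau>y + \<sigma>)) / (s * \<sigma> * \<tau>)" using s(1) \<sigma>(1) \<tau>0 by (simp add: r_def field_simps)
    also have "\<dots> \<le> d * (m * E4) / (s * \<sigma> * \<tau>)"
      using fourth_moment_surplus s(1) \<sigma>(1) \<tau>0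
      by (intro divide_right_mono mult_left_mono) (auto simp: m_def d_def)
    also have "\<dots> = 2 * d * m * E4 / (2 * s * \<sigma> * \<tau>)" using s(1) \<sigma>(1) \<tau>0 by (simp add: field_simps)
    also have "\<dots> \<le> \<kappa>" unfolding \<kappa>_def
    proof (intro divide_left_mono)
      show "lam * \<tau> \<le> 2 * s * \<sigma> * \<tau>" using lam \<tau>0 by (intro mult_right_mono) auto
      have "0 \<le> \<tau> * (\<tau>y + \<sigma>)" using \<tau>0 ty \<sigma>(1) by simp
      then have "0 \<le> m * E4" using fourth_moment_surplus by (simp add: m_def)
      then show "0 \<le> 2 * d * m * E4" by (simp add: d_def mult.assoc)
    qed (use lam \<tau>0 s(1) \<sigma>(1) in simp)
    finally show ?thesis .
  qed
  have ds1: "1 \<le> d / s" using ds s(1) by simp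
  have \<kappa>1: "r \<le> \<kappa>" using mult_right_mono[OF ds1, of r] r \<kappa>r by simp
  have \<kappa>2: "d / s * p \<le> \<kappa>" using mult_left_mono[OF r(1), of "d / s"] ds1 \<kappa>r by simp
  have intK: "integrable P (\<lambda>w. (norm (Z (Kn n w) (Suc n) w))\<^sup>2)" for n by (rule integrable_loss_Kn)
  have intS: "integrable P (\<lambda>w. (norm (Z (Kstar w) (Suc n) w))\<^sup>2)" for n
    using Ks by (intro integrable_loss Ks_meas) (auto simp: W_def)
  show ?thesis
  proof (cases "T \<ge> 3")
    case False
    have "(\<integral>w. (norm (Z (Kn n w) (Suc n) w))\<^sup>2 - (norm (Z (Kstar w) (Suc n) w))\<^sup>2 \<partial>P) \<le> a\<^sup>2" for n
    proof -
      have "(\<integral>w. (norm (Z (Kn n w) (Suc n) w))\<^sup>2 - (norm (Z (Kstar w) (Suc n) w))\<^sup>2 \<partial>P)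
          \<le> (\<integral>w. A\<^sup>2 * (norm (X (Suc n) w))\<^sup>2 \<partial>P)"
      proof (rule integral_mono)
        show "(norm (Z (Kn n w) (Suc n) w))\<^sup>2 - (norm (Z (Kstar w) (Suc n) w))\<^sup>2 \<le> A\<^sup>2 * (norm (X (Suc n) w))\<^sup>2" for w
        proof -
          have "(norm (Z (Kn n w) (Suc n) w))\<^sup>2 \<le> A\<^sup>2 * (norm (X (Suc n) w))\<^sup>2"
            using power_mono[OF norm_Z_le[OF Kn_opnorm[of n w], of "Suc n" w], of 2] by (simp add: power_mult_distrib)
          then show ?thesis using zero_le_power2[of "norm (Z (Kstar w) (Suc n) w)"] by linarith
        qed
        show "integrable P (\<lambda>w. (norm (Z (Kn n w) (Suc n) w))\<^sup>2 - (norm (Z (Kstar w) (Suc n) w))\<^sup>2)"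
          by (intro Bochner_Integration.integrable_diff intK intS)
        show "integrable P (\<lambda>w. A\<^sup>2 * (norm (X (Suc n) w))\<^sup>2)"
          using expected_norm_X[of "Suc n"] by (simp add: has_bochner_integral_iff)
      qed
      also have "\<dots> = a\<^sup>2" unfolding a2 using expected_norm_X[of "Suc n"] by (simp add: has_bochner_integral_iff)
      finally show ?thesis .
    qed
    then have "(\<Sum>n<T. \<integral>w. (norm (Z (Kn n w) (Suc n) w))\<^sup>2 - (norm (Z (Kstar w) (Suc n) w))\<^sup>2 \<partial>P) \<le> (\<Sum>n<T. a\<^sup>2)"
      by (rule sum_mono)
    also have "\<dots> = real T * a\<^sup>2" by simp
    also have "\<dots> \<le> \<kappa> * a\<^sup>2" using False r(2) \<kappa>1 by (intro mult_right_mono) auto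
    also have "\<dots> \<le> B * (1 + ln (real T))"
    proof -
      have "0 \<le> \<kappa> * a\<^sup>2" using r(2) \<kappa>1 by simp
      moreover have "1 \<le> 1 + ln (real T)" using T by simp
      ultimately show ?thesis unfolding B using mult_left_mono[of 1 "1 + ln (real T)" "\<kappa> * a\<^sup>2"] by simp
    qed
    finally show ?thesis .
  next
    case True
    obtain K0 where K0: "K0 \<in> W" "\<And>K. K \<in> W \<Longrightarrow> F K0 \<le> F K" using minimizer by blast
    define f where "f = sqrt (F K0)"
    define \<beta> where "\<beta> = b * opnorm D * (opnorm C + 1) * sqrt \<tau>"
    have f: "f\<^sup>2 = F K0" "f \<ge> 0" using F_nonneg[of K0] by (simp_all add: f_def)
    have \<beta>0: "\<beta> \<ge> 0" using b \<tau>0 opnorm_nonneg[of D] opnorm_nonneg[of C] by (simp add: \<beta>_def)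
    have "F K0 \<le> (opnorm H)\<^sup>2 * \<tau>" using K0(2)[OF zero_in_W] F_zero_le by simp
    then have "f \<le> sqrt ((opnorm H)\<^sup>2 * \<tau>)" unfolding f_def by (rule real_sqrt_le_mono)
    also have "\<dots> = opnorm H * sqrt \<tau>" using opnorm_nonneg[of H] by (simp add: real_sqrt_mult)
    also have "\<dots> = a - \<beta>" by (simp add: a_def A_def \<beta>_def algebra_simps)
    finally have fa: "f + \<beta> \<le> a" by simp
    define gap where "gap = (\<integral>w. (\<Sum>t\<in>{1..T}. (norm (Z K0 t w))\<^sup>2 - (norm (Z (Kstar w) t w))\<^sup>2) \<partial>P)"
    have "gap \<le> p / s * (d * f\<^sup>2) + r * (f * \<beta>)"
      using hindsight_gap[OF T K0 Ks_meas Ks f] by (simp only: gap_def p_def d_def r_def \<beta>_def)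
    also have "\<dots> = (d / s * p) * f\<^sup>2 + r * (f * \<beta>)" by simp
    also have "\<dots> \<le> \<kappa> * f\<^sup>2 + \<kappa> * (f * \<beta>)"
      using \<kappa>1 \<kappa>2 f(2) \<beta>0 by (intro add_mono mult_right_mono) auto
    also have "\<dots> = \<kappa> * (f * (f + \<beta>))" by (simp add: power2_eq_square algebra_simps)
    also have "\<dots> \<le> \<kappa> * (f * a)" using fa f r(2) \<kappa>1 by (intro mult_left_mono) auto
    finally have gap: "gap \<le> \<kappa> * (f * a)" .
    have lossS: "integrable P (\<lambda>w. (norm (Z (Kstar w) t w))\<^sup>2)" "has_bochner_integral P (\<lambda>w. (norm (Z K0 t w))\<^sup>2) (F K0)"
      if "t \<in> {1..T}" for t
      using intS[of "t - 1"] expected_loss[of t K0] that by simp_all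
    have "gap = (\<Sum>t\<in>{1..T}. \<integral>w. (norm (Z K0 t w))\<^sup>2 - (norm (Z (Kstar w) t w))\<^sup>2 \<partial>P)"
      unfolding gap_def using lossS by (intro Bochner_Integration.integral_sum Bochner_Integration.integrable_diff)
        (auto simp: has_bochner_integral_iff)
    also have "\<dots> = (\<Sum>t\<in>{1..T}. F K0 - (\<integral>w. (norm (Z (Kstar w) t w))\<^sup>2 \<partial>P))"
    proof (rule sum.cong[OF refl])
      fix t assume t: "t \<in> {1..T}"
      show "(\<integral>w. (norm (Z K0 t w))\<^sup>2 - (norm (Z (Kstar w) t w))\<^sup>2 \<partial>P) = F K0 - (\<integral>w. (norm (Z (Kstar w) t w))\<^sup>2 \<partial>P)"
        using lossS[OF t] by (simp add: has_bochner_integral_iff)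
    qed
    also have "\<dots> = (\<Sum>n<T. F K0 - (\<integral>w. (norm (Z (Kstar w) (Suc n) w))\<^sup>2 \<partial>P))"
      by (simp only: One_nat_def sum.atLeast1_atMost_eq)
    finally have gap_eq: "gap = (\<Sum>n<T. F K0 - (\<integral>w. (norm (Z (Kstar w) (Suc n) w))\<^sup>2 \<partial>P))" .
    have "(\<Sum>n<T. \<integral>w. (norm (Z (Kn n w) (Suc n) w))\<^sup>2 - (norm (Z (Kstar w) (Suc n) w))\<^sup>2 \<partial>P)
        = (\<Sum>n<T. ((\<integral>w. (norm (Z (Kn n w) (Suc n) w))\<^sup>2 \<partial>P) - F K0) + (F K0 - (\<integral>w. (norm (Z (Kstar w) (Suc n) w))\<^sup>2 \<partial>P)))"
      using intK intS by (intro sum.cong refl) simp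
    also have "\<dots> = (\<Sum>n<T. (\<integral>w. (norm (Z (Kn n w) (Suc n) w))\<^sup>2 \<partial>P) - F K0) + gap"
      unfolding gap_eq by (rule sum.distrib)
    also have "\<dots> \<le> (2 * (a\<^sup>2 - f\<^sup>2) + \<kappa> * a\<^sup>2 * (harm T - 1)) + \<kappa> * (f * a)"
      using regret_against_best_fixed_gain[OF T K0] by (intro add_mono gap) (simp only: a2 f(1) B)
    also have "\<dots> \<le> \<kappa> * a\<^sup>2 * (1 + ln (real T))"
      using regret_budget[of \<kappa> f a T] r(2) \<kappa>1 f(2) fa \<beta>0 True by simp
    finally show ?thesis by (simp only: B)
  qed
qed

end

theorem theoremV2:
  fixes P :: "'w measure"
    and own_u :: "'m::finite \<Rightarrow> 'a::finite" and own_y :: "'p::finite \<Rightarrow> 'a"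
    and H :: "real^'n::finite^'q::finite" and D :: "real^'m^'q" and C :: "real^'n^'p"
    and V\<^sub>x\<^sub>x :: "real^'n^'n" and V\<^sub>v\<^sub>v :: "real^'p^'p"
    and x :: "nat \<Rightarrow> 'w \<Rightarrow> real^'n" and v :: "nat \<Rightarrow> 'w \<Rightarrow> real^'p"
    and \<kappa>\<^sub>x \<kappa>\<^sub>v b\<^sub>K \<alpha> lam b\<^sub>G_sq :: real and T :: nat
    and K1 :: "'a \<Rightarrow> real^'p^'m"
    and Ks :: "nat \<Rightarrow> 'w \<Rightarrow> 'a \<Rightarrow> real^'p^'m"
    and Kstar :: "'w \<Rightarrow> real^'p^'m"
  assumes P: "prob_space P"
    and D_pd: "positive_definite (transpose D ** D)"
    and x_gauss: "\<And>t. t \<ge> 1 \<Longrightarrow> centered_gaussian P V\<^sub>x\<^sub>x (x t)"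
    and v_gauss: "\<And>t. t \<ge> 1 \<Longrightarrow> centered_gaussian P V\<^sub>v\<^sub>v (v t)"
    and indep_xv: "\<And>t. t \<ge> 1 \<Longrightarrow> independent_rv P (x t) (v t)"
    and indep_time: "prob_space.indep_vars P (\<lambda>_. borel) (\<lambda>t w. (x t w, v t w)) {1..}"
    and x_cov: "\<And>t. t \<ge> 1 \<Longrightarrow> has_bochner_integral P (\<lambda>w. outer (x t w) (x t w)) V\<^sub>x\<^sub>x"
    and v_cov: "\<And>t. t \<ge> 1 \<Longrightarrow> has_bochner_integral P (\<lambda>w. outer (v t w) (v t w)) V\<^sub>v\<^sub>v"
    and x_fourth: "\<And>t. t \<ge> 1 \<Longrightarrow> integrable P (\<lambda>w. (x t w \<bullet> x t w)\<^sup>2)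
                       \<and> (\<integral>w. (x t w \<bullet> x t w)\<^sup>2 \<partial>P) \<le> \<kappa>\<^sub>x"
    and v_fourth: "\<And>t. t \<ge> 1 \<Longrightarrow> integrable P (\<lambda>w. (v t w \<bullet> v t w)\<^sup>2)
                       \<and> (\<integral>w. (v t w \<bullet> v t w)\<^sup>2 \<partial>P) \<le> \<kappa>\<^sub>v"
    and sigma_pos: "sigma_min (transpose D ** D) *
                      (sigma_min (C ** V\<^sub>x\<^sub>x ** transpose C) + sigma_min V\<^sub>v\<^sub>v) > 0"
    and \<alpha>_eq: "\<alpha> = 2 * sigma_min (transpose D ** D) *
                      (sigma_min (C ** V\<^sub>x\<^sub>x ** transpose C) + sigma_min V\<^sub>v\<^sub>v)"
    and lam: "0 < lam" "lam \<le> \<alpha>"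
    and T: "T \<ge> 1"
    and K1: "\<And>i. K1 i \<in> block_space own_u own_y i" "opnorm (Diag K1) \<le> b\<^sub>K"
    and run: "\<And>w. w \<in> space P \<Longrightarrow>
                partial_gradient_run own_u own_y H D C b\<^sub>K (\<lambda>t. 1 / (lam * real t)) T
                  (\<lambda>t. x t w) (\<lambda>t. v t w) K1 (\<lambda>t. Ks t w)"
    and Kstar_meas: "Kstar \<in> borel_measurable P"
    and Kstar: "\<And>w. w \<in> space P \<Longrightarrow>
                  is_arg_min (\<lambda>K. \<Sum>t=1..T. loss H D C (x t w) (v t w) K)
                    (\<lambda>K. K \<in> block_diagonal own_u own_y \<and> opnorm K \<le> b\<^sub>K) (Kstar w)"
    and b\<^sub>G_sq_eq: "b\<^sub>G_sq = 4 * (opnorm D)\<^sup>2 * (opnorm H + b\<^sub>K * opnorm D * (opnorm C + 1))\<^sup>2 *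
                     (opnorm C + 1)\<^sup>2 * (\<kappa>\<^sub>x + 2 * trace V\<^sub>x\<^sub>x * trace V\<^sub>v\<^sub>v + \<kappa>\<^sub>v)"
  shows "(\<forall>t\<in>{1..T}. integrable P (\<lambda>w. loss H D C (x t w) (v t w) (Diag (Ks t w))
                                        - loss H D C (x t w) (v t w) (Kstar w)))
       \<and> (\<Sum>t=1..T. \<integral>w. (loss H D C (x t w) (v t w) (Diag (Ks t w))
                            - loss H D C (x t w) (v t w) (Kstar w)) \<partial>P)
         \<le> b\<^sub>G_sq / (2 * lam) * (1 + ln (real T))"
proof -
  interpret prob_space P by (rule P)
  define s where "s = sigma_min (transpose D ** D)"
  define \<sigma> where "\<sigma> = sigma_min (C ** V\<^sub>x\<^sub>x ** transpose C) + sigma_min V\<^sub>v\<^sub>v"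
  have DD: "u \<bullet> ((transpose D ** D) *v u) = (norm (D *v u))\<^sup>2" for u
  proof -
    have "(transpose D ** D) *v u = (D *v u) v* D"
      by (simp only: matrix_vector_mul_assoc[symmetric] transpose_matrix_vector)
    then have "u \<bullet> ((transpose D ** D) *v u) = ((D *v u) v* D) \<bullet> u" by (simp only: inner_commute)
    then show ?thesis by (simp only: dot_lmul_matrix power2_norm_eq_inner)
  qed
  have psd_D: "positive_semidefinite (transpose D ** D)"
    unfolding positive_semidefinite_def DD using D_pd by (simp add: positive_definite_def)
  have psd_x: "positive_semidefinite V\<^sub>x\<^sub>x" and psd_v: "positive_semidefinite V\<^sub>v\<^sub>v"
    using x_gauss[of 1] v_gauss[of 1] by (simp_all add: centered_gaussian_def)
  have CC: "u \<bullet> ((C ** V\<^sub>x\<^sub>x ** transpose C) *v u) = (u v* C) \<bullet> (V\<^sub>x\<^sub>x *v (u v* C))" for u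
    by (simp only: matrix_vector_mul_assoc[symmetric] transpose_matrix_vector dot_lmul_matrix)
  have psd_C: "positive_semidefinite (C ** V\<^sub>x\<^sub>x ** transpose C)"
    unfolding positive_semidefinite_def CC
  proof (intro conjI allI)
    show "transpose (C ** V\<^sub>x\<^sub>x ** transpose C) = C ** V\<^sub>x\<^sub>x ** transpose C"
      using psd_x by (simp add: positive_semidefinite_def matrix_transpose_mul matrix_mul_assoc)
  qed (use psd_x in \<open>simp add: positive_semidefinite_def\<close>)
  have "0 \<le> s" "0 \<le> \<sigma>"
    using sigma_min_quadratic_form(1)[OF psd_D] sigma_min_quadratic_form(1)[OF psd_C]
      sigma_min_quadratic_form(1)[OF psd_v] by (simp_all add: s_def \<sigma>_def)
  moreover have "0 < s * \<sigma>" using sigma_pos by (simp only: s_def \<sigma>_def)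
  ultimately have pos: "0 < s" "0 < \<sigma>" by (auto simp: zero_less_mult_iff)
  have s_le: "s * (norm u)\<^sup>2 \<le> (norm (D *v u))\<^sup>2" for u
    using sigma_min_quadratic_form(2)[OF psd_D, of u] by (simp only: DD s_def)
  have \<sigma>_le: "\<sigma> * (norm u)\<^sup>2 \<le> (u v* C) \<bullet> (V\<^sub>x\<^sub>x *v (u v* C)) + u \<bullet> (V\<^sub>v\<^sub>v *v u)" for u
    using add_mono[OF sigma_min_quadratic_form(2)[OF psd_C, of u] sigma_min_quadratic_form(2)[OF psd_v, of u]]
    by (simp only: CC \<sigma>_def distrib_right)
  have b: "0 \<le> b\<^sub>K" using opnorm_nonneg[of "Diag K1"] K1(2) by linarith
  interpret L: team_learning P own_u own_y H D C V\<^sub>x\<^sub>x V\<^sub>v\<^sub>v x v \<kappa>\<^sub>x \<kappa>\<^sub>v b\<^sub>K s \<sigma> lam K1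
  proof (intro team_learning.intro team_problem.intro team_problem_axioms.intro team_learning_axioms.intro)
    show "prob_space P" "0 < s" "0 < \<sigma>" "0 \<le> b\<^sub>K" "0 < lam" by (fact P pos b lam(1))+
    show "integrable P (\<lambda>w. (x t w \<bullet> x t w)\<^sup>2) \<and> (\<integral>w. (x t w \<bullet> x t w)\<^sup>2 \<partial>P) \<le> \<kappa>\<^sub>x"
      and "integrable P (\<lambda>w. (v t w \<bullet> v t w)\<^sup>2) \<and> (\<integral>w. (v t w \<bullet> v t w)\<^sup>2 \<partial>P) \<le> \<kappa>\<^sub>v" if "t \<ge> 1" for t
      using x_fourth[OF that] v_fourth[OF that] by blast+
    show "s * (norm u)\<^sup>2 \<le> (norm (D *v u))\<^sup>2" for u by (rule s_le)
    show "\<sigma> * (norm u)\<^sup>2 \<le> (u v* C) \<bullet> (V\<^sub>x\<^sub>x *v (u v* C)) + u \<bullet> (V\<^sub>v\<^sub>v *v u)" for u by (rule \<sigma>_le)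
    show "gaussian_sequence P (\<lambda>t w. (x t w, v t w)) (joint_covariance V\<^sub>x\<^sub>x V\<^sub>v\<^sub>v)"
      by (rule gaussian_sequence_pair[OF P x_gauss v_gauss indep_xv indep_time])
    show "lam \<le> 2 * s * \<sigma>" using lam(2) by (simp only: \<alpha>_eq s_def \<sigma>_def)
    show "K1 i \<in> block_ball own_u own_y b\<^sub>K i" for i
      using K1(1)[of i] K1(2) opnorm_Diag_le_iff[of K1 own_u own_y b\<^sub>K] K1(1) by (auto simp: block_ball_def)
  qed
  have Kstar_W: "Kstar w \<in> L.W" if "w \<in> space P" for w
    using Kstar[OF that] by (simp add: is_arg_min_def L.W_def)
  have gain: "Diag (Ks (Suc n) w) = L.Kn n w" if "w \<in> space P" "n < T" for n w
    using gains_run[OF run[OF that(1)], of n] that(2)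
    by (simp add: L.Kn_def L.gn_def L.\<eta>_def[abs_def])
  have diff: "loss H D C (x (Suc n) w) (v (Suc n) w) (Diag (Ks (Suc n) w)) - loss H D C (x (Suc n) w) (v (Suc n) w) (Kstar w)
      = (norm (L.Z (L.Kn n w) (Suc n) w))\<^sup>2 - (norm (L.Z (Kstar w) (Suc n) w))\<^sup>2" if "w \<in> space P" "n < T" for n w
    by (simp only: gain[OF that] L.loss_eq)
  have int: "integrable P (\<lambda>w. (norm (L.Z (L.Kn n w) (Suc n) w))\<^sup>2 - (norm (L.Z (Kstar w) (Suc n) w))\<^sup>2)" for n
    using Kstar_W
    by (intro Bochner_Integration.integrable_diff L.integrable_loss_Kn L.integrable_loss Kstar_meas) (auto simp: L.W_def)
  show ?thesis
  proof (intro conjI ballI)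
    fix t assume "t \<in> {1..T}"
    then obtain n where n: "t = Suc n" "n < T" by (cases t) auto
    show "integrable P (\<lambda>w. loss H D C (x t w) (v t w) (Diag (Ks t w)) - loss H D C (x t w) (v t w) (Kstar w))"
      unfolding n(1) using int[of n] by (subst Bochner_Integration.integrable_cong[OF refl diff[OF _ n(2)]]) auto
  next
    have "(\<Sum>t=1..T. \<integral>w. (loss H D C (x t w) (v t w) (Diag (Ks t w)) - loss H D C (x t w) (v t w) (Kstar w)) \<partial>P)
        = (\<Sum>n<T. \<integral>w. (norm (L.Z (L.Kn n w) (Suc n) w))\<^sup>2 - (norm (L.Z (Kstar w) (Suc n) w))\<^sup>2 \<partial>P)"
      unfolding One_nat_def sum.atLeast1_atMost_eq
      by (intro sum.cong refl Bochner_Integration.integral_cong diff) auto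
    also have "\<dots> \<le> L.B * (1 + ln (real T))" by (rule L.regret_bound[OF T Kstar_meas Kstar_W])
    also have "L.B = b\<^sub>G_sq / (2 * lam)"
      by (simp add: L.B_def L.A_def L.E4_def b\<^sub>G_sq_eq)
    finally show "(\<Sum>t=1..T. \<integral>w. (loss H D C (x t w) (v t w) (Diag (Ks t w)) - loss H D C (x t w) (v t w) (Kstar w)) \<partial>P)
        \<le> b\<^sub>G_sq / (2 * lam) * (1 + ln (real T))" .
  qed
qed

end
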